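(* Let $T>0$, $1\le p\le\infty$, and let $f:[0,T]\times[0,+\infty)\times\mathbb{R}\to\mathbb{R}$ be an $L^p$-Carathéodory function satisfying the conditions $(f_1)$, $(f_2)$, $(f_3)$ listed in the context. Suppose that there exist two constants $r,R>0$, with $r\neq R$, such that the following hypotheses hold. $(H_r)$ The inequality $$\int_0^T f(t,a+at,a)\,dt<0,\qquad \text{for } a=\frac{r}{1+T},$$ holds. Moreover, for every $\vartheta$ with $0<\vartheta\le 1$, any solution $u$ of the problem $$u''+\vartheta f(t,u,u')=0,\quad 0<t<T,\qquad u'(0)=u'(T)=u(0),$$ such that $u(t)>0$ for all $t\in[0,T]$, satisfies $\|u\|_\infty\neq r$. $(H_R)$ There exist a non-negative function $v\in L^p([0,T],\mathbb{R})$ with $v\not\equiv0$ and a constant $\alpha_0>0$ such that, for every $\alpha\in[0,\alpha_0]$, every solution $u\ge 0$ of the problem $$u''+f(t,u,u')+\alpha v(t)=0,\quad 0<t<T,\qquad u'(0)=u'(T)=u(0),$$ satisfies $\|u\|_\infty\neq R$. Moreover, for $\alpha=\alpha_0$ this problem has no solution $u$ with $0\le u(t)\le R$ for every $t\in[0,T]$. Then the problem $$u''+f(t,u,u')=0,\quad 0<t<T,\qquad u'(0)=u'(T)=u(0),$$ has at least one positive solution $u$ (that is, a solution with $u(t)>0$ for all $t\in[0,T]$) such that $$\min\{r,R\}<\max_{t\in[0,T]}u(t)<\max\{r,R\}.$$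
   Context: Solutions: a solution of any of the boundary value problems is a function $u:[0,T]\to\mathbb{R}$ of class $C^1$ such that $u'$ is absolutely continuous, $u$ satisfies the differential equation for almost every $t\in[0,T]$, and $u$ satisfies the boundary conditions. $\|u\|_\infty=\max_{t\in[0,T]}|u(t)|$. $L^p$-Carathéodory (standard meaning): $f(\cdot,s,\xi)$ is measurable for all $(s,\xi)$, $f(t,\cdot,\cdot)$ is continuous for almost every $t$, and for every $c>0$ there is $g_c\in L^p([0,T])$ with $|f(t,s,\xi)|\le g_c(t)$ for almost every $t$ and all $(s,\xi)$ in the domain with $|s|\le c$, $|\xi|\le c$. Conditions on $f$: $(f_1)$ $f(t,0,\xi)=0$ for almost every $t\in[0,T]$ and every $\xi\in\mathbb{R}$. $(f_2)$ There exist a non-negative function $k\in L^1([0,T])$ and a constant $\rho>0$ such that $|f(t,s,\xi)|\le k(t)(|s|+|\xi|)$ for almost every $t\in[0,T]$, every $0\le s\le\rho$ and every $|\xi|\le\rho$. $(f_3)$ (Bernstein–Nagumo type condition) For each $\eta>0$ there exist a continuous function $\phi=\phi_\eta:[0,+\infty)\to[0,+\infty)$ with $\int^{\infty}\frac{\xi^{(p-1)/p}}{\phi(\xi)}\,d\xi=\infty$ and $\liminf_{\xi\to+\infty}\phi(\xi)>0$, and a function $\psi=\psi_\eta\in L^p([0,T],[0,+\infty))$ such that $|f(t,s,\xi)|\le\psi(t)\phi(|\xi|)$ for almost every $t\in[0,T]$, all $s\in[0,\eta]$ and all $\xi\in\mathbb{R}$. (Here $(p-1)/p$ is read as $1$ if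 $p=\infty$, and $\int^\infty$ denotes the integral over a neighbourhood of $+\infty$.) *)

theory Defs
  imports "HOL-Analysis.Analysis"
begin

text \<open>Functions on \<open>[0,T]\<close> are represented by functions on all of \<open>real\<close>; their values
  outside \<open>[0,T]\<close> (and, for \<open>f t s x\<close>, at \<open>s < 0\<close>) are never constrained or used.\<close>

definition in_Lp :: "ennreal \<Rightarrow> real \<Rightarrow> (real \<Rightarrow> real) \<Rightarrow> bool" where
  "in_Lp p T g \<longleftrightarrow>
     g \<in> borel_measurable (lebesgue_on {0..T}) \<and>
     (if p = \<infinity> then \<exists>C. AE t in lebesgue_on {0..T}. \<bar>g t\<bar> \<le> C
      else integrable (lebesgue_on {0..T}) (\<lambda>t. \<bar>g t\<bar> powr enn2real p))"

text \<open>Elements of \<open>L\<^sup>p\<close> are determined almost everywhere only, so their non-negativity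
  is understood almost everywhere.\<close>

definition in_Lp_nonneg :: "ennreal \<Rightarrow> real \<Rightarrow> (real \<Rightarrow> real) \<Rightarrow> bool" where
  "in_Lp_nonneg p T g \<longleftrightarrow> in_Lp p T g \<and> (AE t in lebesgue_on {0..T}. 0 \<le> g t)"

definition Lp_Caratheodory :: "ennreal \<Rightarrow> real \<Rightarrow> (real \<Rightarrow> real \<Rightarrow> real \<Rightarrow> real) \<Rightarrow> bool" where
  "Lp_Caratheodory p T f \<longleftrightarrow>
     (\<forall>s\<ge>0. \<forall>\<xi>. (\<lambda>t. f t s \<xi>) \<in> borel_measurable (lebesgue_on {0..T})) \<and>
     (AE t in lebesgue_on {0..T}. continuous_on ({0..} \<times> UNIV) (\<lambda>(s, \<xi>). f t s \<xi>)) \<and>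
     (\<forall>c>0. \<exists>g. in_Lp p T g \<and>
        (AE t in lebesgue_on {0..T}. \<forall>s \<xi>. 0 \<le> s \<and> \<bar>s\<bar> \<le> c \<and> \<bar>\<xi>\<bar> \<le> c \<longrightarrow> \<bar>f t s \<xi>\<bar> \<le> g t))"

definition cond_f1 :: "real \<Rightarrow> (real \<Rightarrow> real \<Rightarrow> real \<Rightarrow> real) \<Rightarrow> bool" where
  "cond_f1 T f \<longleftrightarrow> (AE t in lebesgue_on {0..T}. \<forall>\<xi>. f t 0 \<xi> = 0)"

definition cond_f2 :: "real \<Rightarrow> (real \<Rightarrow> real \<Rightarrow> real \<Rightarrow> real) \<Rightarrow> bool" where
  "cond_f2 T f \<longleftrightarrow>
     (\<exists>k \<rho>. in_Lp_nonneg 1 T k \<and> 0 < \<rho> \<and>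
        (AE t in lebesgue_on {0..T}. \<forall>s \<xi>. 0 \<le> s \<and> s \<le> \<rho> \<and> \<bar>\<xi>\<bar> \<le> \<rho> \<longrightarrow>
           \<bar>f t s \<xi>\<bar> \<le> k t * (\<bar>s\<bar> + \<bar>\<xi>\<bar>)))"

definition nagumo_exponent :: "ennreal \<Rightarrow> real" where
  "nagumo_exponent p = (if p = \<infinity> then 1 else (enn2real p - 1) / enn2real p)"

text \<open>The divergence of the integral at \<open>+\<infinity>\<close> is stated for all sufficiently large lower limits
  \<open>M\<close>; as \<open>\<phi>\<close> is eventually bounded away from \<open>0\<close>, this avoids possible zeros of \<open>\<phi>\<close>, and it does
  not matter which large \<open>M\<close> is taken.\<close>

definition cond_f3 :: "ennreal \<Rightarrow> real \<Rightarrow> (real \<Rightarrow> real \<Rightarrow> real \<Rightarrow> real) \<Rightarrow> bool" where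
  "cond_f3 p T f \<longleftrightarrow>
     (\<forall>\<eta>>0. \<exists>\<phi> \<psi>.
        continuous_on {0..} \<phi> \<and> (\<forall>\<xi>\<ge>0. 0 \<le> \<phi> \<xi>) \<and>
        (\<forall>\<^sub>F M in at_top.
           (\<integral>\<^sup>+\<xi>\<in>{M..}. ennreal (\<xi> powr nagumo_exponent p / \<phi> \<xi>) \<partial>lborel) = \<infinity>) \<and>
        0 < Liminf at_top (\<lambda>\<xi>. ereal (\<phi> \<xi>)) \<and>
        in_Lp_nonneg p T \<psi> \<and>
        (AE t in lebesgue_on {0..T}. \<forall>s \<xi>. 0 \<le> s \<and> s \<le> \<eta> \<longrightarrow> \<bar>f t s \<xi>\<bar> \<le> \<psi> t * \<phi> \<bar>\<xi>\<bar>))"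

definition abs_continuous_on :: "real \<Rightarrow> real \<Rightarrow> (real \<Rightarrow> real) \<Rightarrow> bool" where
  "abs_continuous_on c d w \<longleftrightarrow>
     (\<forall>\<epsilon>>0. \<exists>\<delta>>0. \<forall>(n::nat) a b.
        (\<forall>i<n. c \<le> a i \<and> a i \<le> b i \<and> b i \<le> d) \<longrightarrow>
        disjoint_family_on (\<lambda>i. {a i<..<b i}) {..<n} \<longrightarrow>
        (\<Sum>i<n. b i - a i) < \<delta> \<longrightarrow>
        (\<Sum>i<n. \<bar>w (b i) - w (a i)\<bar>) < \<epsilon>)"

text \<open>\<open>u\<close> solves \<open>u'' + F(t,u,u') = 0\<close> on \<open>[0,T]\<close> with \<open>u'(0) = u'(T) = u(0)\<close>; here \<open>du\<close> is \<open>u'\<close>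
  (one-sided at the end points).\<close>

definition bvp_solution :: "real \<Rightarrow> (real \<Rightarrow> real \<Rightarrow> real \<Rightarrow> real) \<Rightarrow> (real \<Rightarrow> real) \<Rightarrow> bool" where
  "bvp_solution T F u \<longleftrightarrow>
     (\<exists>du.
        (\<forall>t\<in>{0..T}. (u has_real_derivative du t) (at t within {0..T})) \<and>
        continuous_on {0..T} du \<and>
        abs_continuous_on 0 T du \<and>
        (AE t in lebesgue_on {0..T}. \<exists>ddu.
           (du has_real_derivative ddu) (at t within {0..T}) \<and> ddu + F t (u t) (du t) = 0) \<and>
        du 0 = u 0 \<and> du T = u 0)"

text \<open>For continuous \<open>u\<close> this supremum is the maximum of \<open>\<bar>u\<bar>\<close> on \<open>[0,T]\<close>.\<close>

definition sup_norm :: "real \<Rightarrow> (real \<Rightarrow> real) \<Rightarrow> real" where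
  "sup_norm T u = (SUP t\<in>{0..T}. \<bar>u t\<bar>)"

definition hyp_Hr :: "real \<Rightarrow> (real \<Rightarrow> real \<Rightarrow> real \<Rightarrow> real) \<Rightarrow> real \<Rightarrow> bool" where
  "hyp_Hr T f r \<longleftrightarrow>
     (let a = r / (1 + T) in (LINT t|lebesgue_on {0..T}. f t (a + a * t) a) < 0) \<and>
     (\<forall>\<theta> u. 0 < \<theta> \<and> \<theta> \<le> 1 \<and> bvp_solution T (\<lambda>t s \<xi>. \<theta> * f t s \<xi>) u \<and> (\<forall>t\<in>{0..T}. 0 < u t) \<longrightarrow>
        sup_norm T u \<noteq> r)"

definition hyp_HR :: "ennreal \<Rightarrow> real \<Rightarrow> (real \<Rightarrow> real \<Rightarrow> real \<Rightarrow> real) \<Rightarrow> real \<Rightarrow> bool" where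
  "hyp_HR p T f R \<longleftrightarrow>
     (\<exists>v \<alpha>0. in_Lp_nonneg p T v \<and> \<not> (AE t in lebesgue_on {0..T}. v t = 0) \<and> 0 < \<alpha>0 \<and>
        (\<forall>\<alpha> u. 0 \<le> \<alpha> \<and> \<alpha> \<le> \<alpha>0 \<and> bvp_solution T (\<lambda>t s \<xi>. f t s \<xi> + \<alpha> * v t) u \<and>
           (\<forall>t\<in>{0..T}. 0 \<le> u t) \<longrightarrow> sup_norm T u \<noteq> R) \<and>
        \<not> (\<exists>u. bvp_solution T (\<lambda>t s \<xi>. f t s \<xi> + \<alpha>0 * v t) u \<and>
           (\<forall>t\<in>{0..T}. 0 \<le> u t \<and> u t \<le> R)))"

end

theory Submission
  imports Defs "HOL-Complex_Analysis.Great_Picard"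
begin

text \<open>Shooting replaces degree theory. A solution is fixed by \<open>a = u(0) = u'(0)\<close>, and the remaining
  condition \<open>u'(T) = a\<close> says that the integral of the nonlinearity along the trajectory vanishes.
  A parameter \<open>l\<close> in \<open>[-1,1]\<close> joins the two homotopies: \<open>\<theta> = 1 + l\<close> for \<open>l \<le> 0\<close> and
  \<open>\<alpha> = \<alpha>0 l\<close> for \<open>l \<ge> 0\<close>. Initial value problems need not be uniquely solvable, so trajectories are
  replaced by Euler polygons; their defect \<open>G(l,a)\<close> and maximum \<open>M(l,a)\<close> are continuous functions on the
  plane. There \<open>G > 0\<close> for \<open>a < 0\<close>, whereas at \<open>l = -1\<close> the defect approximates an integral that is
  negative for \<open>a = r/(1+T)\<close>; unicoherence of the plane then yields a zero of \<open>G\<close> at which \<open>l\<close> and \<open>M\<close>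
  are either excluded by the hypotheses or as wanted. Refining the mesh and using compactness, these
  zeros converge to a solution of a truncated problem, and the Nagumo condition removes the truncation.\<close>

subsection \<open>Zeros of a function of two real variables\<close>


text \<open>The bound on the maximum is \<open>r\<close> for \<open>l \<le> 0\<close> and
  \<open>R\<close> for \<open>l \<ge> 0\<close>, so the admissible region has a wall at
  \<open>l = 0\<close>, between the heights \<open>r\<close> and \<open>R\<close>. Zeros of the
  defect on the rest of its frontier are ruled out by the two a priori hypotheses, and at
  \<open>l = 1\<close> the region contains none at all. At \<open>l = -1\<close> the defect changes
  sign inside the region, in the limit of fine meshes. The separation between positive and negative
  defect that starts there can leave only through the wall, and a zero on the wall is the solution
  sought. Nothing depends on which of \<open>r\<close> and \<open>R\<close> is larger. Two obstacles
  shape the details. Time dependence is only measurable, so the polygons freeze position and slope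
  on each cell but integrate exactly in time. And zeros are found only at fixed mesh, so everything
  said about them is kept non-strict, in order to survive the limit; strictness returns at the very
  end, when a maximum equal to \<open>r\<close> or \<open>R\<close> is excluded.\<close>

text \<open>If the conclusion failed, take the component \<open>E\<close> of \<open>{G \<ge> 0}\<close> in the region \<open>D\<close> (\<open>M \<le> r\<close> on the left,
  \<open>M \<le> R\<close> on the right) that contains the lower half plane, and the component \<open>C\<close> of its complement that
  contains the points with large \<open>a\<close>. The connected set \<open>frontier C\<close> would be split into zeros of \<open>G\<close>, met
  on the line \<open>l = -1\<close>, and points of \<open>frontier D\<close>, met on the line \<open>l = 1\<close>.\<close>

lemma planar_zero_alternative:
  fixes G M :: "real \<times> real \<Rightarrow> real" and r R a0 :: real
  assumes contG: "continuous_on UNIV G" and contM: "continuous_on UNIV M"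
    and r: "0 < r" and R: "0 < R"
    and G_pos: "\<And>l a. a < 0 \<Longrightarrow> 0 < G (l, a)" and M_nonpos: "\<And>l a. a < 0 \<Longrightarrow> M (l, a) \<le> 0"
    and M_ge: "\<And>l a. a \<le> M (l, a)"
    and G_clamp: "\<And>l a. G (l, a) = G (max (-1) (min 1 l), a)"
    and M_clamp: "\<And>l a. M (l, a) = M (max (-1) (min 1 l), a)"
    and M_lt: "\<And>a. a < a0 \<Longrightarrow> M (-1, a) < r" and M_gt: "\<And>a. a > a0 \<Longrightarrow> M (-1, a) > r"
  shows "\<exists>l a. -1 \<le> l \<and> l \<le> 1 \<and>
    (l = -1 \<and> a = a0 \<and> 0 \<le> G (l, a) \<or>
     G (l, a) = 0 \<and> 0 \<le> a \<and>
       (l \<le> 0 \<and> M (l, a) = r \<or> 0 \<le> l \<and> M (l, a) = R \<or>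
        l = 0 \<and> min r R \<le> M (l, a) \<and> M (l, a) \<le> max r R \<or> l = 1 \<and> M (l, a) \<le> R))"
proof (rule ccontr)
  assume none: "\<not> ?thesis"
  have G_neg: "G (-1, a0) < 0"
  proof (rule ccontr)
    assume "\<not> G (-1, a0) < 0"
    then show False
      using none[simplified not_ex, rule_format, of "-1" a0] by simp
  qed
  have none': "False" if "-1 \<le> l" "l \<le> 1" "G (l, a) = 0"
      "l \<le> 0 \<and> M (l, a) = r \<or> 0 \<le> l \<and> M (l, a) = R \<or>
        l = 0 \<and> min r R \<le> M (l, a) \<and> M (l, a) \<le> max r R \<or> l = 1 \<and> M (l, a) \<le> R" for l a
  proof -
    have "0 \<le> a" using G_pos[of a l] that(3) by (cases "a < 0") auto
    with none that show False by blast
  qed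
  \<comment> \<open>On the line \<open>l = 0\<close> both pieces contribute, so \<open>M p\<close>
    may go up to the larger of \<open>r\<close> and \<open>R\<close>; frontier points on that line
    have \<open>M\<close> between the two values.\<close>
  define D where "D = {p. fst p \<le> 0 \<and> M p \<le> r} \<union> {p. 0 \<le> fst p \<and> M p \<le> R}"
  have closed_D: "closed D"
    unfolding D_def Collect_conj_eq
    by (intro closed_Un closed_Int closed_Collect_le contM continuous_on_const continuous_on_fst continuous_on_id)
  have lower: "p \<in> D \<and> 0 < G p" if "snd p < 0" for p
  proof (cases p)
    case (Pair l a)
    then show ?thesis using that M_nonpos[of a l] G_pos[of a l] r R by (auto simp: D_def)
  qed
  have intD1: "p \<in> interior D" if "fst p < 0" "M p < r" for p
  proof (rule interiorI)
    show "open ({p. fst p < 0} \<inter> {p. M p < r})"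
      by (intro open_Int open_Collect_less contM continuous_on_const continuous_on_fst continuous_on_id)
  qed (use that in \<open>auto simp: D_def\<close>)
  have intD2: "p \<in> interior D" if "fst p > 0" "M p < R" for p
  proof (rule interiorI)
    show "open ({p. 0 < fst p} \<inter> {p. M p < R})"
      by (intro open_Int open_Collect_less contM continuous_on_const continuous_on_fst continuous_on_id)
  qed (use that in \<open>auto simp: D_def\<close>)
  have intD3: "p \<in> interior D" if "M p < min r R" for p
  proof (rule interiorI)
    show "open {p. M p < min r R}"
      by (intro open_Int open_Collect_less contM continuous_on_const continuous_on_fst continuous_on_id)
  qed (use that in \<open>auto simp: D_def\<close>)
  \<comment> \<open>\<open>D\<close> extends over the whole plane, while only \<open>l\<close> in
    [-1,1] has a meaning. Clamping \<open>l\<close> changes neither \<open>G\<close> nor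
    \<open>M\<close>, so a zero anywhere on the frontier yields a forbidden one in the
    strip.\<close>
  have G_frontier: "G p \<noteq> 0" if "p \<in> D" "p \<notin> interior D" for p
  proof
    assume "G p = 0"
    obtain l a where p: "p = (l, a)" by fastforce
    define l' where "l' = max (-1) (min 1 l)"
    have l': "-1 \<le> l'" "l' \<le> 1" "G (l', a) = 0" "M (l', a) = M p"
      using \<open>G p = 0\<close> G_clamp[of l a] M_clamp[of l a] p by (auto simp: l'_def)
    consider "l < 0" | "l = 0" | "l > 0" by linarith
    then show False
    proof cases
      case 1
      then have "M p = r" using intD1[of p] that p by (force simp: D_def)
      then show False using none'[OF l'(1-3)] l' 1 by (auto simp: l'_def)
    next
      case 2
      then have "min r R \<le> M p" "M p \<le> max r R" using intD3[of p] that p by (force simp: D_def)+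
      then show False using none'[OF l'(1-3)] l' 2 by (auto simp: l'_def)
    next
      case 3
      then have "M p = R" using intD2[of p] that p by (force simp: D_def)
      then show False using none'[OF l'(1-3)] l' 3 by (auto simp: l'_def)
    qed
  qed
  define P where "P = D \<inter> {p. 0 \<le> G p}"
  have closed_P: "closed P"
    unfolding P_def by (intro closed_Int closed_D closed_Collect_le contG continuous_on_const)
  define E where "E = connected_component_set P (0, -1)"
  have base_P: "(0, -1) \<in> P" using lower[of "(0, -1)"] by (auto simp: P_def)
  have closed_E: "closed E" unfolding E_def by (rule closed_connected_component[OF closed_P])
  have E_P: "E \<subseteq> P" unfolding E_def by (rule connected_component_subset)
  have conn_E: "connected E" unfolding E_def by (rule connected_connected_component)
  have lowE: "(l, a) \<in> E" if "a < 0" for l a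
  proof -
    have "{p::real\<times>real. snd p < 0} \<subseteq> E"
      unfolding E_def
    proof (rule connected_component_maximal)
      have "{p::real\<times>real. snd p < 0} = UNIV \<times> {..<0}" by auto
      then show "connected {p::real\<times>real. snd p < 0}"
        by (simp add: connected_Times)
      show "{p::real\<times>real. snd p < 0} \<subseteq> P" using lower by (auto simp: P_def intro: less_imp_le)
    qed auto
    with that show ?thesis by auto
  qed
  \<comment> \<open>Above the height \<open>max r R\<close> the estimate \<open>a \<le> M\<close>
    keeps points out of \<open>D\<close>, so the line at height \<open>A\<close> lies in one
    component of the complement of \<open>E\<close>. The term \<open>a0\<close> lets a vertical
    segment from \<open>a0\<close> at \<open>l = -1\<close> climb to that height.\<close>
  define A where "A = max (max r R) a0 + 1"
  have A: "A > max r R" "A > r" "A > R" "A \<ge> a0" "A \<ge> -1"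
    using r unfolding A_def by linarith+
  have top: "p \<notin> E" if "snd p > max r R" for p
    using that M_ge[of "snd p" "fst p"] E_P by (auto simp: P_def D_def)
  have leftE: "(-1, a) \<notin> E" if "a \<ge> a0" for a
  proof (cases "a = a0")
    case True then show ?thesis using G_neg E_P by (auto simp: P_def)
  next
    case False then show ?thesis using M_gt[of a] that E_P by (auto simp: P_def D_def)
  qed
  define C where "C = connected_component_set (-E) (0, A)"
  have "(0, A) \<in> -E" using top[of "(0, A)"] by (auto simp: A)
  then have C: "C \<in> components (-E)" unfolding C_def by (rule componentsI)
  have topC: "(l, A) \<in> C" for l
  proof -
    have "{p::real\<times>real. snd p > max r R} \<subseteq> C"
      unfolding C_def
    proof (rule connected_component_maximal)
      have "{p::real\<times>real. snd p > max r R} = UNIV \<times> {max r R<..}" by auto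
      then show "connected {p::real\<times>real. snd p > max r R}"
        by (simp add: connected_Times)
    qed (use top in \<open>auto simp: A\<close>)
    then show ?thesis by (auto simp: A)
  qed
  have "C \<subseteq> -E" using C by (rule in_components_subset)
  have leftC: "(-1, a0) \<in> C"
  proof -
    have "{-1::real} \<times> {a0..A} \<subseteq> connected_component_set (-E) (-1, A)"
      by (rule connected_component_maximal)
         (use leftE in \<open>auto simp: A connected_Times\<close>)
    also have "\<dots> = C"
      using topC[of "-1"] unfolding C_def by (metis connected_component_eq)
    finally show ?thesis by (auto simp: A)
  qed
  have frE: "frontier C \<subseteq> E"
    by (rule frontier_of_components_closed_complement[OF closed_E C])
  \<comment> \<open>Unicoherence of the plane: a complementary component of a connected set has a
    connected frontier.\<close>
  have conn: "connected (frontier C)"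
    by (rule connected_frontier_component_complement[OF conn_E C])
  define Z1 where "Z1 = D \<inter> {p. G p = 0}"
  define Z2 where "Z2 = frontier D"
  have closed_Z: "closed Z1" "closed Z2"
    unfolding Z1_def Z2_def by (intro closed_Int closed_D closed_Collect_eq contG continuous_on_const frontier_closed)+
  have D_fr: "p \<notin> interior D" if "p \<in> Z2" for p using that by (auto simp: Z2_def frontier_def)
  have Z2D: "Z2 \<subseteq> D" unfolding Z2_def using closed_D by (simp add: frontier_subset_eq)
  have disj: "Z1 \<inter> Z2 = {}"
    using G_frontier D_fr by (auto simp: Z1_def)
  have cover: "frontier C \<subseteq> Z1 \<union> Z2"
  proof
    fix p assume p: "p \<in> frontier C"
    then have pE: "p \<in> E" using frE by auto
    then have pD: "p \<in> D" "0 \<le> G p" using E_P by (auto simp: P_def)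
    show "p \<in> Z1 \<union> Z2"
    proof (rule ccontr)
      \<comment> \<open>A ball around such a point inside \<open>P\<close> is connected and meets
        \<open>E\<close>, so it belongs to the component \<open>E\<close> and keeps \<open>C\<close>
        away from the point.\<close>
      assume np: "p \<notin> Z1 \<union> Z2"
      then have "p \<in> interior D" "0 < G p" using pD closure_subset[of D] by (auto simp: Z1_def Z2_def frontier_def)
      then have "p \<in> interior D \<inter> {p. 0 < G p}" by auto
      moreover have "open (interior D \<inter> {p. 0 < G p})"
        by (intro open_Int open_interior open_Collect_less contG continuous_on_const)
      ultimately obtain e where e: "e > 0" "ball p e \<subseteq> interior D \<inter> {p. 0 < G p}"
        by (meson open_contains_ball)
      have "ball p e \<subseteq> connected_component_set P p"
        by (rule connected_component_maximal)
           (use e interior_subset[of D] in \<open>auto simp: P_def\<close>)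
      also have "\<dots> = E" using pE unfolding E_def by (metis connected_component_eq)
      finally have "ball p e \<inter> C = {}" using \<open>C \<subseteq> -E\<close> by auto
      moreover have "p \<in> closure C" using p by (auto simp: frontier_def)
      ultimately show False using e(1)
        by (metis closure_approachable disjoint_iff dist_commute mem_ball)
    qed
  qed
  have line: "\<exists>a. a \<le> b \<and> (l, a) \<in> frontier C" if "(l, b) \<in> C" "b \<ge> -1" for l b
  proof -
    have 1: "(l, b) \<in> ({l} \<times> {-1..b}) \<inter> C" and 2: "(l, -1) \<in> ({l} \<times> {-1..b}) - C"
      using that lowE[of "-1" l] \<open>C \<subseteq> -E\<close> by auto
    have "({l} \<times> {-1..b}) \<inter> frontier C \<noteq> {}"
      by (rule connected_Int_frontier) (use 1 2 in \<open>blast+ | simp add: connected_Times\<close>)+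
    then show ?thesis by auto
  qed
  have "a0 \<ge> 0" using leftC lowE[of a0 "-1"] \<open>C \<subseteq> -E\<close> by force
  \<comment> \<open>On \<open>l = -1\<close> the crossing height lies below \<open>a0\<close>, where
    \<open>M < r\<close>; the point is interior to \<open>D\<close> and so must be a zero of
    \<open>G\<close>.\<close>
  have "Z1 \<inter> frontier C \<noteq> {}"
  proof -
    obtain a where a: "a \<le> a0" "(-1, a) \<in> frontier C" using line[OF leftC] \<open>a0 \<ge> 0\<close> by auto
    then have "a < a0" using frE leftE[of a] by force
    then have "(-1, a) \<in> interior D" using M_lt[of a] by (intro intD1) auto
    then show ?thesis using cover a D_fr by blast
  qed
  \<comment> \<open>On \<open>l = 1\<close> the assumption \<open>none\<close> excludes zeros with
    \<open>M \<le> R\<close>, so the crossing point lies on the frontier of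
    \<open>D\<close>.\<close>
  moreover have "Z2 \<inter> frontier C \<noteq> {}"
  proof -
    obtain a where a: "(1, a) \<in> frontier C" using line[OF topC[of 1]] r by (auto simp: A)
    then have "(1, a) \<in> D" using frE E_P by (auto simp: P_def)
    then have "M (1, a) \<le> R" by (auto simp: D_def)
    then have "(1, a) \<notin> Z1" using none'[of 1 a] by (auto simp: Z1_def)
    then show ?thesis using cover a by blast
  qed
  ultimately show False
    using conn closed_Z cover disj by (auto simp: connected_closed)
qed

subsection \<open>Indefinite Lebesgue integrals\<close>


lemma integral_diff_segment:
  fixes f :: "real \<Rightarrow> real"
  assumes "f integrable_on {a..b}" "a \<le> x" "x \<le> y" "y \<le> b"
  shows "integral {a..y} f - integral {a..x} f = integral {x..y} f"
proof -
  have "f integrable_on {a..y}" using assms integrable_subinterval_real[of f a b a y] by auto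
  from Henstock_Kurzweil_Integration.integral_combine[OF assms(2,3) this] show ?thesis by simp
qed

text \<open>Lebesgue's differentiation theorem for one fixed deviation \<open>e\<close>. Each bad
  \<open>x\<close> is the end point of arbitrarily short intervals whose Henstock error exceeds
  \<open>e\<close> times their length. Vitali's theorem extracts disjoint ones that cover almost all
  bad points; finitely many of them form a tagged partial division, and Henstock's lemma bounds
  their total length.\<close>

lemma negligible_integral_not_slope:
  fixes f :: "real \<Rightarrow> real"
  assumes f: "f integrable_on {a..b}" and e: "0 < e"
  shows "negligible {x \<in> {a..b}. \<forall>d>0. \<exists>y\<in>{a..b}. y \<noteq> x \<and> \<bar>y - x\<bar> < d \<and>
    e * \<bar>y - x\<bar> < \<bar>integral {a..y} f - integral {a..x} f - f x * (y - x)\<bar>}"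
    (is "negligible ?B")
  unfolding negligible_outer_le
proof (intro allI impI)
  fix \<epsilon> :: real assume \<epsilon>: "\<epsilon> > 0"
  have "e * \<epsilon> > 0" using e \<epsilon> by simp
  from Henstock_lemma[OF f[folded box_real(2)] this] obtain \<gamma> where \<gamma>: "gauge \<gamma>"
    and hen: "\<And>p. \<lbrakk>p tagged_partial_division_of (cbox a b); \<gamma> fine p\<rbrakk> \<Longrightarrow>
             sum (\<lambda>(x,k). norm(measure lborel k *\<^sub>R f x - integral k f)) p < e * \<epsilon>" by blast
  \<comment> \<open>The covering theorem speaks of balls, whereas the tag \<open>x\<close> is an end
    point of its interval. So intervals are indexed by pairs (tag, other end) and described by
    midpoint and half length.\<close>
  define c where "c = (\<lambda>(x::real, y). (x + y) / 2)"
  define rad where "rad = (\<lambda>(x::real, y). \<bar>y - x\<bar> / 2)"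
  define J where "J = (\<lambda>(x::real, y). {min x y..max x y})"
  define K where "K = {(x, y). x \<in> {a..b} \<and> y \<in> {a..b} \<and> y \<noteq> x \<and> J (x, y) \<subseteq> \<gamma> x \<and>
    e * \<bar>y - x\<bar> < \<bar>integral {a..y} f - integral {a..x} f - f x * (y - x)\<bar>}"
  have J_cball: "cball (c i) (rad i) = J i" for i
    by (cases i) (auto simp: c_def rad_def J_def dist_real_def abs_real_def field_simps split: if_splits)
  have rad_pos: "0 < rad i" if "i \<in> K" for i
    using that by (auto simp: K_def rad_def)
  have cover: "\<exists>i. i \<in> K \<and> x \<in> cball (c i) (rad i) \<and> rad i < d" if x: "x \<in> ?B" and d: "0 < d" for x d
  proof -
    obtain \<delta> where \<delta>: "\<delta> > 0" "ball x \<delta> \<subseteq> \<gamma> x"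
      using \<gamma> by (meson gauge_def open_contains_ball)
    have "min \<delta> d > 0" using \<delta> d by simp
    with x obtain y where y: "y \<in> {a..b}" "y \<noteq> x" "\<bar>y - x\<bar> < min \<delta> d"
      "e * \<bar>y - x\<bar> < \<bar>integral {a..y} f - integral {a..x} f - f x * (y - x)\<bar>" by blast
    have "J (x, y) \<subseteq> ball x \<delta>" using y(3) by (auto simp: J_def dist_real_def)
    then have "(x, y) \<in> K" using x y \<delta> by (auto simp: K_def)
    moreover have "x \<in> cball (c (x, y)) (rad (x, y))" unfolding J_cball by (auto simp: J_def)
    moreover have "rad (x, y) < d" using y(3) by (auto simp: rad_def)
    ultimately show ?thesis by blast
  qed
  obtain C where C': "countable C" "C \<subseteq> K"
     "pairwise (\<lambda>i j. disjnt (cball (c i) (rad i)) (cball (c j) (rad j))) C"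
     "negligible (?B - (\<Union>i \<in> C. cball (c i) (rad i)))"
    by (rule Vitali_covering_theorem_cballs[of K rad ?B c]) (use rad_pos cover in blast)+
  note C = C'[unfolded J_cball]
  have J_meas: "J i \<in> lmeasurable" for i
    by (cases i) (auto simp: J_def)
  have fin: "measure lebesgue (\<Union>i\<in>I. J i) \<le> \<epsilon>" if I: "I \<subseteq> C" "finite I" for I
  proof -
    define p where "p = (\<lambda>i. (fst i, J i)) ` I"
    have IK: "I \<subseteq> K" using I C by auto
    have J_ne: "J i \<noteq> {}" for i by (cases i) (auto simp: J_def)
    have inj: "inj_on (\<lambda>i. (fst i, J i)) I"
    proof (rule inj_onI)
      fix i j assume ij: "i \<in> I" "j \<in> I" "(fst i, J i) = (fst j, J j)"
      show "i = j"
      proof (rule ccontr)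
        assume "i \<noteq> j"
        then have "disjnt (J i) (J j)" using C(3) I ij by (meson pairwiseD subsetD)
        then show False using ij J_ne[of i] by (auto simp: disjnt_def)
      qed
    qed
    have "p tagged_partial_division_of (cbox a b)"
      unfolding tagged_partial_division_of_def
    proof (intro conjI allI impI)
      show "finite p" using I by (auto simp: p_def)
    next
      fix x k assume "(x, k) \<in> p"
      then obtain y where "(x, y) \<in> I" "k = J (x, y)" by (auto simp: p_def)
      then show "x \<in> k" "k \<subseteq> cbox a b" "\<exists>a b. k = cbox a b"
        using IK by (auto simp: K_def J_def)
    next
      fix x1 k1 x2 k2 assume *: "(x1, k1) \<in> p \<and> (x2, k2) \<in> p \<and> (x1, k1) \<noteq> (x2, k2)"
      then obtain i j where ij: "i \<in> I" "j \<in> I" "k1 = J i" "k2 = J j" "i \<noteq> j" by (auto simp: p_def)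
      then have "disjnt (J i) (J j)" using C(3) I by (meson pairwiseD subsetD)
      then show "interior k1 \<inter> interior k2 = {}"
        using ij interior_subset[of k1] interior_subset[of k2] by (auto simp: disjnt_def)
    qed
    moreover have "\<gamma> fine p" using IK by (fastforce simp: fine_def p_def K_def)
    ultimately have "sum (\<lambda>(x,k). norm(measure lborel k *\<^sub>R f x - integral k f)) p < e * \<epsilon>" by (rule hen)
    also have "sum (\<lambda>(x,k). norm(measure lborel k *\<^sub>R f x - integral k f)) p
        = (\<Sum>i\<in>I. \<bar>measure lborel (J i) * f (fst i) - integral (J i) f\<bar>)"
      unfolding p_def by (subst sum.reindex[OF inj]) (simp add: o_def)
    finally have 1: "(\<Sum>i\<in>I. \<bar>measure lborel (J i) * f (fst i) - integral (J i) f\<bar>) < e * \<epsilon>" .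
    have 2: "e * measure lebesgue (J i) \<le> \<bar>measure lborel (J i) * f (fst i) - integral (J i) f\<bar>" if "i \<in> I" for i
    proof -
      obtain x y where i: "i = (x, y)" by fastforce
      have xy: "x \<in> {a..b}" "y \<in> {a..b}"
        "e * \<bar>y - x\<bar> < \<bar>integral {a..y} f - integral {a..x} f - f x * (y - x)\<bar>"
        using that IK i by (auto simp: K_def)
      show ?thesis
      proof (cases "x \<le> y")
        case True
        then have "integral {a..y} f - integral {a..x} f = integral {x..y} f"
          using xy by (intro integral_diff_segment[OF f]) auto
        then show ?thesis using xy True by (simp add: i J_def abs_minus_commute mult.commute)
      next
        case False
        then have "integral {a..x} f - integral {a..y} f = integral {y..x} f"
          using xy by (intro integral_diff_segment[OF f]) auto
        then have "integral {a..y} f - integral {a..x} f - f x * (y - x) = (x - y) * f x - integral {y..x} f"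
          by (simp add: algebra_simps)
        then show ?thesis using xy False by (simp add: i J_def)
      qed
    qed
    have "e * measure lebesgue (\<Union>i\<in>I. J i) \<le> e * (\<Sum>i\<in>I. measure lebesgue (J i))"
      using e I J_meas by (intro mult_left_mono measure_UNION_le) (auto simp: fmeasurableD)
    also have "\<dots> \<le> (\<Sum>i\<in>I. \<bar>measure lborel (J i) * f (fst i) - integral (J i) f\<bar>)"
      unfolding sum_distrib_left by (intro sum_mono 2)
    finally have "e * measure lebesgue (\<Union>i\<in>I. J i) \<le> e * \<epsilon>" using 1 by linarith
    then show ?thesis using e by simp
  qed
  have U: "(\<Union>i\<in>C. J i) \<in> lmeasurable" "measure lebesgue (\<Union>i\<in>C. J i) \<le> \<epsilon>"
    using fmeasurable_UN_bound[OF C(1) J_meas fin] measure_UN_bound[OF C(1) J_meas fin] by auto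
  show "\<exists>U. ?B \<subseteq> U \<and> U \<in> lmeasurable \<and> measure lebesgue U \<le> \<epsilon>"
  proof (intro exI conjI)
    let ?U = "(\<Union>i\<in>C. J i) \<union> (?B - (\<Union>i\<in>C. J i))"
    show "?B \<subseteq> ?U" by blast
    show "?U \<in> lmeasurable"
      using U(1) negligible_imp_measurable[OF C(4)] by (rule fmeasurable.Un)
    show "measure lebesgue ?U \<le> \<epsilon>"
      using U(2) C(4) by (subst measure_Un_null_set) (auto simp: negligible_iff_null_sets fmeasurableD U(1))
  qed
qed

text \<open>The exceptional set is covered by the countably many bad sets for the deviations
  1/(n+1).\<close>

lemma negligible_integral_no_derivative:
  fixes f :: "real \<Rightarrow> real"
  assumes f: "f integrable_on {a..b}"
  shows "negligible {x \<in> {a..b}. \<not> ((\<lambda>t. integral {a..t} f) has_real_derivative f x) (at x within {a..b})}"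
proof -
  define B where "B = (\<lambda>e. {x \<in> {a..b}. \<forall>d>0. \<exists>y\<in>{a..b}. y \<noteq> x \<and> \<bar>y - x\<bar> < d \<and>
    e * \<bar>y - x\<bar> < \<bar>integral {a..y} f - integral {a..x} f - f x * (y - x)\<bar>})"
  have "negligible (B (inverse (real (Suc n))))" for n
    unfolding B_def by (rule negligible_integral_not_slope[OF f]) simp
  then have "negligible (\<Union>n. B (inverse (real (Suc n))))"
    by (intro negligible_countable_Union) auto
  moreover have "((\<lambda>t. integral {a..t} f) has_real_derivative f x) (at x within {a..b})"
    if x: "x \<in> {a..b}" "x \<notin> (\<Union>n. B (inverse (real (Suc n))))" for x
    unfolding has_field_derivative_def has_derivative_within_alt
  proof (intro conjI allI impI bounded_linear_mult_right)
    fix e :: real assume "e > 0"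
    then obtain n where n: "inverse (real (Suc n)) < e" using reals_Archimedean by blast
    have "x \<notin> B (inverse (real (Suc n)))" using x by blast
    then have "\<exists>d>0. \<forall>y\<in>{a..b}. y = x \<or> d \<le> \<bar>y - x\<bar> \<or>
      \<bar>integral {a..y} f - integral {a..x} f - f x * (y - x)\<bar> \<le> inverse (real (Suc n)) * \<bar>y - x\<bar>"
      using x(1) unfolding B_def by (auto simp: not_less)
    then obtain d where d: "d > 0" "\<And>y. y \<in> {a..b} \<Longrightarrow> y \<noteq> x \<Longrightarrow> \<bar>y - x\<bar> < d \<Longrightarrow>
      \<bar>integral {a..y} f - integral {a..x} f - f x * (y - x)\<bar> \<le> inverse (real (Suc n)) * \<bar>y - x\<bar>"
      by (metis not_less)
    show "\<exists>d>0. \<forall>y\<in>{a..b}. norm (y - x) < d \<longrightarrow>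
      norm (integral {a..y} f - integral {a..x} f - f x * (y - x)) \<le> e * norm (y - x)"
    proof (intro exI[of _ d] conjI ballI impI d(1))
      fix y assume y: "y \<in> {a..b}" "norm (y - x) < d"
      show "norm (integral {a..y} f - integral {a..x} f - f x * (y - x)) \<le> e * norm (y - x)"
      proof (cases "y = x")
        case False
        have "\<bar>integral {a..y} f - integral {a..x} f - f x * (y - x)\<bar> \<le> inverse (real (Suc n)) * \<bar>y - x\<bar>"
          using d(2)[OF y(1) False] y by simp
        also have "\<dots> \<le> e * \<bar>y - x\<bar>" using n by (intro mult_right_mono) auto
        finally show ?thesis by simp
      qed simp
    qed
  qed
  ultimately show ?thesis by (elim negligible_subset) blast
qed

text \<open>At every point at most one of the restricted copies of \<open>h\<close> is non-zero, so
  their sum is at most \<open>h\<close> pointwise, and it remains to integrate.\<close>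

lemma sum_integral_disjoint_le:
  fixes h :: "real \<Rightarrow> real"
  assumes h: "h integrable_on {c..d}" "\<And>x. x \<in> {c..d} \<Longrightarrow> 0 \<le> h x"
    and ab: "\<And>i. i < n \<Longrightarrow> c \<le> a i \<and> a i \<le> b i \<and> b i \<le> d"
    and disj: "disjoint_family_on (\<lambda>i. {a i<..<b i}) {..<n::nat}"
  shows "(\<Sum>i<n. integral {a i..b i} h) \<le> integral {c..d} h"
proof -
  have 1: "((\<lambda>x. if x \<in> {a i<..<b i} then h x else 0) has_integral integral {a i..b i} h) {c..d}" if "i < n" for i
  proof -
    have "(h has_integral integral {a i..b i} h) (cbox (a i) (b i))"
      using integrable_subinterval_real[OF h(1), of "a i" "b i"] ab[OF that] by auto
    from has_integral_restrict_open_subinterval[OF this, of c d] ab[OF that] show ?thesis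
      by auto
  qed
  have 2: "((\<lambda>x. \<Sum>i<n. if x \<in> {a i<..<b i} then h x else 0) has_integral (\<Sum>i<n. integral {a i..b i} h)) {c..d}"
    by (intro has_integral_sum 1) auto
  have "(\<Sum>i<n. if x \<in> {a i<..<b i} then h x else 0) \<le> h x" if x: "x \<in> {c..d}" for x
  proof (cases "\<exists>j<n. x \<in> {a j<..<b j}")
    case True
    then obtain j where j: "j < n" "x \<in> {a j<..<b j}" by blast
    have "x \<notin> {a i<..<b i}" if "i < n" "i \<noteq> j" for i
      using disj j that unfolding disjoint_family_on_def by blast
    then have "(\<Sum>i<n. if x \<in> {a i<..<b i} then h x else 0) = (\<Sum>i<n. if i = j then h x else 0)"
      using j by (intro sum.cong) auto
    then show ?thesis using j by simp
  next
    case False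
    then have "(\<Sum>i<n. if x \<in> {a i<..<b i} then h x else 0) = 0" by (intro sum.neutral) auto
    then show ?thesis using h(2)[OF x] by simp
  qed
  then show ?thesis by (intro has_integral_le[OF 2 integrable_integral[OF h(1)]])
qed

text \<open>Truncation splits \<open>g\<close> into a part bounded by \<open>n\<close> and a
  remainder \<open>h\<close> of small integral. The first contributes at most \<open>n\<close> times
  the total length of the intervals, the second at most its whole integral.\<close>

lemma abs_continuous_on_integral_bound:
  fixes w g :: "real \<Rightarrow> real"
  assumes g: "g integrable_on {c..d}" "\<And>x. x \<in> {c..d} \<Longrightarrow> 0 \<le> g x"
    and w: "\<And>s t. c \<le> s \<Longrightarrow> s \<le> t \<Longrightarrow> t \<le> d \<Longrightarrow> \<bar>w t - w s\<bar> \<le> integral {s..t} g"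
  shows "abs_continuous_on c d w"
  unfolding abs_continuous_on_def
proof (intro allI impI)
  fix \<epsilon> :: real assume \<epsilon>: "\<epsilon> > 0"
  have meas: "g \<in> borel_measurable (lebesgue_on {c..d})" using g(1) by (rule integrable_imp_measurable)
  have int: "(\<lambda>x. min (g x) (real n)) integrable_on {c..d}" for n
    by (rule measurable_bounded_by_integrable_imp_integrable[OF _ g(1)])
       (use g(2) meas in auto)
  have "(\<lambda>n. integral {c..d} (\<lambda>x. min (g x) (real n))) \<longlonglongrightarrow> integral {c..d} g"
  proof (rule dominated_convergence(2)[OF int g(1)])
    fix x assume "x \<in> {c..d}"
    obtain N where "g x \<le> real N" using real_arch_simple by blast
    then show "(\<lambda>n. min (g x) (real n)) \<longlonglongrightarrow> g x"
      by (intro tendsto_eventually eventually_sequentiallyI[of N]) auto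
  qed (use g(2) in auto)
  from LIMSEQ_D[OF this, of "\<epsilon>/2"] \<epsilon> obtain n where
    n: "\<bar>integral {c..d} (\<lambda>x. min (g x) (real n)) - integral {c..d} g\<bar> < \<epsilon> / 2" by auto
  define h where "h = (\<lambda>x. g x - min (g x) (real n))"
  have h: "h integrable_on {c..d}" "\<And>x. 0 \<le> h x"
    unfolding h_def using g int by (auto intro!: integrable_diff)
  have hI: "integral {c..d} h < \<epsilon> / 2"
    using n unfolding h_def by (subst integral_diff[OF g(1) int]) linarith
  show "\<exists>\<delta>>0. \<forall>(N::nat) a b. (\<forall>i<N. c \<le> a i \<and> a i \<le> b i \<and> b i \<le> d) \<longrightarrow>
        disjoint_family_on (\<lambda>i. {a i<..<b i}) {..<N} \<longrightarrow> (\<Sum>i<N. b i - a i) < \<delta> \<longrightarrow>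
        (\<Sum>i<N. \<bar>w (b i) - w (a i)\<bar>) < \<epsilon>"
  \<comment> \<open>\<open>Suc n\<close> instead of \<open>n\<close> keeps the quotient meaningful
    for \<open>n = 0\<close>.\<close>
  proof (intro exI[of _ "\<epsilon> / (2 * real (Suc n))"] conjI allI impI)
    show "\<epsilon> / (2 * real (Suc n)) > 0" using \<epsilon> by simp
    fix N :: nat and a b :: "nat \<Rightarrow> real"
    assume ab: "\<forall>i<N. c \<le> a i \<and> a i \<le> b i \<and> b i \<le> d"
      and disj: "disjoint_family_on (\<lambda>i. {a i<..<b i}) {..<N}"
      and small: "(\<Sum>i<N. b i - a i) < \<epsilon> / (2 * real (Suc n))"
    have "\<bar>w (b i) - w (a i)\<bar> \<le> integral {a i..b i} h + real (Suc n) * (b i - a i)" if "i < N" for i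
    proof -
      have i: "c \<le> a i" "a i \<le> b i" "b i \<le> d" using ab that by auto
      have sub: "f integrable_on {c..d} \<Longrightarrow> f integrable_on {a i..b i}" for f :: "real \<Rightarrow> real"
        using i by (elim integrable_subinterval_real) auto
      have "\<bar>w (b i) - w (a i)\<bar> \<le> integral {a i..b i} g" by (rule w[OF i])
      also have "\<dots> \<le> integral {a i..b i} (\<lambda>x. h x + real (Suc n))"
        by (intro integral_le sub g(1) integrable_add h(1) integrable_const_ivl)
           (auto simp: h_def)
      also have "\<dots> = integral {a i..b i} h + real (Suc n) * (b i - a i)"
        using i by (subst integral_add) (auto intro: sub h)
      finally show ?thesis .
    qed
    then have "(\<Sum>i<N. \<bar>w (b i) - w (a i)\<bar>) \<le> (\<Sum>i<N. integral {a i..b i} h + real (Suc n) * (b i - a i))"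
      by (intro sum_mono) auto
    also have "\<dots> = (\<Sum>i<N. integral {a i..b i} h) + real (Suc n) * (\<Sum>i<N. b i - a i)"
      by (simp add: sum.distrib sum_distrib_left)
    also have "(\<Sum>i<N. integral {a i..b i} h) \<le> integral {c..d} h"
      by (rule sum_integral_disjoint_le[OF h(1,2) _ disj]) (use ab in auto)
    also have "real (Suc n) * (\<Sum>i<N. b i - a i) \<le> real (Suc n) * (\<epsilon> / (2 * real (Suc n)))"
      using small by (intro mult_left_mono) auto
    also have "\<dots> = \<epsilon> / 2" by (simp del: of_nat_Suc)
    finally show "(\<Sum>i<N. \<bar>w (b i) - w (a i)\<bar>) < \<epsilon>" using hI by simp
  qed
qed

lemma AE_lebesgue_on_negligible:
  assumes "negligible N" "\<And>t. t \<in> S \<Longrightarrow> t \<notin> N \<Longrightarrow> P t" "S \<in> sets lebesgue"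
  shows "AE t in lebesgue_on S. P t"
proof -
  have "AE t in lebesgue. t \<notin> N"
    using assms(1) by (intro AE_not_in) (simp add: negligible_iff_null_sets)
  then show ?thesis using assms(2,3) by (simp add: AE_restrict_space_iff) (auto elim: eventually_mono)
qed

lemma AE_lebesgue_on_imp_negligible:
  assumes "AE t in lebesgue_on S. P t" "S \<in> sets lebesgue"
  shows "negligible {t \<in> S. \<not> P t}"
proof -
  have "AE t in lebesgue. t \<in> S \<longrightarrow> P t" using assms by (simp add: AE_restrict_space_iff)
  then have "AE t in lebesgue. t \<notin> {t \<in> S. \<not> P t}" by (auto elim: eventually_mono)
  then show ?thesis by (simp add: AE_iff_null_sets negligible_iff_null_sets AE_iff_null completion.AE_iff_null_sets)
qed

text \<open>Leads from the integral equations, which survive limits, back to the differential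
  problem: differentiation of the integral gives \<open>w' = -h\<close> almost everywhere, the
  majorant \<open>g\<close> gives absolute continuity, and the vanishing total integral gives
  \<open>w T = w 0 = u 0\<close>. Agreement with \<open>F\<close> is asked for only almost
  everywhere, so a change of the nonlinearity on a null set is harmless.\<close>

lemma bvp_solution_integral:
  fixes u w h g :: "real \<Rightarrow> real"
  assumes T: "0 < T" and g: "g integrable_on {0..T}"
    and h: "h integrable_on {0..T}" "\<And>t. t \<in> {0..T} \<Longrightarrow> \<bar>h t\<bar> \<le> g t"
    and w: "\<And>t. t \<in> {0..T} \<Longrightarrow> w t = a - integral {0..t} h"
    and u: "\<And>t. t \<in> {0..T} \<Longrightarrow> u t = a + integral {0..t} w"
    and total: "integral {0..T} h = 0"
    and F: "AE t in lebesgue_on {0..T}. F t (u t) (w t) = h t"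
  shows "bvp_solution T F u"
  unfolding bvp_solution_def
proof (intro exI[of _ w] conjI ballI)
  have "continuous_on {0..T} (\<lambda>t. a - integral {0..t} h)"
    by (intro continuous_intros indefinite_integral_continuous_1 h)
  then show contw: "continuous_on {0..T} w" by (subst continuous_on_cong[OF refl w])
  show "(u has_real_derivative w t) (at t within {0..T})" if t: "t \<in> {0..T}" for t
  proof -
    have "((\<lambda>t. a + integral {0..t} w) has_real_derivative 0 + w t) (at t within {0..T})"
      by (intro DERIV_add DERIV_const integral_has_real_derivative contw t)
    then show ?thesis using u t by (auto elim!: has_field_derivative_transform_within[of _ _ _ _ 1])
  qed
  show "abs_continuous_on 0 T w"
  proof (rule abs_continuous_on_integral_bound[OF g])
    show "0 \<le> g x" if "x \<in> {0..T}" for x using h(2)[OF that] by linarith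
    fix s t assume st: "0 \<le> s" "s \<le> t" "t \<le> T"
    have "w t - w s = - integral {s..t} h"
      using st w[of s] w[of t] integral_diff_segment[OF h(1) st] by simp
    moreover have "\<bar>integral {s..t} h\<bar> \<le> integral {s..t} g"
      using integral_norm_bound_integral[of h "{s..t}" g] st h
        integrable_subinterval_real[OF h(1), of s t] integrable_subinterval_real[OF g, of s t] by auto
    ultimately show "\<bar>w t - w s\<bar> \<le> integral {s..t} g" by simp
  qed
  have "AE t in lebesgue_on {0..T}. (w has_real_derivative - h t) (at t within {0..T})"
  proof (rule AE_lebesgue_on_negligible[OF negligible_integral_no_derivative[OF h(1)]])
    fix t assume t: "t \<in> {0..T}" "t \<notin> {x \<in> {0..T}. \<not> ((\<lambda>t. integral {0..t} h) has_real_derivative h x) (at x within {0..T})}"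
    then have "((\<lambda>t. a - integral {0..t} h) has_real_derivative 0 - h t) (at t within {0..T})"
      by (intro DERIV_diff DERIV_const) auto
    then show "(w has_real_derivative - h t) (at t within {0..T})"
      using w t by (auto elim!: has_field_derivative_transform_within[of _ _ _ _ 1])
  qed simp
  then show "AE t in lebesgue_on {0..T}. \<exists>ddu. (w has_real_derivative ddu) (at t within {0..T}) \<and> ddu + F t (u t) (w t) = 0"
    using F by eventually_elim auto
  show "w 0 = u 0" "w T = u 0" using w[of 0] w[of T] u[of 0] T total by auto
qed

subsection \<open>Euler polygons for the shooting problem\<close>


text \<open>One integrable \<open>g\<close> dominates \<open>K\<close> for all parameters, positions
  and slopes; it serves both in dominated convergence and as common modulus of continuity.\<close>

locale euler_shooting =
  fixes T :: real and K :: "real \<Rightarrow> real \<Rightarrow> real \<Rightarrow> real \<Rightarrow> real" and \<theta> g :: "real \<Rightarrow> real"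
  assumes T_pos: "0 < T"
    and K_meas: "\<And>l s x. (\<lambda>t. K l t s x) \<in> borel_measurable (lebesgue_on {0..T})"
    and K_cont: "\<And>t. t \<in> {0..T} \<Longrightarrow> continuous_on UNIV (\<lambda>(l, s, x). K l t s x)"
    and K_bound: "\<And>l t s x. t \<in> {0..T} \<Longrightarrow> \<bar>K l t s x\<bar> \<le> g t"
    and g_int: "g integrable_on {0..T}"
    and \<theta>_cont: "continuous_on UNIV \<theta>"
    and \<theta>_range: "\<And>l. 0 \<le> \<theta> l" "\<And>l. \<theta> l \<le> 1"
begin

lemma g_nonneg: "t \<in> {0..T} \<Longrightarrow> 0 \<le> g t"
  using K_bound[of t 0 0 0] by (meson abs_ge_zero order_trans)

lemma K_tendsto:
  assumes "t \<in> {0..T}" "l \<longlonglongrightarrow> l'" "s \<longlonglongrightarrow> s'" "x \<longlonglongrightarrow> x'"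
  shows "(\<lambda>n. K (l n) t (s n) (x n)) \<longlonglongrightarrow> K l' t s' x'"
proof -
  have "(\<lambda>n. (l n, s n, x n)) \<longlonglongrightarrow> (l', s', x')" by (intro tendsto_Pair assms)
  from continuous_on_tendsto_compose[OF K_cont[OF assms(1)] this] show ?thesis by simp
qed

lemma subint: "0 \<le> c \<Longrightarrow> d \<le> T \<Longrightarrow> f integrable_on {0..T} \<Longrightarrow> f integrable_on {c..d}"
  for f :: "real \<Rightarrow> real"
  by (erule integrable_subinterval_real) auto

lemma measurable_integrable:
  assumes "f \<in> borel_measurable (lebesgue_on {0..T})" "\<And>t. t \<in> {0..T} \<Longrightarrow> \<bar>f t\<bar> \<le> g t"
  shows "f integrable_on {0..T}"
  by (rule measurable_bounded_by_integrable_imp_integrable[OF assms(1) g_int]) (use assms in auto)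

lemma K_integrable: "(\<lambda>t. K l t s x) integrable_on {0..T}"
  by (intro measurable_integrable K_meas K_bound)

lemma K_integral_cont:
  assumes "0 \<le> c" "d \<le> T"
  shows "continuous_on UNIV (\<lambda>(l, s, x). integral {c..d} (\<lambda>t. K l t s x))"
  unfolding continuous_on_sequentially
proof (intro allI ballI impI)
  fix p :: "nat \<Rightarrow> real \<times> real \<times> real" and q
  assume "(\<forall>n. p n \<in> UNIV) \<and> p \<longlonglongrightarrow> q"
  then have p: "p \<longlonglongrightarrow> q" by simp
  have "(\<lambda>n. integral {c..d} (\<lambda>t. K (fst (p n)) t (fst (snd (p n))) (snd (snd (p n)))))
     \<longlonglongrightarrow> integral {c..d} (\<lambda>t. K (fst q) t (fst (snd q)) (snd (snd q)))"
  proof (rule dominated_convergence(2))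
    show "g integrable_on {c..d}" using assms by (intro subint[OF _ _ g_int])
    show "(\<lambda>t. K (fst (p n)) t (fst (snd (p n))) (snd (snd (p n)))) integrable_on {c..d}" for n
      using assms by (intro subint[OF _ _ K_integrable])
    show "norm (K (fst (p n)) t (fst (snd (p n))) (snd (snd (p n)))) \<le> g t" if "t \<in> {c..d}" for n t
      using that assms K_bound by auto
    show "(\<lambda>n. K (fst (p n)) t (fst (snd (p n))) (snd (snd (p n)))) \<longlonglongrightarrow>
       K (fst q) t (fst (snd q)) (snd (snd q))" if "t \<in> {c..d}" for t
      using that assms by (intro K_tendsto tendsto_fst tendsto_snd p) auto
  qed
  then show "((\<lambda>(l, s, x). integral {c..d} (\<lambda>t. K l t s x)) \<circ> p) \<longlonglongrightarrow>
      (case q of (l, s, x) \<Rightarrow> integral {c..d} (\<lambda>t. K l t s x))"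
    by (simp add: o_def case_prod_unfold)
qed

section \<open>Euler polygons and their continuity in the shooting parameters\<close>

definition mesh :: "nat \<Rightarrow> nat \<Rightarrow> real" where
  "mesh n k = real k * (T / real (Suc n))"

text \<open>Sampling a merely measurable function at mesh points would be meaningless, hence the
  exact time integral over the cell. Both components start at \<open>a\<close> because of the
  condition u'(0) = u(0).\<close>

primrec node :: "nat \<Rightarrow> real \<Rightarrow> real \<Rightarrow> nat \<Rightarrow> real \<times> real" where
  "node n l a 0 = (a, a)"
| "node n l a (Suc k) =
    (fst (node n l a k) + T / real (Suc n) * snd (node n l a k),
     snd (node n l a k) - \<theta> l *
       integral {mesh n k..mesh n (Suc k)} (\<lambda>t. K l t (fst (node n l a k)) (snd (node n l a k))))"

primrec peak :: "nat \<Rightarrow> real \<Rightarrow> real \<Rightarrow> nat \<Rightarrow> real" where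
  "peak n l a 0 = a"
| "peak n l a (Suc k) = max (peak n l a k) (fst (node n l a (Suc k)))"

text \<open>The factor \<open>\<theta> l\<close> is left out on purpose. With it the defect would
  vanish identically where \<open>\<theta> l = 0\<close>; without it, the defect there still
  approximates the integral in (H_r). For \<open>\<theta> l > 0\<close> the zeros are the
  same.\<close>

definition defect :: "nat \<Rightarrow> real \<Rightarrow> real \<Rightarrow> real" where
  "defect n l a = (\<Sum>k<Suc n. integral {mesh n k..mesh n (Suc k)}
     (\<lambda>t. K l t (fst (node n l a k)) (snd (node n l a k))))"

lemma mesh_0: "mesh n 0 = 0" and mesh_last: "mesh n (Suc n) = T"
  unfolding mesh_def by (simp_all del: of_nat_Suc)

lemma mesh_Suc: "mesh n (Suc k) = mesh n k + T / real (Suc n)"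
proof -
  have "real (Suc k) = real k + 1" by simp
  then show ?thesis unfolding mesh_def by (simp only: distrib_right mult_1)
qed

lemma mesh_mono: "j \<le> k \<Longrightarrow> mesh n j \<le> mesh n k"
  unfolding mesh_def using T_pos by (intro mult_right_mono) auto

lemma mesh_range: "0 \<le> mesh n k" "k \<le> Suc n \<Longrightarrow> mesh n k \<le> T"
  using mesh_mono[of 0 k n] mesh_mono[of k "Suc n" n] by (auto simp: mesh_0 mesh_last)

lemma node_cont: "k \<le> Suc n \<Longrightarrow> continuous_on UNIV (\<lambda>p. node n (fst p) (snd p) k)"
proof (induction k)
  case 0
  then show ?case by (auto intro!: continuous_intros)
next
  case (Suc k)
  then have c: "continuous_on UNIV (\<lambda>p. node n (fst p) (snd p) k)" by simp
  have "continuous_on UNIV (\<lambda>p. (\<lambda>(l, s, x). integral {mesh n k..mesh n (Suc k)} (\<lambda>t. K l t s x))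
      (fst p, fst (node n (fst p) (snd p) k), snd (node n (fst p) (snd p) k)))"
    by (rule continuous_on_compose2[OF K_integral_cont])
       (use Suc mesh_range in \<open>auto intro!: continuous_intros c\<close>)
  then have i: "continuous_on UNIV (\<lambda>p. integral {mesh n k..mesh n (Suc k)}
      (\<lambda>t. K (fst p) t (fst (node n (fst p) (snd p) k)) (snd (node n (fst p) (snd p) k))))"
    by (simp add: case_prod_unfold)
  have "continuous_on UNIV (\<lambda>p::real\<times>real. \<theta> (fst p))"
    by (rule continuous_on_compose2[OF \<theta>_cont]) (auto intro!: continuous_intros)
  then show ?case unfolding node.simps by (intro continuous_intros c i)
qed

lemma defect_cont: "continuous_on UNIV (\<lambda>p. defect n (fst p) (snd p))"
  unfolding defect_def
proof (intro continuous_on_sum)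
  fix k assume "k \<in> {..<Suc n}"
  then have k: "k \<le> n" by auto
  have c: "continuous_on UNIV (\<lambda>p. node n (fst p) (snd p) k)" using k by (intro node_cont) auto
  have "continuous_on UNIV (\<lambda>p. (\<lambda>(l, s, x). integral {mesh n k..mesh n (Suc k)} (\<lambda>t. K l t s x))
      (fst p, fst (node n (fst p) (snd p) k), snd (node n (fst p) (snd p) k)))"
    by (rule continuous_on_compose2[OF K_integral_cont])
       (use k mesh_range in \<open>auto intro!: continuous_intros c\<close>)
  then show "continuous_on UNIV (\<lambda>p. integral {mesh n k..mesh n (Suc k)}
      (\<lambda>t. K (fst p) t (fst (node n (fst p) (snd p) k)) (snd (node n (fst p) (snd p) k))))"
    by (simp add: case_prod_unfold)
qed

lemma peak_cont: "k \<le> Suc n \<Longrightarrow> continuous_on UNIV (\<lambda>p. peak n (fst p) (snd p) k)"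
proof (induction k)
  case 0
  then show ?case by (auto intro!: continuous_intros)
next
  case (Suc k)
  then show ?case unfolding peak.simps
    by (intro continuous_on_max continuous_on_fst node_cont) auto
qed

lemma node_le_peak: "j \<le> k \<Longrightarrow> fst (node n l a j) \<le> peak n l a k"
  by (induction k) (auto simp: le_Suc_eq max.coboundedI1 simp del: node.simps(2))

lemma peak_attained: "\<exists>j\<le>k. peak n l a k = fst (node n l a j)"
proof (induction k)
  case (Suc k)
  then obtain j where j: "j \<le> k" "peak n l a k = fst (node n l a j)" by blast
  show ?case
  proof (cases "peak n l a k \<le> fst (node n l a (Suc k))")
    case True
    then show ?thesis by (intro exI[of _ "Suc k"]) simp
  next
    case False
    then show ?thesis using j by (intro exI[of _ j]) (simp del: node.simps(2))
  qed
qed simp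

section \<open>The polygons as step functions, with interpolated slopes\<close>

definition cell :: "nat \<Rightarrow> real \<Rightarrow> nat" where
  "cell n t = nat \<lfloor>t / (T / real (Suc n))\<rfloor>"

lemma cell_eq:
  assumes "mesh n k \<le> t" "t < mesh n (Suc k)"
  shows "cell n t = k"
proof -
  define d where "d = T / real (Suc n)"
  have d: "d > 0" using T_pos by (simp add: d_def)
  have "real k * d \<le> t" "t < (real k + 1) * d" using assms by (simp_all add: mesh_def d_def algebra_simps)
  then have "real k \<le> t / d" "t / d < real k + 1" using d by (simp_all add: field_simps)
  then have "\<lfloor>t / d\<rfloor> = int k" by (simp add: floor_eq_iff)
  then show ?thesis by (simp add: cell_def d_def)
qed

text \<open>At \<open>t = T\<close> the index is \<open>Suc n\<close>, one beyond the last cell. A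
  node with that index exists, and a single point does not influence integrals.\<close>

lemma cell_bounds:
  assumes "t \<in> {0..T}"
  shows "cell n t \<le> Suc n" "mesh n (cell n t) \<le> t" "t \<le> mesh n (cell n t) + T / real (Suc n)"
proof -
  define d where "d = T / real (Suc n)"
  have d: "d > 0" using T_pos by (simp add: d_def)
  have m: "mesh n k = real k * d" for k by (simp add: mesh_def d_def)
  have "0 \<le> \<lfloor>t / d\<rfloor>" using assms d by simp
  then have 1: "real (cell n t) = real_of_int \<lfloor>t / d\<rfloor>" by (simp add: cell_def d_def)
  have "real (cell n t) \<le> t / d" unfolding 1 by simp
  then show 2: "mesh n (cell n t) \<le> t" using d by (simp add: m pos_le_divide_eq)
  have "t / d \<le> real (cell n t) + 1" unfolding 1 by linarith
  then show "t \<le> mesh n (cell n t) + T / real (Suc n)"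
    unfolding m d_def[symmetric] using d by (simp only: pos_divide_le_eq distrib_right mult_1)
  have "real (cell n t) * d \<le> real (Suc n) * d" using 2 assms mesh_last[of n] unfolding m by simp
  then have "real (cell n t) \<le> real (Suc n)" using d by (simp only: mult_le_cancel_right_pos)
  then show "cell n t \<le> Suc n" by simp
qed

text \<open>On a closed cell the index can differ from \<open>k\<close> only at the right end point,
  which is negligible.\<close>

lemma has_integral_cell:
  fixes \<phi> :: "nat \<Rightarrow> real \<Rightarrow> real"
  assumes "\<And>j. j < k \<Longrightarrow> \<phi> j integrable_on {mesh n j..mesh n (Suc j)}"
  shows "((\<lambda>t. \<phi> (cell n t) t) has_integral (\<Sum>j<k. integral {mesh n j..mesh n (Suc j)} (\<phi> j))) {0..mesh n k}"
  using assms
proof (induction k)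
  case 0
  then show ?case by (simp add: mesh_0 has_integral_refl)
next
  case (Suc k)
  have "((\<lambda>t. \<phi> (cell n t) t) has_integral integral {mesh n k..mesh n (Suc k)} (\<phi> k)) {mesh n k..mesh n (Suc k)}"
  proof (rule has_integral_spike)
    show "negligible {mesh n (Suc k)}" by simp
    show "(\<phi> k has_integral integral {mesh n k..mesh n (Suc k)} (\<phi> k)) {mesh n k..mesh n (Suc k)}"
      using Suc.prems[of k] by (intro integrable_integral) simp
    show "\<phi> (cell n t) t = \<phi> k t" if "t \<in> {mesh n k..mesh n (Suc k)} - {mesh n (Suc k)}" for t
      using that cell_eq[of n k t] by auto
  qed
  from has_integral_combine[OF mesh_range(1)[of n k] mesh_mono[of k "Suc k" n] Suc.IH this] Suc.prems
  show ?case by (simp add: add.commute)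
qed

definition stepX :: "nat \<Rightarrow> real \<Rightarrow> real \<Rightarrow> real \<Rightarrow> real" where
  "stepX n l a t = fst (node n l a (cell n t))"

definition stepY :: "nat \<Rightarrow> real \<Rightarrow> real \<Rightarrow> real \<Rightarrow> real" where
  "stepY n l a t = snd (node n l a (cell n t))"

definition stepK :: "nat \<Rightarrow> real \<Rightarrow> real \<Rightarrow> real \<Rightarrow> real" where
  "stepK n l a t = K l t (stepX n l a t) (stepY n l a t)"

text \<open>A continuous interpolation of the slopes: it takes the node values at mesh points but,
  unlike \<open>stepY\<close>, admits a common modulus of continuity, so that Arzela-Ascoli
  applies.\<close>

definition slope :: "nat \<Rightarrow> real \<Rightarrow> real \<Rightarrow> real \<Rightarrow> real" where
  "slope n l a t = a - \<theta> l * integral {0..t} (stepK n l a)"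

lemma has_integral_stepK:
  assumes "k \<le> Suc n"
  shows "(stepK n l a has_integral (\<Sum>j<k. integral {mesh n j..mesh n (Suc j)}
     (\<lambda>t. K l t (fst (node n l a j)) (snd (node n l a j))))) {0..mesh n k}"
  unfolding stepK_def[abs_def] stepX_def stepY_def
proof (rule has_integral_cell)
  fix j assume "j < k"
  then have "Suc j \<le> Suc n" using assms by simp
  then show "(\<lambda>t. K l t (fst (node n l a j)) (snd (node n l a j))) integrable_on {mesh n j..mesh n (Suc j)}"
    using mesh_range by (intro subint[OF _ _ K_integrable]) auto
qed

lemma stepK_integrable: "stepK n l a integrable_on {0..T}"
  using has_integral_integrable[OF has_integral_stepK[OF order_refl]] unfolding mesh_last .

lemma stepK_bound: "t \<in> {0..T} \<Longrightarrow> \<bar>stepK n l a t\<bar> \<le> g t"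
  unfolding stepK_def by (rule K_bound)

lemma defect_eq: "defect n l a = integral {0..T} (stepK n l a)"
  using has_integral_stepK[OF order_refl] unfolding defect_def mesh_last by (rule integral_unique[symmetric])

lemma snd_node: "k \<le> Suc n \<Longrightarrow> snd (node n l a k) = slope n l a (mesh n k)"
proof -
  assume k: "k \<le> Suc n"
  have "snd (node n l a k) = a - \<theta> l * (\<Sum>j<k. integral {mesh n j..mesh n (Suc j)}
     (\<lambda>t. K l t (fst (node n l a j)) (snd (node n l a j))))"
    by (induction k) (auto simp: algebra_simps)
  then show ?thesis
    using integral_unique[OF has_integral_stepK[OF k, of l a]] by (simp add: slope_def)
qed

lemma has_integral_stepY:
  assumes "k \<le> Suc n"
  shows "(stepY n l a has_integral (fst (node n l a k) - a)) {0..mesh n k}"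
proof -
  have "fst (node n l a k) - a = (\<Sum>j<k. integral {mesh n j..mesh n (Suc j)} (\<lambda>t. snd (node n l a j)))"
    using T_pos by (induction k) (auto simp: mesh_Suc)
  then show ?thesis
    unfolding stepY_def[abs_def] by (simp only:) (intro has_integral_cell integrable_const_ivl)
qed

lemma stepY_integrable: "stepY n l a integrable_on {0..T}"
  using has_integral_integrable[OF has_integral_stepY[OF order_refl]] unfolding mesh_last .

lemma slope_diff:
  assumes "0 \<le> s" "s \<le> t" "t \<le> T"
  shows "\<bar>slope n l a t - slope n l a s\<bar> \<le> integral {s..t} g"
proof -
  have "slope n l a t - slope n l a s = - \<theta> l * (integral {0..t} (stepK n l a) - integral {0..s} (stepK n l a))"
    unfolding slope_def by (simp add: algebra_simps)
  also have "\<dots> = - \<theta> l * integral {s..t} (stepK n l a)"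
    using integral_diff_segment[OF stepK_integrable assms, of n l a] by simp
  finally have "slope n l a t - slope n l a s = - \<theta> l * integral {s..t} (stepK n l a)" .
  then have "\<bar>slope n l a t - slope n l a s\<bar> \<le> 1 * \<bar>integral {s..t} (stepK n l a)\<bar>"
    using \<theta>_range[of l] by (simp add: abs_mult mult_left_le_one_le)
  also have "\<dots> \<le> integral {s..t} g"
    using integral_norm_bound_integral[of "stepK n l a" "{s..t}" g] assms stepK_bound
      subint[OF assms(1) assms(3) stepK_integrable] subint[OF assms(1) assms(3) g_int] by auto
  finally show ?thesis .
qed

lemma slope_bound:
  assumes "t \<in> {0..T}"
  shows "\<bar>slope n l a t\<bar> \<le> \<bar>a\<bar> + integral {0..T} g"
proof -
  have "\<bar>slope n l a t - slope n l a 0\<bar> \<le> integral {0..t} g" using assms by (intro slope_diff) auto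
  also have "\<dots> \<le> integral {0..T} g"
    using assms g_nonneg by (intro integral_subset_le subint[OF _ _ g_int]) auto
  finally show ?thesis by (simp add: slope_def)
qed

lemma stepY_eq: "t \<in> {0..T} \<Longrightarrow> stepY n l a t = slope n l a (mesh n (cell n t))"
  unfolding stepY_def by (intro snd_node cell_bounds)


text \<open>Pure compactness, hence only a subsequence. The interpolated slopes converge uniformly;
  the step functions follow, because they evaluate these slopes at mesh points closing in on
  \<open>t\<close>; positions are recovered by integration. Convergence of defect and peak carries
  the location of the planar zeros over to the limit.\<close>

lemma Euler_limit:
  fixes l a :: "nat \<Rightarrow> real"
  assumes l: "\<And>n. l n \<in> {-1..1}" and a: "\<And>n. a n \<in> {0..A}"
  obtains r l' u w ts where "strict_mono (r :: nat \<Rightarrow> nat)" "(\<lambda>j. l (r j)) \<longlonglongrightarrow> l'"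
    "(\<lambda>j. a (r j)) \<longlonglongrightarrow> w 0"
    "continuous_on {0..T} w"
    "\<And>t. t \<in> {0..T} \<Longrightarrow> u t = w 0 + integral {0..t} w"
    "(\<lambda>t. K l' t (u t) (w t)) integrable_on {0..T}"
    "\<And>t. t \<in> {0..T} \<Longrightarrow> w t = w 0 - \<theta> l' * integral {0..t} (\<lambda>t. K l' t (u t) (w t))"
    "(\<lambda>j. defect (r j) (l (r j)) (a (r j))) \<longlonglongrightarrow> integral {0..T} (\<lambda>t. K l' t (u t) (w t))"
    "(\<lambda>j. peak (r j) (l (r j)) (a (r j)) (Suc (r j))) \<longlonglongrightarrow> u ts"
    "ts \<in> {0..T}" "\<And>t. t \<in> {0..T} \<Longrightarrow> u t \<le> u ts"
proof -
  obtain l' r1 where r1: "strict_mono (r1 :: nat \<Rightarrow> nat)" "(l \<circ> r1) \<longlonglongrightarrow> l'"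
    using l compact_Icc[of "-1" "1::real"] unfolding compact_def by metis
  define B where "B = A + integral {0..T} g"
  define W where "W = (\<lambda>j. slope (r1 j) (l (r1 j)) (a (r1 j)))"
  have W_bound: "norm (slope n (l n) (a n) t) \<le> B" if "t \<in> {0..T}" for n t
    using slope_bound[OF that, of n "l n" "a n"] a[of n] by (auto simp: B_def)
  have equi: "\<exists>d>0. \<forall>n y. y \<in> {0..T} \<and> norm (x - y) < d \<longrightarrow> norm (W n x - W n y) < e"
    if x: "x \<in> {0..T}" and e: "0 < e" for x e
  proof -
    have "continuous_on {0..T} (\<lambda>t. integral {0..t} g)"
      by (rule indefinite_integral_continuous_1[OF g_int])
    then obtain d where d: "d > 0"
      "\<And>y. y \<in> {0..T} \<Longrightarrow> dist y x < d \<Longrightarrow> dist (integral {0..y} g) (integral {0..x} g) < e"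
      using x e unfolding continuous_on_iff by blast
    have "norm (W n x - W n y) < e" if y: "y \<in> {0..T}" "norm (x - y) < d" for n y
    proof -
      have d': "\<bar>integral {0..y} g - integral {0..x} g\<bar> < e"
        using d(2)[of y] y by (simp add: dist_real_def abs_minus_commute)
      show ?thesis
      proof (cases "x \<le> y")
        case True
        have "\<bar>W n y - W n x\<bar> \<le> integral {x..y} g"
          unfolding W_def using x y True by (intro slope_diff) auto
        also have "integral {x..y} g = integral {0..y} g - integral {0..x} g"
          using integral_diff_segment[OF g_int, of x y] x y True by simp
        finally show ?thesis using d' by (simp add: abs_minus_commute)
      next
        case False
        have "\<bar>W n x - W n y\<bar> \<le> integral {y..x} g"
          unfolding W_def using x y False by (intro slope_diff) auto
        also have "integral {y..x} g = integral {0..x} g - integral {0..y} g"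
          using integral_diff_segment[OF g_int, of y x] x y False by simp
        finally show ?thesis using d' by simp
      qed
    qed
    with d(1) show ?thesis by blast
  qed
  obtain w r2 where contw: "continuous_on {0..T} w" and r2: "strict_mono (r2 :: nat \<Rightarrow> nat)"
    and conv: "\<And>e. 0 < e \<Longrightarrow> \<exists>N. \<forall>n x. n \<ge> N \<and> x \<in> {0..T} \<longrightarrow> norm (W (r2 n) x - w x) < e"
    by (rule Arzela_Ascoli[of "{0..T}" W B]) (use W_bound equi in \<open>auto simp: W_def\<close>)
  define r where "r = r1 \<circ> r2"
  have r: "strict_mono r" unfolding r_def by (rule strict_mono_o[OF r1(1) r2])
  define S where "S = (\<lambda>j. slope (r j) (l (r j)) (a (r j)))"
  define Y where "Y = (\<lambda>j. stepY (r j) (l (r j)) (a (r j)))"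
  define X where "X = (\<lambda>j. stepX (r j) (l (r j)) (a (r j)))"
  define \<kappa> where "\<kappa> = (\<lambda>j. stepK (r j) (l (r j)) (a (r j)))"
  define c where "c = (\<lambda>j t. mesh (r j) (cell (r j) t))"
  have SW: "S j = W (r2 j)" for j by (simp add: S_def W_def r_def)
  have l_lim: "(\<lambda>j. l (r j)) \<longlonglongrightarrow> l'"
    using LIMSEQ_subseq_LIMSEQ[OF r1(2) r2] by (simp add: r_def o_def)
  have S_lim: "(\<lambda>j. S j t) \<longlonglongrightarrow> w t" if "t \<in> {0..T}" for t
    unfolding LIMSEQ_iff SW using conv that by blast
  have a_lim: "(\<lambda>j. a (r j)) \<longlonglongrightarrow> w 0"
    using S_lim[of 0] T_pos by (simp add: S_def slope_def)
  have c_range: "c j t \<in> {0..T}" if "t \<in> {0..T}" for j t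
    using cell_bounds[OF that, of "r j"] mesh_range[of "r j"] that by (auto simp: c_def)
  have c_lim: "(\<lambda>j. c j t) \<longlonglongrightarrow> t" if t: "t \<in> {0..T}" for t
  proof (rule tendsto_sandwich)
    have "(\<lambda>n. T / real (Suc n)) \<longlonglongrightarrow> 0"
      by (rule tendsto_divide_0[OF tendsto_const]) (metis filterlim_at_top_imp_at_infinity filterlim_compose filterlim_real_sequentially filterlim_Suc)
    from LIMSEQ_subseq_LIMSEQ[OF this r] have "(\<lambda>j. t - T / real (Suc (r j))) \<longlonglongrightarrow> t - 0"
      by (intro tendsto_diff tendsto_const) (simp add: o_def)
    then show "(\<lambda>j. t - T / real (Suc (r j))) \<longlonglongrightarrow> t" by simp
    show "\<forall>\<^sub>F j in sequentially. t - T / real (Suc (r j)) \<le> c j t"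
      using cell_bounds(3)[OF t] by (auto simp: c_def algebra_simps simp del: of_nat_Suc)
    show "\<forall>\<^sub>F j in sequentially. c j t \<le> t" using cell_bounds(2)[OF t] by (auto simp: c_def)
  qed simp
  have Y_eq: "Y j t = S j (c j t)" if "t \<in> {0..T}" for j t
    unfolding Y_def S_def c_def by (rule stepY_eq[OF that])
  have Y_lim: "(\<lambda>j. Y j t) \<longlonglongrightarrow> w t" if t: "t \<in> {0..T}" for t
  proof -
    have "(\<lambda>j. w (c j t)) \<longlonglongrightarrow> w t"
      by (rule continuous_on_tendsto_compose[OF contw c_lim[OF t] t]) (use c_range t in auto)
    \<comment> \<open>Here uniform convergence is essential, since the point \<open>c j t\<close>
      moves with \<open>j\<close>.\<close>
    moreover have "(\<lambda>j. S j (c j t) - w (c j t)) \<longlonglongrightarrow> 0"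
    proof (rule LIMSEQ_I)
      fix e :: real assume "0 < e"
      from conv[OF this] obtain N where "\<And>n x. n \<ge> N \<Longrightarrow> x \<in> {0..T} \<Longrightarrow> norm (S n x - w x) < e"
        unfolding SW by blast
      then show "\<exists>N. \<forall>n\<ge>N. norm (S n (c n t) - w (c n t) - 0) < e" using c_range[OF t] by auto
    qed
    ultimately have "(\<lambda>j. (S j (c j t) - w (c j t)) + w (c j t)) \<longlonglongrightarrow> 0 + w t" by (rule tendsto_add[rotated])
    then show ?thesis using Y_eq[OF t] by simp
  qed
  have Y_bound: "norm (Y j t) \<le> B" if "t \<in> {0..T}" for j t
    unfolding Y_eq[OF that] S_def using W_bound[OF c_range[OF that]] by blast
  have w_bound: "norm (w t) \<le> B" if "t \<in> {0..T}" for t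
    by (rule Lim_norm_ubound[OF _ Y_lim[OF that]]) (use Y_bound[OF that] in auto)
  have w_int: "w integrable_on {0..T}" by (rule integrable_continuous_real[OF contw])
  have Y_int: "Y j integrable_on {0..T}" for j unfolding Y_def by (rule stepY_integrable)
  have D_int: "(\<lambda>t. \<bar>Y j t - w t\<bar>) integrable_on {0..T}" for j
  proof (rule measurable_bounded_by_integrable_imp_integrable)
    show "(\<lambda>t. \<bar>Y j t - w t\<bar>) \<in> borel_measurable (lebesgue_on {0..T})"
      by (intro borel_measurable_abs borel_measurable_diff integrable_imp_measurable Y_int w_int)
    show "(\<lambda>t. 2 * B) integrable_on {0..T}" by (rule integrable_const_ivl)
    show "norm \<bar>Y j t - w t\<bar> \<le> 2 * B" if "t \<in> {0..T}" for t
      using Y_bound[OF that, of j] w_bound[OF that] by simp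
  qed simp
  have D_lim: "(\<lambda>j. integral {0..T} (\<lambda>t. \<bar>Y j t - w t\<bar>)) \<longlonglongrightarrow> integral {0..T} (\<lambda>t. \<bar>w t - w t\<bar>)"
  proof (rule dominated_convergence(2)[OF D_int integrable_const_ivl])
    show "norm \<bar>Y j t - w t\<bar> \<le> 2 * B" if "t \<in> {0..T}" for j t
      using Y_bound[OF that, of j] w_bound[OF that] by simp
    show "(\<lambda>j. \<bar>Y j t - w t\<bar>) \<longlonglongrightarrow> \<bar>w t - w t\<bar>" if "t \<in> {0..T}" for t
      by (intro tendsto_intros Y_lim[OF that])
  qed
  \<comment> \<open>Bounds the distance of all nodes from the limit curve at once; pointwise
    convergence would not control the maximum over the nodes.\<close>
  define err where "err = (\<lambda>j. \<bar>a (r j) - w 0\<bar> + integral {0..T} (\<lambda>t. \<bar>Y j t - w t\<bar>))"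
  have "(\<lambda>j. \<bar>a (r j) - w 0\<bar> + integral {0..T} (\<lambda>t. \<bar>Y j t - w t\<bar>)) \<longlonglongrightarrow> \<bar>w 0 - w 0\<bar> + 0"
    using D_lim by (intro tendsto_add tendsto_rabs tendsto_diff a_lim tendsto_const) simp
  then have err_lim: "err \<longlonglongrightarrow> 0" by (simp add: err_def)
  define u where "u = (\<lambda>t. w 0 + integral {0..t} w)"
  have contu: "continuous_on {0..T} u"
    unfolding u_def by (intro continuous_intros indefinite_integral_continuous_1 w_int)
  have node_err: "\<bar>fst (node (r j) (l (r j)) (a (r j)) k) - u (mesh (r j) k)\<bar> \<le> err j" if k: "k \<le> Suc (r j)" for j k
  proof -
    let ?m = "mesh (r j) k"
    have m: "0 \<le> ?m" "?m \<le> T" using mesh_range(1) mesh_range(2)[OF k] by auto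
    have sub: "f integrable_on {0..?m}" if "f integrable_on {0..T}" for f :: "real \<Rightarrow> real"
      by (rule subint[OF order_refl m(2) that])
    have "integral {0..?m} (Y j) = fst (node (r j) (l (r j)) (a (r j)) k) - a (r j)"
      unfolding Y_def by (rule integral_unique[OF has_integral_stepY[OF k]])
    then have "fst (node (r j) (l (r j)) (a (r j)) k) - u ?m
        = (a (r j) - w 0) + (integral {0..?m} (Y j) - integral {0..?m} w)" by (simp add: u_def)
    also have "\<dots> = (a (r j) - w 0) + integral {0..?m} (\<lambda>t. Y j t - w t)"
      by (subst integral_diff[OF sub[OF Y_int] sub[OF w_int]]) simp
    finally have "\<bar>fst (node (r j) (l (r j)) (a (r j)) k) - u ?m\<bar>
       \<le> \<bar>a (r j) - w 0\<bar> + \<bar>integral {0..?m} (\<lambda>t. Y j t - w t)\<bar>" by linarith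
    also have "\<bar>integral {0..?m} (\<lambda>t. Y j t - w t)\<bar> \<le> integral {0..?m} (\<lambda>t. \<bar>Y j t - w t\<bar>)"
      using integral_norm_bound_integral[OF integrable_diff[OF sub[OF Y_int] sub[OF w_int]] sub[OF D_int]] by simp
    also have "\<dots> \<le> integral {0..T} (\<lambda>t. \<bar>Y j t - w t\<bar>)"
      using m by (intro integral_subset_le sub D_int) auto
    finally show ?thesis by (simp add: err_def)
  qed
  have X_lim: "(\<lambda>j. X j t) \<longlonglongrightarrow> u t" if t: "t \<in> {0..T}" for t
  proof -
    have "(\<lambda>j. u (c j t)) \<longlonglongrightarrow> u t"
      by (rule continuous_on_tendsto_compose[OF contu c_lim[OF t] t]) (use c_range t in auto)
    moreover have "(\<lambda>j. X j t - u (c j t)) \<longlonglongrightarrow> 0"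
      by (rule Lim_null_comparison[OF _ err_lim])
         (use node_err[OF cell_bounds(1)[OF t]] in \<open>auto simp: X_def stepX_def c_def\<close>)
    ultimately have "(\<lambda>j. (X j t - u (c j t)) + u (c j t)) \<longlonglongrightarrow> 0 + u t" by (rule tendsto_add[rotated])
    then show ?thesis by simp
  qed
  have \<kappa>_lim: "(\<lambda>j. \<kappa> j t) \<longlonglongrightarrow> K l' t (u t) (w t)" if t: "t \<in> {0..T}" for t
    using K_tendsto[OF t l_lim X_lim[OF t] Y_lim[OF t]] by (simp add: \<kappa>_def stepK_def X_def Y_def)
  have \<kappa>_dct: "(\<lambda>t. K l' t (u t) (w t)) integrable_on {0..s}"
      "(\<lambda>j. integral {0..s} (\<kappa> j)) \<longlonglongrightarrow> integral {0..s} (\<lambda>t. K l' t (u t) (w t))" if s: "s \<in> {0..T}" for s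
  proof -
    have 1: "\<kappa> j integrable_on {0..s}" for j
      unfolding \<kappa>_def using s by (intro subint[OF _ _ stepK_integrable]) auto
    have 2: "g integrable_on {0..s}" using s by (intro subint[OF _ _ g_int]) auto
    have 3: "norm (\<kappa> j t) \<le> g t" if "t \<in> {0..s}" for j t
      using stepK_bound[of t] s that by (auto simp: \<kappa>_def)
    have 4: "(\<lambda>j. \<kappa> j t) \<longlonglongrightarrow> K l' t (u t) (w t)" if "t \<in> {0..s}" for t
      using s that by (intro \<kappa>_lim) auto
    show "(\<lambda>t. K l' t (u t) (w t)) integrable_on {0..s}"
      "(\<lambda>j. integral {0..s} (\<kappa> j)) \<longlonglongrightarrow> integral {0..s} (\<lambda>t. K l' t (u t) (w t))"
      using dominated_convergence[OF 1 2 3 4] by auto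
  qed
  have \<theta>_lim: "(\<lambda>j. \<theta> (l (r j))) \<longlonglongrightarrow> \<theta> l'"
    by (rule continuous_on_tendsto_compose[OF \<theta>_cont l_lim]) auto
  have w_eq: "w t = w 0 - \<theta> l' * integral {0..t} (\<lambda>t. K l' t (u t) (w t))" if t: "t \<in> {0..T}" for t
  proof (rule LIMSEQ_unique[OF S_lim[OF t]])
    show "(\<lambda>j. S j t) \<longlonglongrightarrow> w 0 - \<theta> l' * integral {0..t} (\<lambda>t. K l' t (u t) (w t))"
      using \<kappa>_dct(2)[OF t] unfolding S_def slope_def \<kappa>_def
      by (intro tendsto_diff tendsto_mult a_lim \<theta>_lim)
  qed
  have T: "T \<in> {0..T}" using T_pos by auto
  have defect_lim: "(\<lambda>j. defect (r j) (l (r j)) (a (r j))) \<longlonglongrightarrow> integral {0..T} (\<lambda>t. K l' t (u t) (w t))"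
    using \<kappa>_dct(2)[OF T] by (simp add: defect_eq \<kappa>_def)
  obtain ts where ts: "ts \<in> {0..T}" "\<And>t. t \<in> {0..T} \<Longrightarrow> u t \<le> u ts"
    using continuous_attains_sup[OF compact_Icc _ contu] T by auto
  \<comment> \<open>Bounded from below by the node that belongs to the cell of \<open>ts\<close>,
    from above through the node where the peak is attained.\<close>
  have peak_lim: "(\<lambda>j. peak (r j) (l (r j)) (a (r j)) (Suc (r j))) \<longlonglongrightarrow> u ts"
  proof (rule tendsto_sandwich)
    show "(\<lambda>j. X j ts) \<longlonglongrightarrow> u ts" by (rule X_lim[OF ts(1)])
    show "(\<lambda>j. u ts + err j) \<longlonglongrightarrow> u ts"
      using tendsto_add[OF tendsto_const err_lim, of "u ts"] by simp
    show "\<forall>\<^sub>F j in sequentially. X j ts \<le> peak (r j) (l (r j)) (a (r j)) (Suc (r j))"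
      unfolding X_def stepX_def by (intro always_eventually allI node_le_peak cell_bounds(1)[OF ts(1)])
    show "\<forall>\<^sub>F j in sequentially. peak (r j) (l (r j)) (a (r j)) (Suc (r j)) \<le> u ts + err j"
    proof (intro always_eventually allI)
      fix j
      obtain k where k: "k \<le> Suc (r j)"
        "peak (r j) (l (r j)) (a (r j)) (Suc (r j)) = fst (node (r j) (l (r j)) (a (r j)) k)"
        using peak_attained by blast
      have "u (mesh (r j) k) \<le> u ts" using mesh_range(1) mesh_range(2)[OF k(1)] by (intro ts(2)) auto
      then show "peak (r j) (l (r j)) (a (r j)) (Suc (r j)) \<le> u ts + err j"
        using node_err[OF k(1)] unfolding k(2) by linarith
    qed
  qed
  show thesis
    by (rule that[OF r l_lim a_lim contw _ \<kappa>_dct(1)[OF T] w_eq defect_lim peak_lim ts])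
       (simp_all add: u_def)
qed

end

subsection \<open>A priori estimates\<close>


text \<open>A crude Young inequality; used instead of Hoelder's, it treats \<open>p = 1\<close> and \<open>1 < p < \<infinity>\<close> alike.\<close>

lemma Lp_mult_powr_bound:
  assumes p: "1 \<le> p" and g: "in_Lp_nonneg p T g"
  shows "\<exists>G C. 0 \<le> C \<and> G integrable_on {0..T} \<and> (\<forall>t. 0 \<le> G t) \<and>
    (AE t in lebesgue_on {0..T}. 0 \<le> g t \<and> (\<forall>x\<ge>1. g t * x powr nagumo_exponent p \<le> G t + C * x))"
proof -
  have nn: "AE t in lebesgue_on {0..T}. 0 \<le> g t" using g by (auto simp: in_Lp_nonneg_def)
  show ?thesis
  proof (cases "p = \<infinity>")
    case True
    then obtain C0 where C0: "AE t in lebesgue_on {0..T}. \<bar>g t\<bar> \<le> C0"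
      using g by (auto simp: in_Lp_nonneg_def in_Lp_def)
    have "AE t in lebesgue_on {0..T}. 0 \<le> g t \<and> (\<forall>x\<ge>1. g t * x powr nagumo_exponent p \<le> 0 + \<bar>C0\<bar> * x)"
      using nn C0 by eventually_elim (auto simp: nagumo_exponent_def True intro!: mult_right_mono)
    then show ?thesis by (intro exI[of _ "\<lambda>_. 0"] exI[of _ "\<bar>C0\<bar>"]) (auto intro: integrable_const_ivl)
  next
    case False
    define P where "P = enn2real p"
    have P: "1 \<le> P" using p False enn2real_mono[of 1 p] by (simp add: P_def top.not_eq_extremum)
    have q: "nagumo_exponent p = (P - 1) / P" using False by (simp add: nagumo_exponent_def P_def)
    have int: "integrable (lebesgue_on {0..T}) (\<lambda>t. \<bar>g t\<bar> powr P)"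
      using g False by (auto simp: in_Lp_nonneg_def in_Lp_def P_def)
    \<comment> \<open>Two cases: if \<open>y \<le> x powr (1 / P)\<close>, the product is at most
      \<open>x\<close>; otherwise \<open>x \<le> y powr P\<close>, and the product is at most
      \<open>y powr P\<close>.\<close>
    have bound: "y * x powr ((P - 1) / P) \<le> \<bar>y\<bar> powr P + 1 * x" if "0 \<le> y" "1 \<le> x" for x y :: real
    proof (cases "y \<le> x powr (1 / P)")
      case True
      have "y * x powr ((P - 1) / P) \<le> x powr (1 / P) * x powr ((P - 1) / P)"
        using True by (intro mult_right_mono) auto
      also have "\<dots> = x" using P that by (simp flip: powr_add add: field_simps)
      finally show ?thesis by (simp add: add_increasing)
    next
      case False
      then have y: "x powr (1 / P) < y" by simp
      then have "0 < y" using that by (smt (verit) powr_ge_zero)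
      have "x = (x powr (1 / P)) powr P" using P that by (simp add: powr_powr)
      also have "\<dots> \<le> y powr P" using y P by (intro powr_mono2) auto
      finally have "x powr ((P - 1) / P) \<le> (y powr P) powr ((P - 1) / P)"
        using P that by (intro powr_mono2) auto
      also have "\<dots> = y powr (P - 1)" using P by (simp add: powr_powr)
      finally have "y * x powr ((P - 1) / P) \<le> y powr 1 * y powr (P - 1)"
        using \<open>0 < y\<close> by (intro mult_mono) auto
      also have "\<dots> = y powr P" by (simp only: powr_add[symmetric]) simp
      finally show ?thesis using that by simp
    qed
    have "AE t in lebesgue_on {0..T}. 0 \<le> g t \<and> (\<forall>x\<ge>1. g t * x powr nagumo_exponent p \<le> \<bar>g t\<bar> powr P + 1 * x)"
      unfolding q using nn by eventually_elim (use bound in blast)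
    moreover have "(\<lambda>t. \<bar>g t\<bar> powr P) integrable_on {0..T}"
      by (rule integrable_on_lebesgue_on[OF int]) simp
    ultimately show ?thesis by (intro exI[of _ "\<lambda>t. \<bar>g t\<bar> powr P"] exI[of _ 1]) simp
  qed
qed

text \<open>If the integrals over \<open>{M..N}\<close> stayed bounded, monotone convergence would
  make \<kappa> integrable on the half line, and the non-negative integral would be finite.\<close>

lemma integral_unbounded_of_nn_integral:
  fixes \<kappa> :: "real \<Rightarrow> real"
  assumes cont: "continuous_on {M..} \<kappa>" and nn: "\<And>x. M \<le> x \<Longrightarrow> 0 \<le> \<kappa> x"
    and inf: "(\<integral>\<^sup>+x\<in>{M..}. ennreal (\<kappa> x) \<partial>lborel) = \<infinity>"
  shows "\<exists>N\<ge>M. B < integral {M..N} \<kappa>"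
proof (rule ccontr)
  assume "\<not> ?thesis"
  then have B: "integral {M..N} \<kappa> \<le> B" if "M \<le> N" for N using that by force
  define F where "F = (\<lambda>(k::nat) x. if x \<in> {M..M + real k} then \<kappa> x else 0)"
  have kint: "\<kappa> integrable_on {M..N}" for N
    by (intro integrable_continuous_real continuous_on_subset[OF cont]) auto
  have F: "(F k has_integral integral {M..M + real k} \<kappa>) {M..}" for k
    unfolding F_def using integrable_integral[OF kint[of "M + real k"]]
    by (subst has_integral_restrict) auto
  have Fint: "integral {M..} (F k) = integral {M..M + real k} \<kappa>" for k
    using F by (rule integral_unique)
  have "\<kappa> integrable_on {M..}"
  proof (rule conjunct1[OF monotone_convergence_increasing[of F]])
    show "F k integrable_on {M..}" for k using F by (rule has_integral_integrable)
    show "F k x \<le> F (Suc k) x" if "x \<in> {M..}" for k x using that nn by (auto simp: F_def)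
    show "(\<lambda>k. F k x) \<longlonglongrightarrow> \<kappa> x" if x: "x \<in> {M..}" for x
    proof (rule tendsto_eventually)
      obtain n where n: "x - M \<le> real n" using real_arch_simple by blast
      show "\<forall>\<^sub>F k in sequentially. F k x = \<kappa> x"
        using x n by (intro eventually_sequentiallyI[of n]) (auto simp: F_def)
    qed
    have "0 \<le> integral {M..M + real k} \<kappa>" for k by (rule integral_nonneg[OF kint]) (use nn in auto)
    then show "bounded (range (\<lambda>k. integral {M..} (F k)))"
      unfolding Fint bounded_iff using B by (intro exI[of _ B]) auto
  qed
  then obtain I where "(\<kappa> has_integral I) {M..}" by blast
  from nn_integral_has_integral_lebesgue'[OF _ this] nn inf show False by simp
qed

text \<open>Telescoping; the induction moves by half of \<delta> because the local hypothesis wants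
  intervals strictly shorter than \<delta>.\<close>

lemma increments_le_of_local:
  fixes P Q :: "real \<Rightarrow> real"
  assumes \<delta>: "0 < \<delta>" and ab: "a \<le> b"
    and loc: "\<And>s t. a \<le> s \<Longrightarrow> s \<le> t \<Longrightarrow> t \<le> b \<Longrightarrow> t - s < \<delta> \<Longrightarrow> P t - P s \<le> Q t - Q s"
  shows "P b - P a \<le> Q b - Q a"
proof -
  have "P t - P a \<le> Q t - Q a" if "a \<le> t" "t \<le> b" "t - a \<le> real n * (\<delta> / 2)" for n t
    using that
  proof (induction n arbitrary: t)
    case 0
    then show ?case by simp
  next
    case (Suc n)
    define s where "s = max a (t - \<delta> / 2)"
    have s: "a \<le> s" "s \<le> t" "t - s < \<delta>" "s \<le> b" "s - a \<le> real n * (\<delta> / 2)"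
      using Suc.prems \<delta> by (auto simp: s_def max_def algebra_simps)
    show ?case using Suc.IH[OF s(1) s(4) s(5)] loc[OF s(1,2) Suc.prems(2) s(3)] by linarith
  qed
  moreover obtain n where "(b - a) / (\<delta> / 2) \<le> real n" using real_arch_simple by blast
  then have "b - a \<le> real n * (\<delta> / 2)" using \<delta> by (simp add: field_simps)
  ultimately show ?thesis using ab by blast
qed

lemma integrable_mult_continuous:
  fixes \<Psi> c :: "real \<Rightarrow> real"
  assumes "\<Psi> integrable_on {a..b}" "\<And>t. t \<in> {a..b} \<Longrightarrow> 0 \<le> \<Psi> t" "continuous_on {a..b} c"
  shows "(\<lambda>t. \<Psi> t * c t) integrable_on {a..b}"
proof -
  have "bounded (c ` {a..b})" using assms(3) by (intro compact_imp_bounded compact_continuous_image) auto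
  then obtain B where B: "\<And>t. t \<in> {a..b} \<Longrightarrow> \<bar>c t\<bar> \<le> B" by (auto simp: bounded_iff) (metis atLeastAtMost_iff)
  show ?thesis
  proof (rule measurable_bounded_by_integrable_imp_integrable)
    show "(\<lambda>t. \<Psi> t * c t) \<in> borel_measurable (lebesgue_on {a..b})"
      by (intro borel_measurable_times integrable_imp_measurable assms integrable_continuous_real)
    show "(\<lambda>t. \<Psi> t * B) integrable_on {a..b}" by (intro integrable_on_mult_left assms)
    show "norm (\<Psi> t * c t) \<le> \<Psi> t * B" if "t \<in> {a..b}" for t
      using assms(2)[OF that] B[OF that] by (simp add: abs_mult mult_left_mono)
  qed simp
qed

text \<open>Separation of variables in the differential inequality \<open>z' \<le> \<Psi> \<phi>(z)\<close>, with an arbitrary weight \<open>\<kappa>\<close>.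
  Working with increments over short intervals avoids differentiating \<open>z\<close>.\<close>

lemma integral_weight_le:
  fixes z \<Psi> \<phi> \<kappa> :: "real \<Rightarrow> real"
  assumes ab: "a \<le> b" and contz: "continuous_on {a..b} z"
    and range: "\<And>t. t \<in> {a..b} \<Longrightarrow> z t \<in> {N0..N}"
    and ends: "z a = N0" "z b = N"
    and \<kappa>: "continuous_on {N0..N} \<kappa>" "\<And>x. x \<in> {N0..N} \<Longrightarrow> 0 < \<kappa> x"
    and \<phi>: "continuous_on {N0..N} \<phi>" "\<And>x. x \<in> {N0..N} \<Longrightarrow> 0 \<le> \<phi> x"
    and \<Psi>: "\<Psi> integrable_on {a..b}" "\<And>t. t \<in> {a..b} \<Longrightarrow> 0 \<le> \<Psi> t"
    and incr: "\<And>s t. a \<le> s \<Longrightarrow> s \<le> t \<Longrightarrow> t \<le> b \<Longrightarrow> z t - z s \<le> integral {s..t} (\<lambda>r. \<Psi> r * \<phi> (z r))"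
  shows "integral {N0..N} \<kappa> \<le> integral {a..b} (\<lambda>r. \<Psi> r * (\<kappa> (z r) * \<phi> (z r)))"
    (is "_ \<le> ?I")
proof -
  have zsub: "z ` {a..b} \<subseteq> {N0..N}" using range by auto
  have c1: "continuous_on {a..b} (\<lambda>r. \<phi> (z r))" by (rule continuous_on_compose2[OF \<phi>(1) contz zsub])
  have c2: "continuous_on {a..b} (\<lambda>r. \<kappa> (z r))" by (rule continuous_on_compose2[OF \<kappa>(1) contz zsub])
  have i1: "(\<lambda>r. \<Psi> r * \<phi> (z r)) integrable_on {a..b}" by (rule integrable_mult_continuous[OF \<Psi> c1])
  have i2: "(\<lambda>r. \<Psi> r * (\<kappa> (z r) * \<phi> (z r))) integrable_on {a..b}"
    by (rule integrable_mult_continuous[OF \<Psi> continuous_on_mult[OF c2 c1]])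
  have N: "N0 \<le> N" using range[of a] ab ends by auto
  have kint: "\<kappa> integrable_on {N0..N}" by (rule integrable_continuous_real[OF \<kappa>(1)])
  have "integral {N0..N} \<kappa> \<le> (1 + \<epsilon>) * ?I" if \<epsilon>: "\<epsilon> > 0" for \<epsilon>
  proof -
    \<comment> \<open>The positive minimum of \<kappa> turns absolute oscillation into relative
      oscillation: over short intervals the weights differ at most by the factor
      \<open>1 + \<epsilon>\<close>.\<close>
    obtain m where m: "m \<in> {N0..N}" "\<And>x. x \<in> {N0..N} \<Longrightarrow> \<kappa> m \<le> \<kappa> x"
      using continuous_attains_inf[OF compact_Icc _ \<kappa>(1)] N by auto
    have "\<epsilon> * \<kappa> m > 0" using \<epsilon> \<kappa>(2)[OF m(1)] by simp
    moreover have "uniformly_continuous_on {N0..N} \<kappa>"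
      by (rule compact_uniformly_continuous[OF \<kappa>(1) compact_Icc])
    ultimately obtain d1 where d1: "d1 > 0"
      "\<And>x y. x \<in> {N0..N} \<Longrightarrow> y \<in> {N0..N} \<Longrightarrow> dist x y < d1 \<Longrightarrow> dist (\<kappa> x) (\<kappa> y) < \<epsilon> * \<kappa> m"
      unfolding uniformly_continuous_on_def by metis
    have "uniformly_continuous_on {a..b} z"
      by (rule compact_uniformly_continuous[OF contz compact_Icc])
    then obtain d where d: "d > 0"
      "\<And>x y. x \<in> {a..b} \<Longrightarrow> y \<in> {a..b} \<Longrightarrow> dist x y < d \<Longrightarrow> dist (z x) (z y) < d1"
      unfolding uniformly_continuous_on_def using d1(1) by metis
    define H where "H = (\<lambda>t. integral {N0..z t} \<kappa>)"
    define Q where "Q = (\<lambda>t. (1 + \<epsilon>) * integral {a..t} (\<lambda>r. \<Psi> r * (\<kappa> (z r) * \<phi> (z r))))"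
    have "H b - H a \<le> Q b - Q a"
    proof (rule increments_le_of_local[OF d(1) ab])
      fix s t assume st: "a \<le> s" "s \<le> t" "t \<le> b" "t - s < d"
      have sub: "f integrable_on {s..t}" if "f integrable_on {a..b}" for f :: "real \<Rightarrow> real"
        using st by (intro integrable_subinterval_real[OF that]) auto
      have I: "integral {a..t} (\<lambda>r. \<Psi> r * (\<kappa> (z r) * \<phi> (z r))) - integral {a..s} (\<lambda>r. \<Psi> r * (\<kappa> (z r) * \<phi> (z r)))
         = integral {s..t} (\<lambda>r. \<Psi> r * (\<kappa> (z r) * \<phi> (z r)))"
        by (rule integral_diff_segment[OF i2 st(1-3)])
      have pos: "0 \<le> \<Psi> r * (\<kappa> (z r) * \<phi> (z r))" if "r \<in> {s..t}" for r
        using that st range[of r] \<kappa>(2)[of "z r"] \<phi>(2)[of "z r"] \<Psi>(2)[of r] by simp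
      have Inn: "0 \<le> integral {s..t} (\<lambda>r. \<Psi> r * (\<kappa> (z r) * \<phi> (z r)))"
        by (rule integral_nonneg[OF sub[OF i2] pos])
      have zst: "z s \<in> {N0..N}" "z t \<in> {N0..N}" using range[of s] range[of t] st by auto
      have "H t - H s \<le> (1 + \<epsilon>) * integral {s..t} (\<lambda>r. \<Psi> r * (\<kappa> (z r) * \<phi> (z r)))"
      proof (cases "z t \<le> z s")
        case True
        have "H t \<le> H s" unfolding H_def
          using True zst \<kappa>(2) by (intro integral_subset_le integrable_subinterval_real[OF kint]) (auto intro: less_imp_le)
        moreover have "0 \<le> (1 + \<epsilon>) * integral {s..t} (\<lambda>r. \<Psi> r * (\<kappa> (z r) * \<phi> (z r)))"
          using Inn \<epsilon> by simp
        ultimately show ?thesis by linarith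
      next
        case False
        have "continuous_on {z s..z t} \<kappa>" by (rule continuous_on_subset[OF \<kappa>(1)]) (use zst in auto)
        then obtain xm where xm: "xm \<in> {z s..z t}" "\<And>x. x \<in> {z s..z t} \<Longrightarrow> \<kappa> x \<le> \<kappa> xm"
          using continuous_attains_sup[OF compact_Icc, of "z s" "z t" \<kappa>] False by auto
        have xmN: "xm \<in> {N0..N}" using xm(1) zst by auto
        have near: "\<kappa> xm \<le> (1 + \<epsilon>) * \<kappa> (z r)" if r: "r \<in> {s..t}" for r
        proof -
          have rr: "r \<in> {a..b}" using r st by auto
          have "dist (z s) (z r) < d1" "dist (z t) (z r) < d1"
            using d(2)[of s r] d(2)[of t r] r rr st by (auto simp: dist_real_def)
          then have "dist xm (z r) < d1" using xm(1) by (auto simp: dist_real_def)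
          then have "dist (\<kappa> xm) (\<kappa> (z r)) < \<epsilon> * \<kappa> m" by (rule d1(2)[OF xmN range[OF rr]])
          also have "\<dots> \<le> \<epsilon> * \<kappa> (z r)" using m(2)[OF range[OF rr]] \<epsilon> by simp
          finally show ?thesis by (simp add: dist_real_def algebra_simps)
        qed
        have "H t - H s = integral {z s..z t} \<kappa>"
          unfolding H_def using zst False by (intro integral_diff_segment[OF kint]) auto
        also have "\<dots> \<le> integral {z s..z t} (\<lambda>x. \<kappa> xm)"
          using zst by (intro integral_le integrable_subinterval_real[OF kint] integrable_const_ivl xm(2)) auto
        also have "\<dots> = \<kappa> xm * (z t - z s)" using False by simp
        also have "\<dots> \<le> \<kappa> xm * integral {s..t} (\<lambda>r. \<Psi> r * \<phi> (z r))"
          using \<kappa>(2)[OF xmN] by (intro mult_left_mono incr st) auto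
        also have "\<dots> = integral {s..t} (\<lambda>r. \<kappa> xm * (\<Psi> r * \<phi> (z r)))" by simp
        also have "\<dots> \<le> integral {s..t} (\<lambda>r. (1 + \<epsilon>) * (\<Psi> r * (\<kappa> (z r) * \<phi> (z r))))"
        proof (rule integral_le)
          show "(\<lambda>r. \<kappa> xm * (\<Psi> r * \<phi> (z r))) integrable_on {s..t}"
            by (intro integrable_on_mult_right sub i1)
          show "(\<lambda>r. (1 + \<epsilon>) * (\<Psi> r * (\<kappa> (z r) * \<phi> (z r)))) integrable_on {s..t}"
            by (intro integrable_on_mult_right sub i2)
          fix r assume r: "r \<in> {s..t}"
          then have "0 \<le> \<Psi> r * \<phi> (z r)"
            using st range[of r] \<phi>(2)[of "z r"] \<Psi>(2)[of r] by simp
          from mult_right_mono[OF near[OF r] this]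
          show "\<kappa> xm * (\<Psi> r * \<phi> (z r)) \<le> (1 + \<epsilon>) * (\<Psi> r * (\<kappa> (z r) * \<phi> (z r)))"
            by (simp add: algebra_simps)
        qed
        also have "\<dots> = (1 + \<epsilon>) * integral {s..t} (\<lambda>r. \<Psi> r * (\<kappa> (z r) * \<phi> (z r)))" by simp
        finally show ?thesis .
      qed
      also have "\<dots> = Q t - Q s" unfolding Q_def by (simp only: flip: I right_diff_distrib)
      finally show "H t - H s \<le> Q t - Q s" .
    qed
    then show ?thesis by (simp add: H_def Q_def ends)
  qed
  note * = this
  show ?thesis
  proof (rule ccontr)
    assume "\<not> ?thesis"
    then have lt: "?I < integral {N0..N} \<kappa>" by simp
    have "0 \<le> ?I"
      using range \<kappa>(2) \<phi>(2) \<Psi>(2) by (intro integral_nonneg i2 mult_nonneg_nonneg) (auto intro: less_imp_le)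
    \<comment> \<open>Makes \<epsilon> times the right-hand integral at most half of the supposed
      gap; the added 1 prevents division by zero.\<close>
    define \<epsilon> where "\<epsilon> = (integral {N0..N} \<kappa> - ?I) / (2 * (?I + 1))"
    have "\<epsilon> > 0" using lt \<open>0 \<le> ?I\<close> by (simp add: \<epsilon>_def)
    have "\<epsilon> * ?I \<le> \<epsilon> * (?I + 1)" using \<open>\<epsilon> > 0\<close> by simp
    also have "\<dots> = (integral {N0..N} \<kappa> - ?I) / 2" using \<open>0 \<le> ?I\<close> by (simp add: \<epsilon>_def field_simps)
    finally show False using *[OF \<open>\<epsilon> > 0\<close>] lt by (simp add: algebra_simps)
  qed
qed


section \<open>Bound on the slope from the Nagumo condition\<close>

lemma compact_superlevel:
  fixes z :: "real \<Rightarrow> real"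
  assumes "continuous_on {a..b} z"
  shows "compact {t \<in> {a..b}. c \<le> z t}"
proof -
  have "closed ({a..b} \<inter> z -` {c..})"
    by (rule continuous_closed_preimage[OF assms]) auto
  then have "compact ({a..b} \<inter> ({a..b} \<inter> z -` {c..}))" by (intro compact_Int_closed compact_Icc)
  also have "{a..b} \<inter> ({a..b} \<inter> z -` {c..}) = {t \<in> {a..b}. c \<le> z t}" by auto
  finally show ?thesis .
qed

text \<open>\<open>b\<close> is the first time at level \<open>N\<close>, and \<open>a\<close> the
  last time before \<open>b\<close> at level \<open>N0\<close>; the intermediate value theorem keeps
  \<open>z\<close> between the levels from \<open>a\<close> to \<open>b\<close>.\<close>

lemma continuous_crossing:
  fixes z :: "real \<Rightarrow> real"
  assumes t1: "0 \<le> t1" and contz: "continuous_on {0..t1} z"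
    and NN: "N0 < N" and z: "z 0 \<le> N0" "N \<le> z t1"
  obtains a b where "0 \<le> a" "a \<le> b" "b \<le> t1" "z a = N0" "z b = N"
    "\<And>t. a \<le> t \<Longrightarrow> t \<le> b \<Longrightarrow> N0 \<le> z t \<and> z t \<le> N"
proof -
  define U where "U = {t \<in> {0..t1}. N \<le> z t}"
  have "compact U" unfolding U_def by (rule compact_superlevel[OF contz])
  moreover have "t1 \<in> U" using t1 z by (auto simp: U_def)
  ultimately obtain b where b: "b \<in> U" "\<And>t. t \<in> U \<Longrightarrow> b \<le> t"
    using compact_attains_inf[of U] by blast
  have b01: "0 \<le> b" "b \<le> t1" "N \<le> z b" using b(1) by (auto simp: U_def)
  have contb: "continuous_on {0..b} z" by (rule continuous_on_subset[OF contz]) (use b01 in auto)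
  have below: "z t \<le> N" if "0 \<le> t" "t \<le> b" for t
  proof (rule ccontr)
    assume "\<not> z t \<le> N"
    have "continuous_on {0..t} z" by (rule continuous_on_subset[OF contb]) (use that in auto)
    then obtain x where x: "0 \<le> x" "x \<le> t" "z x = N"
      using IVT'[of z 0 N t] z NN \<open>0 \<le> t\<close> \<open>\<not> z t \<le> N\<close> by auto
    then have "x \<in> U" using that b01 by (auto simp: U_def)
    then have "x = t" using b(2)[of x] x that by simp
    then show False using x \<open>\<not> z t \<le> N\<close> by simp
  qed
  have zb: "z b = N" using below[of b] b01 by simp
  define V where "V = {t \<in> {0..b}. - N0 \<le> - z t}"
  have "compact V" unfolding V_def by (intro compact_superlevel continuous_intros contb)
  moreover have "0 \<in> V" using b01 z by (auto simp: V_def)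
  ultimately obtain a where a: "a \<in> V" "\<And>t. t \<in> V \<Longrightarrow> t \<le> a"
    using compact_attains_sup[of V] by blast
  have a01: "0 \<le> a" "a \<le> b" "z a \<le> N0" using a(1) by (auto simp: V_def)
  have above: "N0 \<le> z t" if "a \<le> t" "t \<le> b" for t
  proof (rule ccontr)
    assume "\<not> N0 \<le> z t"
    have "continuous_on {t..b} z" by (rule continuous_on_subset[OF contb]) (use that a01 in auto)
    then obtain x where x: "t \<le> x" "x \<le> b" "z x = N0"
      using IVT'[of z t N0 b] zb NN \<open>t \<le> b\<close> \<open>\<not> N0 \<le> z t\<close> by auto
    then have "x \<in> V" using that a01 by (auto simp: V_def)
    then have "x = t" using a(2)[of x] x that by simp
    then show False using x \<open>\<not> N0 \<le> z t\<close> by simp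
  qed
  have "z a = N0" using above[of a] a01 by simp
  from that[OF a01(1,2) b01(2) this zb] show thesis using above below a01 by auto
qed

text \<open>A slope leaving [-N,N] would rise in modulus from \<open>N0\<close> to \<open>N\<close>
  with constant sign on some interval. Separation of variables with weight
  \<open>x powr q / \<phi> x\<close> bounds the integral of the weight by that of
  \<open>G + C z\<close>, where \<open>z\<close> is the modulus of the slope; and the integral of
  \<open>z\<close> is, up to sign, an increment of \<open>u\<close>, hence at most \<eta>. The
  growth bound enters only for moduli between \<open>N0\<close> and \<open>N\<close>, so truncating
  the nonlinearity beyond \<open>N\<close> leaves the argument intact.\<close>

lemma Nagumo_bound:
  fixes u w k \<Psi> \<phi> G :: "real \<Rightarrow> real"
  assumes contw: "continuous_on {0..T} w"
    and u: "\<And>t. t \<in> {0..T} \<Longrightarrow> u t = u0 + integral {0..t} w"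
    and u_range: "\<And>t. t \<in> {0..T} \<Longrightarrow> 0 \<le> u t \<and> u t \<le> \<eta>"
    and w: "\<And>t. t \<in> {0..T} \<Longrightarrow> w t = w 0 - \<theta> * integral {0..t} k"
    and w0: "\<bar>w 0\<bar> \<le> N0" and \<theta>: "0 \<le> \<theta>" "\<theta> \<le> 1"
    and k: "k integrable_on {0..T}"
    and k_bound: "\<And>t. t \<in> {0..T} \<Longrightarrow> N0 \<le> \<bar>w t\<bar> \<Longrightarrow> \<bar>w t\<bar> \<le> N \<Longrightarrow> \<bar>k t\<bar> \<le> \<Psi> t * \<phi> \<bar>w t\<bar>"
    and N: "1 \<le> N0" "N0 < N"
    and \<phi>: "continuous_on {N0..N} \<phi>" "\<And>x. x \<in> {N0..N} \<Longrightarrow> 0 < \<phi> x"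
    and \<Psi>: "\<Psi> integrable_on {0..T}" "\<And>t. t \<in> {0..T} \<Longrightarrow> 0 \<le> \<Psi> t"
    and G: "G integrable_on {0..T}" "\<And>t. t \<in> {0..T} \<Longrightarrow> 0 \<le> G t" and C: "0 \<le> C"
    and young: "\<And>t x. t \<in> {0..T} \<Longrightarrow> 1 \<le> x \<Longrightarrow> \<Psi> t * x powr q \<le> G t + C * x"
    and large: "integral {0..T} G + C * \<eta> < integral {N0..N} (\<lambda>x. x powr q / \<phi> x)"
    and t1: "t1 \<in> {0..T}"
  shows "\<bar>w t1\<bar> \<le> N"
proof (rule ccontr)
  assume "\<not> \<bar>w t1\<bar> \<le> N"
  define \<sigma> where "\<sigma> = (if 0 \<le> w t1 then 1 else - 1 :: real)"
  define z where "z = (\<lambda>t. \<sigma> * w t)"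
  have \<sigma>: "\<bar>\<sigma>\<bar> = 1" "\<sigma> * \<sigma> = 1" by (auto simp: \<sigma>_def)
  have z1: "N \<le> z t1" using \<open>\<not> \<bar>w t1\<bar> \<le> N\<close> by (auto simp: z_def \<sigma>_def)
  have abs_z: "\<bar>z t\<bar> = \<bar>w t\<bar>" for t by (simp add: z_def abs_mult \<sigma>)
  have z0: "z 0 \<le> N0" using w0 abs_z[of 0] by linarith
  have contz: "continuous_on {0..T} z" unfolding z_def by (intro continuous_intros contw)
  obtain a b where ab: "0 \<le> a" "a \<le> b" "b \<le> t1" "z a = N0" "z b = N"
    and zr: "\<And>t. a \<le> t \<Longrightarrow> t \<le> b \<Longrightarrow> N0 \<le> z t \<and> z t \<le> N"
    by (rule continuous_crossing[of t1 z N0 N])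
       (use t1 z0 z1 N continuous_on_subset[OF contz, of "{0..t1}"] in auto)
  have bT: "b \<le> T" using ab t1 by auto
  have sub: "f integrable_on {a..b}" if "f integrable_on {0..T}" for f :: "real \<Rightarrow> real"
    using ab bT by (intro integrable_subinterval_real[OF that]) auto
  have wz: "\<bar>w t\<bar> = z t" if "a \<le> t" "t \<le> b" for t
    using zr[OF that] N abs_z[of t] by linarith
  have czab: "continuous_on {a..b} z" by (rule continuous_on_subset[OF contz]) (use ab bT in auto)
  have \<Psi>ab: "\<Psi> integrable_on {a..b}" "\<And>t. t \<in> {a..b} \<Longrightarrow> 0 \<le> \<Psi> t"
    using sub[OF \<Psi>(1)] \<Psi>(2) ab bT by auto
  have c\<phi>: "continuous_on {a..b} (\<lambda>r. \<phi> (z r))"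
    by (rule continuous_on_compose2[OF \<phi>(1) czab]) (use zr in auto)
  have i\<phi>: "(\<lambda>r. \<Psi> r * \<phi> (z r)) integrable_on {a..b}"
    by (rule integrable_mult_continuous[OF \<Psi>ab c\<phi>])
  define \<kappa> where "\<kappa> = (\<lambda>x. x powr q / \<phi> x)"
  have \<kappa>\<phi>: "\<kappa> x * \<phi> x = x powr q" if "x \<in> {N0..N}" for x
    using \<phi>(2)[OF that] by (simp add: \<kappa>_def)
  have "integral {N0..N} \<kappa> \<le> integral {a..b} (\<lambda>r. \<Psi> r * (\<kappa> (z r) * \<phi> (z r)))"
  proof (rule integral_weight_le[OF ab(2) czab _ ab(4,5) _ _ \<phi>(1) _ \<Psi>ab])
    show "z t \<in> {N0..N}" if "t \<in> {a..b}" for t using zr that by auto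
    show "continuous_on {N0..N} \<kappa>" unfolding \<kappa>_def
      using N \<phi>(2) by (intro continuous_intros \<phi>(1)) force+
    show "0 < \<kappa> x" if "x \<in> {N0..N}" for x using \<phi>(2)[OF that] that N by (auto simp: \<kappa>_def)
    show "0 \<le> \<phi> x" if "x \<in> {N0..N}" for x using \<phi>(2)[OF that] by simp
    fix s t assume st: "a \<le> s" "s \<le> t" "t \<le> b"
    have kst: "k integrable_on {s..t}" by (rule integrable_subinterval_real[OF k]) (use st ab bT in auto)
    have "integral {0..t} k - integral {0..s} k = integral {s..t} k"
      using st ab bT by (intro integral_diff_segment[OF k]) auto
    moreover have "w t - w s = - (\<theta> * (integral {0..t} k - integral {0..s} k))"
      using w[of s] w[of t] st ab bT by (simp add: right_diff_distrib)
    moreover have "z t - z s = \<sigma> * (w t - w s)" by (simp add: z_def right_diff_distrib)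
    ultimately have "z t - z s \<le> \<bar>\<sigma> * \<theta> * integral {s..t} k\<bar>" by simp
    also have "\<dots> \<le> 1 * \<bar>integral {s..t} k\<bar>"
      unfolding abs_mult \<sigma>(1) using \<theta> by (intro mult_right_mono) auto
    also have "\<dots> \<le> integral {s..t} (\<lambda>r. \<Psi> r * \<phi> (z r))"
    proof -
      have "norm (integral {s..t} k) \<le> integral {s..t} (\<lambda>r. \<Psi> r * \<phi> (z r))"
      proof (rule integral_norm_bound_integral[OF kst])
        show "(\<lambda>r. \<Psi> r * \<phi> (z r)) integrable_on {s..t}"
          by (rule integrable_subinterval_real[OF i\<phi>]) (use st in auto)
        show "norm (k r) \<le> \<Psi> r * \<phi> (z r)" if "r \<in> {s..t}" for r
          using k_bound[of r] wz[of r] zr[of r] that st ab bT by auto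
      qed
      then show ?thesis by simp
    qed
    finally show "z t - z s \<le> integral {s..t} (\<lambda>r. \<Psi> r * \<phi> (z r))" .
  qed
  also have "\<dots> \<le> integral {a..b} (\<lambda>r. G r + C * z r)"
  proof (rule integral_le)
    have "(\<lambda>r. \<Psi> r * (z r powr q)) integrable_on {a..b}"
      using zr N by (intro integrable_mult_continuous[OF \<Psi>ab] continuous_intros czab) force+
    then show "(\<lambda>r. \<Psi> r * (\<kappa> (z r) * \<phi> (z r))) integrable_on {a..b}"
      by (rule integrable_eq) (use \<kappa>\<phi> zr in auto)
    show "(\<lambda>r. G r + C * z r) integrable_on {a..b}"
      by (intro integrable_add sub[OF G(1)] integrable_on_mult_right integrable_continuous_real czab)
    show "\<Psi> r * (\<kappa> (z r) * \<phi> (z r)) \<le> G r + C * z r" if r: "r \<in> {a..b}" for r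
      using young[of r "z r"] zr[of r] \<kappa>\<phi>[of "z r"] r N ab bT by auto
  qed
  also have "\<dots> = integral {a..b} G + C * integral {a..b} z"
    by (subst integral_add[OF sub[OF G(1)] integrable_on_mult_right[OF integrable_continuous_real[OF czab]]]) simp
  also have "integral {a..b} G \<le> integral {0..T} G"
    using ab bT G by (intro integral_subset_le sub) auto
  also have "C * integral {a..b} z \<le> C * \<eta>"
  proof (rule mult_left_mono[OF _ C])
    have "integral {a..b} z = \<sigma> * integral {a..b} w" unfolding z_def by simp
    also have "integral {a..b} w = u b - u a"
      using u[of a] u[of b] ab bT
        integral_diff_segment[OF integrable_continuous_real[OF contw] ab(1,2) bT] by simp
    also have "\<sigma> * (u b - u a) \<le> \<eta>" using u_range[of a] u_range[of b] ab bT by (auto simp: \<sigma>_def)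
    finally show "integral {a..b} z \<le> \<eta>" .
  qed
  finally show False using large by (simp add: \<kappa>_def)
qed

text \<open>Where \<open>u < 0\<close>, \<open>k\<close> is non-negative and \<open>w\<close> cannot
  increase. Once \<open>u\<close> is negative it has met a negative slope, so it stays negative
  until \<open>T\<close>; then \<open>w T < 0\<close> contradicts \<open>w T = w 0\<close>.\<close>

lemma shooting_solution_nonneg:
  fixes u w k :: "real \<Rightarrow> real"
  assumes T: "0 < T" and contw: "continuous_on {0..T} w"
    and u: "\<And>t. t \<in> {0..T} \<Longrightarrow> u t = w 0 + integral {0..t} w"
    and w: "\<And>t. t \<in> {0..T} \<Longrightarrow> w t = w 0 - \<theta> * integral {0..t} k"
    and k: "k integrable_on {0..T}" "integral {0..T} k = 0" and \<theta>: "0 \<le> \<theta>" and w0: "0 \<le> w 0"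
    and sign: "\<And>t. t \<in> {0..T} \<Longrightarrow> u t < 0 \<Longrightarrow> 0 \<le> k t"
    and t: "t \<in> {0..T}"
  shows "0 \<le> u t"
proof (rule ccontr)
  assume neg: "\<not> 0 \<le> u t"
  have wint: "w integrable_on {0..T}" by (rule integrable_continuous_real[OF contw])
  have udiff: "u y - u x = integral {x..y} w" if "0 \<le> x" "x \<le> y" "y \<le> T" for x y
    using u[of x] u[of y] integral_diff_segment[OF wint that] that by simp
  have contu: "continuous_on {0..T} u"
  proof -
    have "continuous_on {0..T} (\<lambda>t. w 0 + integral {0..t} w)"
      by (intro continuous_intros indefinite_integral_continuous_1 wint)
    then show ?thesis by (subst continuous_on_cong[OF refl u])
  qed
  have u0: "u 0 = w 0" using u[of 0] T by simp
  have "compact {s\<in>{0..t}. 0 \<le> u s}"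
    using t by (intro compact_superlevel continuous_on_subset[OF contu]) auto
  moreover have "0 \<in> {s\<in>{0..t}. 0 \<le> u s}" using t u0 w0 by auto
  ultimately obtain a where a: "a \<in> {s\<in>{0..t}. 0 \<le> u s}"
    "\<And>s. s \<in> {s\<in>{0..t}. 0 \<le> u s} \<Longrightarrow> s \<le> a"
    using compact_attains_sup[of "{s\<in>{0..t}. 0 \<le> u s}"] by auto
  have after: "u s < 0" if "a < s" "s \<le> t" for s
  proof (rule ccontr)
    assume "\<not> u s < 0"
    then have "s \<le> a" using that a(1) by (intro a(2)) auto
    then show False using that by simp
  qed
  have at: "0 \<le> a" "a < t" "0 \<le> u a" using a(1) neg by (auto simp: less_le)
  have "\<exists>b\<in>{a..t}. w b < 0"
  proof (rule ccontr)
    assume "\<not> ?thesis"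
    then have "0 \<le> integral {a..t} w"
      using t at by (intro integral_nonneg integrable_subinterval_real[OF wint]) (auto simp: not_less)
    then show False using udiff[of a t] at t neg by simp
  qed
  then obtain b where b: "a \<le> b" "b \<le> t" "w b < 0" by auto
  \<comment> \<open>At the two end points \<open>u\<close> may vanish, and the sign of
    \<open>k\<close> is unknown there; altering \<open>k\<close> at these points does not change its
    integral.\<close>
  have wdec: "w y \<le> w x" if "0 \<le> x" "x \<le> y" "y \<le> T" "\<And>s. x < s \<Longrightarrow> s < y \<Longrightarrow> u s < 0" for x y
  proof -
    have kxy: "k integrable_on {x..y}" by (rule integrable_subinterval_real[OF k(1)]) (use that in auto)
    have "0 \<le> integral {x..y} (\<lambda>s. if s \<in> {x, y} then 0 else k s)"
    proof (rule integral_nonneg)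
      show "(\<lambda>s. if s \<in> {x, y} then 0 else k s) integrable_on {x..y}"
        by (rule integrable_spike_finite[OF _ _ kxy, of "{x, y}"]) auto
      show "0 \<le> (if s \<in> {x, y} then 0 else k s)" if "s \<in> {x..y}" for s
        using that sign[of s] \<open>\<And>s. x < s \<Longrightarrow> s < y \<Longrightarrow> u s < 0\<close>[of s] \<open>0 \<le> x\<close> \<open>y \<le> T\<close> by auto
    qed
    also have "integral {x..y} (\<lambda>s. if s \<in> {x, y} then 0 else k s) = integral {x..y} k"
      by (rule integral_spike[of "{x, y}"]) auto
    finally have "0 \<le> integral {0..y} k - integral {0..x} k"
      using integral_diff_segment[OF k(1) that(1-3)] by simp
    then have "0 \<le> \<theta> * (integral {0..y} k - integral {0..x} k)" using \<theta> by simp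
    then show ?thesis using w[of x] w[of y] that by (simp add: algebra_simps)
  qed
  have wt: "w t \<le> w b" using b at t after by (intro wdec) auto
  \<comment> \<open>Up to a first return time \<open>c\<close> the slope would stay below
    \<open>w t\<close>, which is negative, so \<open>u\<close> could not have risen.\<close>
  have neg': "u s < 0" if "t \<le> s" "s \<le> T" for s
  proof (rule ccontr)
    assume ns: "\<not> u s < 0"
    have "continuous_on {t..s} u" by (rule continuous_on_subset[OF contu]) (use t that in auto)
    then have "compact {x\<in>{t..s}. 0 \<le> u x}" by (rule compact_superlevel)
    moreover have "s \<in> {x\<in>{t..s}. 0 \<le> u x}" using ns that by auto
    ultimately obtain c where c: "c \<in> {x\<in>{t..s}. 0 \<le> u x}"
      "\<And>x. x \<in> {x\<in>{t..s}. 0 \<le> u x} \<Longrightarrow> c \<le> x"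
      using compact_attains_inf[of "{x\<in>{t..s}. 0 \<le> u x}"] by blast
    have before: "u x < 0" if "t \<le> x" "x < c" for x
    proof (rule ccontr)
      assume "\<not> u x < 0"
      then have "c \<le> x" using that c(1) by (intro c(2)) auto
      then show False using that by simp
    qed
    have "w x \<le> w t" if "x \<in> {t..c}" for x
      using that c(1) \<open>s \<le> T\<close> t before by (intro wdec) auto
    then have "integral {t..c} w \<le> integral {t..c} (\<lambda>x. 0)"
      using wt b c(1) \<open>s \<le> T\<close> t
      by (intro integral_le integrable_subinterval_real[OF wint] integrable_const_ivl) force+
    then show False using udiff[of t c] c(1) \<open>s \<le> T\<close> t neg by auto
  qed
  have "w T \<le> w t" using t neg' by (intro wdec) auto
  moreover have "w T = w 0" using w[of T] T k(2) by simp
  ultimately show False using wt b w0 by linarith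
qed

text \<open>A local Gronwall argument: near a common zero of \<open>u\<close> and \<open>w\<close>,
  the maximum of \<open>\<bar>u\<bar> + \<bar>w\<bar>\<close> is at most half of itself. So the set
  of common zeros is open as well as closed in the interval.\<close>

lemma linear_growth_unique_zero:
  fixes u w h \<beta> :: "real \<Rightarrow> real"
  assumes contw: "continuous_on {0..T} w"
    and u: "\<And>t. t \<in> {0..T} \<Longrightarrow> u t = u0 + integral {0..t} w"
    and w: "\<And>t. t \<in> {0..T} \<Longrightarrow> w t = w0 - integral {0..t} h"
    and h: "h integrable_on {0..T}"
    and \<beta>: "\<beta> integrable_on {0..T}" "\<And>t. t \<in> {0..T} \<Longrightarrow> 0 \<le> \<beta> t" and \<rho>: "0 < \<rho>"
    and growth: "\<And>t. t \<in> {0..T} \<Longrightarrow> \<bar>u t\<bar> \<le> \<rho> \<Longrightarrow> \<bar>w t\<bar> \<le> \<rho> \<Longrightarrow> \<bar>h t\<bar> \<le> \<beta> t * (\<bar>u t\<bar> + \<bar>w t\<bar>)"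
    and t0: "t0 \<in> {0..T}" "u t0 = 0" "w t0 = 0"
    and t: "t \<in> {0..T}"
  shows "u t = 0"
proof -
  have wint: "w integrable_on {0..T}" by (rule integrable_continuous_real[OF contw])
  have contu: "continuous_on {0..T} u"
  proof -
    have "continuous_on {0..T} (\<lambda>t. u0 + integral {0..t} w)"
      by (intro continuous_intros indefinite_integral_continuous_1 wint)
    then show ?thesis by (subst continuous_on_cong[OF refl u])
  qed
  define z where "z = (\<lambda>t. \<bar>u t\<bar> + \<bar>w t\<bar>)"
  have contz: "continuous_on {0..T} z" unfolding z_def by (intro continuous_intros contu contw)
  have \<beta>1: "(\<lambda>t. \<beta> t + 1) integrable_on {0..T}" by (intro integrable_add \<beta> integrable_const_ivl)
  \<comment> \<open>The summand 1 accounts for \<open>u' = w\<close>, the summand \<beta> for the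
    growth of \<open>h\<close>.\<close>
  define P where "P = (\<lambda>t. integral {0..t} (\<lambda>t. \<beta> t + 1))"
  have contP: "continuous_on {0..T} P" unfolding P_def by (rule indefinite_integral_continuous_1[OF \<beta>1])
  have step: "\<bar>u y - u x\<bar> + \<bar>w y - w x\<bar> \<le> m * \<bar>P y - P x\<bar>"
    if xy: "0 \<le> x" "x \<le> y" "y \<le> T" and z: "\<And>s. s \<in> {x..y} \<Longrightarrow> z s \<le> m" "m \<le> \<rho>" for x y m
  proof -
    have sub: "f integrable_on {x..y}" if "f integrable_on {0..T}" for f :: "real \<Rightarrow> real"
      using xy by (intro integrable_subinterval_real[OF that]) auto
    have m: "0 \<le> m" using z(1)[of x] xy by (auto simp: z_def)
    have "\<bar>u y - u x\<bar> = norm (integral {x..y} w)"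
      using u[of x] u[of y] integral_diff_segment[OF wint xy] xy by simp
    also have "\<dots> \<le> integral {x..y} (\<lambda>s. m)"
      using z by (intro integral_norm_bound_integral sub wint integrable_const_ivl) (force simp: z_def)
    finally have 1: "\<bar>u y - u x\<bar> \<le> integral {x..y} (\<lambda>s. m)" .
    have "\<bar>w y - w x\<bar> = norm (integral {x..y} h)"
      using w[of x] w[of y] integral_diff_segment[OF h xy] xy by simp
    also have "\<dots> \<le> integral {x..y} (\<lambda>s. \<beta> s * m)"
    proof (intro integral_norm_bound_integral sub h integrable_on_mult_left \<beta>(1))
      fix s assume s: "s \<in> {x..y}"
      then have "\<bar>h s\<bar> \<le> \<beta> s * z s"
        using growth[of s] z(1)[OF s] z(2) xy unfolding z_def by auto
      also have "\<dots> \<le> \<beta> s * m" using z(1)[OF s] \<beta>(2)[of s] s xy by (intro mult_left_mono) auto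
      finally show "norm (h s) \<le> \<beta> s * m" by simp
    qed
    finally have "\<bar>w y - w x\<bar> \<le> integral {x..y} (\<lambda>s. \<beta> s * m)" .
    with 1 have "\<bar>u y - u x\<bar> + \<bar>w y - w x\<bar> \<le> integral {x..y} (\<lambda>s. \<beta> s * m) + integral {x..y} (\<lambda>s. m)" by simp
    also have "\<dots> = integral {x..y} (\<lambda>s. \<beta> s * m + m)"
      by (rule integral_add[symmetric]) (intro sub integrable_on_mult_left \<beta>(1) integrable_const_ivl)+
    also have "\<dots> = integral {x..y} (\<lambda>s. (\<beta> s + 1) * m)" by (simp add: distrib_right)
    also have "\<dots> = m * (P y - P x)"
      unfolding P_def using integral_diff_segment[OF \<beta>1 xy] by simp
    also have "\<dots> \<le> m * \<bar>P y - P x\<bar>" using m by (intro mult_left_mono) auto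
    finally show ?thesis .
  qed
  define Z where "Z = {s \<in> {0..T}. z s = 0}"
  have "closedin (top_of_set {0..T}) Z"
    unfolding Z_def by (rule continuous_closedin_preimage_constant[OF contz])
  moreover have "openin (top_of_set {0..T}) Z"
    unfolding openin_euclidean_subtopology_iff
  proof (intro conjI ballI)
    show "Z \<subseteq> {0..T}" by (auto simp: Z_def)
    fix s assume "s \<in> Z"
    then have s: "s \<in> {0..T}" "z s = 0" "u s = 0" "w s = 0" by (auto simp: Z_def z_def)
    obtain d1 where d1: "d1 > 0" "\<And>y. y \<in> {0..T} \<Longrightarrow> dist y s < d1 \<Longrightarrow> dist (z y) (z s) < \<rho>"
      using contz s(1) \<rho> unfolding continuous_on_iff by blast
    obtain d2 where d2: "d2 > 0" "\<And>y. y \<in> {0..T} \<Longrightarrow> dist y s < d2 \<Longrightarrow> dist (P y) (P s) < 1 / 2"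
      using contP s(1) unfolding continuous_on_iff by (metis half_gt_zero zero_less_one)
    \<comment> \<open>Half of the minimum, so that the closed interval \<open>I\<close> lies inside
      both open neighbourhoods.\<close>
    define d where "d = min d1 d2 / 2"
    have d: "d > 0" "d < d1" "d < d2" using d1 d2 by (auto simp: d_def)
    define I where "I = {max 0 (s - d)..min T (s + d)}"
    have I: "I \<subseteq> {0..T}" "s \<in> I" using s d by (auto simp: I_def)
    have "compact I" "continuous_on I z"
      using I continuous_on_subset[OF contz] by (auto simp: I_def)
    then obtain x where x: "x \<in> I" "\<And>y. y \<in> I \<Longrightarrow> z y \<le> z x"
      using continuous_attains_sup[of I z] I by blast
    have xT: "x \<in> {0..T}" and xs: "\<bar>x - s\<bar> \<le> d" using x I by (auto simp: I_def)
    have "z x < \<rho>" using d1(2)[OF xT] xs d s by (auto simp: dist_real_def)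
    have P: "\<bar>P x - P s\<bar> \<le> 1 / 2" using d2(2)[OF xT] xs d by (auto simp: dist_real_def)
    have zx0: "0 \<le> z x" by (auto simp: z_def)
    have "z x \<le> z x * \<bar>P x - P s\<bar>"
    proof (cases "x \<le> s")
      case True
      have "\<bar>u s - u x\<bar> + \<bar>w s - w x\<bar> \<le> z x * \<bar>P s - P x\<bar>"
        using xT s True x I \<open>z x < \<rho>\<close> by (intro step) (auto simp: I_def)
      then show ?thesis using s by (simp add: z_def abs_minus_commute)
    next
      case False
      have "\<bar>u x - u s\<bar> + \<bar>w x - w s\<bar> \<le> z x * \<bar>P x - P s\<bar>"
        using xT s False x I \<open>z x < \<rho>\<close> by (intro step) (auto simp: I_def)
      then show ?thesis using s by (simp add: z_def)
    qed
    also have "\<dots> \<le> z x * (1 / 2)" using P zx0 by (intro mult_left_mono)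
    finally have "z x = 0" using zx0 by simp
    have "y \<in> Z" if "y \<in> {0..T}" "dist y s < d" for y
    proof -
      have "y \<in> I" using that by (auto simp: I_def dist_real_def)
      from x(2)[OF this] \<open>z x = 0\<close> that show ?thesis by (auto simp: Z_def z_def)
    qed
    then show "\<exists>e>0. \<forall>x'\<in>{0..T}. dist x' s < e \<longrightarrow> x' \<in> Z" using d by blast
  qed
  moreover have "t0 \<in> Z" using t0 by (auto simp: Z_def z_def)
  ultimately have "Z = {0..T}"
    using connected_Icc[of 0 T] unfolding connected_clopen by blast
  then have "t \<in> Z" using t by simp
  then have "\<bar>u t\<bar> + \<bar>w t\<bar> = 0" by (simp add: Z_def z_def)
  then show ?thesis by linarith
qed

subsection \<open>Existence of solutions with prescribed maximum\<close>


text \<open>All conditions hold at every \<open>t\<close>, a null set having been dealt with by the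
  caller. The bounds on \<open>F\<close> concern only positions in [0, max r R] and slopes up to
  \<open>N\<close>: outside this range the nonlinearity is truncated, and the limit trajectory is
  shown never to leave it.\<close>

lemma shooting_alternative:
  fixes T r R N0 N C q \<alpha>0 :: real and F :: "real \<Rightarrow> real \<Rightarrow> real \<Rightarrow> real"
    and v g1 g2 \<Psi> \<phi> G :: "real \<Rightarrow> real"
  assumes T: "0 < T" and r: "0 < r" and R: "0 < R" and \<alpha>0: "0 \<le> \<alpha>0"
    and F_meas: "\<And>s x. 0 \<le> s \<Longrightarrow> (\<lambda>t. F t s x) \<in> borel_measurable (lebesgue_on {0..T})"
    and F_cont: "\<And>t. t \<in> {0..T} \<Longrightarrow> continuous_on ({0..} \<times> UNIV) (\<lambda>(s, x). F t s x)"
    and F_bound: "\<And>t s x. t \<in> {0..T} \<Longrightarrow> 0 \<le> s \<Longrightarrow> s \<le> max r R \<Longrightarrow> \<bar>x\<bar> \<le> N \<Longrightarrow> \<bar>F t s x\<bar> \<le> g1 t"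
    and F_zero: "\<And>t x. t \<in> {0..T} \<Longrightarrow> F t 0 x = 0"
    and v: "v \<in> borel_measurable (lebesgue_on {0..T})" "\<And>t. t \<in> {0..T} \<Longrightarrow> 0 \<le> v t \<and> v t \<le> g2 t"
    and g: "g1 integrable_on {0..T}" "g2 integrable_on {0..T}"
    and nagumo: "\<And>t s x. t \<in> {0..T} \<Longrightarrow> 0 \<le> s \<Longrightarrow> s \<le> max r R \<Longrightarrow> N0 \<le> \<bar>x\<bar> \<Longrightarrow> \<bar>x\<bar> \<le> N \<Longrightarrow>
        \<bar>F t s x\<bar> + \<alpha>0 * v t \<le> \<Psi> t * \<phi> \<bar>x\<bar>"
    and N: "1 \<le> N0" "max r R \<le> N0" "N0 < N"
    and \<phi>: "continuous_on {N0..N} \<phi>" "\<And>x. x \<in> {N0..N} \<Longrightarrow> 0 < \<phi> x"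
    and \<Psi>: "\<Psi> integrable_on {0..T}" "\<And>t. t \<in> {0..T} \<Longrightarrow> 0 \<le> \<Psi> t"
    and G: "G integrable_on {0..T}" "\<And>t. t \<in> {0..T} \<Longrightarrow> 0 \<le> G t" and C: "0 \<le> C"
    and young: "\<And>t x. t \<in> {0..T} \<Longrightarrow> 1 \<le> x \<Longrightarrow> \<Psi> t * x powr q \<le> G t + C * x"
    and large: "integral {0..T} G + C * max r R < integral {N0..N} (\<lambda>x. x powr q / \<phi> x)"
    and neg: "integral {0..T} (\<lambda>t. F t (r / (1 + T) + r / (1 + T) * t) (r / (1 + T))) < 0"
  obtains l u w ts where "-1 < l" "l \<le> 1" "continuous_on {0..T} w" "0 \<le> w 0"
    "\<And>t. t \<in> {0..T} \<Longrightarrow> u t = w 0 + integral {0..t} w"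
    "(\<lambda>t. F t (u t) (w t) + \<alpha>0 * max 0 l * v t) integrable_on {0..T}"
    "\<And>t. t \<in> {0..T} \<Longrightarrow> \<bar>F t (u t) (w t) + \<alpha>0 * max 0 l * v t\<bar> \<le> g1 t + \<alpha>0 * g2 t"
    "\<And>t. t \<in> {0..T} \<Longrightarrow> w t = w 0 - min 1 (1 + l) * integral {0..t} (\<lambda>t. F t (u t) (w t) + \<alpha>0 * max 0 l * v t)"
    "integral {0..T} (\<lambda>t. F t (u t) (w t) + \<alpha>0 * max 0 l * v t) = 0"
    "ts \<in> {0..T}" "\<And>t. t \<in> {0..T} \<Longrightarrow> 0 \<le> u t \<and> u t \<le> u ts"
    "l \<le> 0 \<and> u ts = r \<or> 0 \<le> l \<and> u ts = R \<or>
      l = 0 \<and> min r R \<le> u ts \<and> u ts \<le> max r R \<or> l = 1 \<and> u ts \<le> R"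
proof -
  define \<eta> where "\<eta> = max r R"
  have \<eta>: "r \<le> \<eta>" "R \<le> \<eta>" "0 < \<eta>" "\<eta> \<le> N" "\<eta> \<le> N0" using r R N by (auto simp: \<eta>_def)
  \<comment> \<open>Clamping the position also avoids negative arguments, at which \<open>F\<close>
    carries no information.\<close>
  define Fc where "Fc = (\<lambda>t s x. F t (max 0 (min s \<eta>)) (max (- N) (min x N)))"
  \<comment> \<open>The middle term of \<open>K\<close> is positive exactly for \<open>s < 0\<close>; it makes trajectories that cross zero keep falling.\<close>
  define K where "K = (\<lambda>l t s x. Fc t s x + max 0 (min 1 (- s)) + \<alpha>0 * max 0 (min 1 l) * v t)"
  define \<theta> where "\<theta> = (\<lambda>l::real. max 0 (min 1 (1 + l)))"
  have Fc_bound: "\<bar>Fc t s x\<bar> \<le> g1 t" if "t \<in> {0..T}" for t s x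
    unfolding Fc_def using that \<eta> N by (intro F_bound) (auto simp: \<eta>_def[symmetric])
  interpret euler_shooting T K \<theta> "\<lambda>t. g1 t + 1 + \<alpha>0 * g2 t"
  proof
    show "0 < T" by (rule T)
    show "(\<lambda>t. K l t s x) \<in> borel_measurable (lebesgue_on {0..T})" for l s x
      unfolding K_def Fc_def
      by (intro borel_measurable_add borel_measurable_times borel_measurable_const F_meas v(1)) auto
    show "continuous_on UNIV (\<lambda>(l, s, x). K l t s x)" if t: "t \<in> {0..T}" for t
    proof -
      have "continuous_on UNIV (\<lambda>p::real\<times>real\<times>real. (\<lambda>(s, x). F t s x)
          (max 0 (min (fst (snd p)) \<eta>), max (- N) (min (snd (snd p)) N)))"
        by (rule continuous_on_compose2[OF F_cont[OF t]]) (auto intro!: continuous_intros)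
      then have 1: "continuous_on UNIV (\<lambda>p::real\<times>real\<times>real. Fc t (fst (snd p)) (snd (snd p)))"
        by (simp add: Fc_def)
      show ?thesis unfolding K_def case_prod_unfold by (intro continuous_intros 1)
    qed
    show "\<bar>K l t s x\<bar> \<le> g1 t + 1 + \<alpha>0 * g2 t" if t: "t \<in> {0..T}" for l t s x
    proof -
      have "0 \<le> \<alpha>0 * max 0 (min 1 l) * v t" using \<alpha>0 v(2)[OF t] by simp
      moreover have "\<alpha>0 * max 0 (min 1 l) * v t \<le> \<alpha>0 * 1 * g2 t"
        using \<alpha>0 v(2)[OF t] by (intro mult_mono mult_left_mono) auto
      ultimately show ?thesis using Fc_bound[OF t, of s x] unfolding K_def by linarith
    qed
    show "(\<lambda>t. g1 t + 1 + \<alpha>0 * g2 t) integrable_on {0..T}"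
      by (intro integrable_add integrable_on_mult_right g integrable_const_ivl)
    show "continuous_on UNIV \<theta>" unfolding \<theta>_def by (intro continuous_intros)
    show "0 \<le> \<theta> l" "\<theta> l \<le> 1" for l by (auto simp: \<theta>_def)
  qed
  have K_neg: "min 1 (- s) \<le> K l t s x" if "t \<in> {0..T}" "s < 0" for l t s x
    using that \<alpha>0 v(2)[OF that(1)] F_zero[OF that(1)] by (auto simp: K_def Fc_def)
  have K_inner: "K l t s x = F t s x + \<alpha>0 * max 0 l * v t" if "l \<le> 1" "0 \<le> s" "s \<le> \<eta>" "\<bar>x\<bar> \<le> N" for l t s x
  proof -
    have "max 0 (min s \<eta>) = s" "max (- N) (min x N) = x" "max 0 (min 1 (- s)) = 0" "min 1 l = l"
      using that by auto
    then show ?thesis by (simp add: K_def Fc_def)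
  qed
  define a0 where "a0 = r / (1 + T)"
  have a0: "0 < a0" "a0 * (1 + T) = r" using r T by (auto simp: a0_def)
  have a0r: "a0 \<le> r" using a0 T mult_left_mono[of 1 "1 + T" a0] by simp
  have h: "0 < T / real (Suc n)" for n using T by simp
  \<comment> \<open>A polygon that starts below zero never recovers, because \<open>K\<close> is
    positive at negative positions and its slope can only decrease. This yields the behaviour on the
    lower half plane.\<close>
  have node_neg: "fst (node n l a k) \<le> a \<and> snd (node n l a k) \<le> a" if "a < 0" "k \<le> Suc n" for n l a k
    using that(2)
  proof (induction k)
    case (Suc k)
    then have IH: "fst (node n l a k) \<le> a" "snd (node n l a k) \<le> a" by auto
    have "T / real (Suc n) * snd (node n l a k) \<le> 0"
      using h[of n] IH that(1) by (intro mult_nonneg_nonpos) auto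
    moreover have "0 \<le> integral {mesh n k..mesh n (Suc k)} (\<lambda>t. K l t (fst (node n l a k)) (snd (node n l a k)))"
    proof (rule integral_nonneg)
      show "(\<lambda>t. K l t (fst (node n l a k)) (snd (node n l a k))) integrable_on {mesh n k..mesh n (Suc k)}"
        by (rule subint[OF mesh_range(1) mesh_range(2)[OF Suc.prems] K_integrable])
      fix t assume "t \<in> {mesh n k..mesh n (Suc k)}"
      then have "t \<in> {0..T}" using mesh_range(1)[of n k] mesh_range(2)[OF Suc.prems] by auto
      from K_neg[OF this, of "fst (node n l a k)" l "snd (node n l a k)"]
      show "0 \<le> K l t (fst (node n l a k)) (snd (node n l a k))" using IH that(1) by auto
    qed
    then have "0 \<le> \<theta> l * integral {mesh n k..mesh n (Suc k)} (\<lambda>t. K l t (fst (node n l a k)) (snd (node n l a k)))"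
      using \<theta>_range(1)[of l] by simp
    ultimately show ?case using IH by auto
  qed simp
  have defect_pos: "0 < defect n l a" if a: "a < 0" for n l a
    unfolding defect_def
  proof (rule sum_pos)
    fix k assume "k \<in> {..<Suc n}"
    then have k: "k \<le> Suc n" "Suc k \<le> Suc n" by auto
    have m: "mesh n k < mesh n (Suc k)" using h[of n] by (simp add: mesh_Suc)
    have "0 < (mesh n (Suc k) - mesh n k) * min 1 (- a)" using m a by simp
    also have "\<dots> = integral {mesh n k..mesh n (Suc k)} (\<lambda>t. min 1 (- a))" using m by simp
    also have "\<dots> \<le> integral {mesh n k..mesh n (Suc k)} (\<lambda>t. K l t (fst (node n l a k)) (snd (node n l a k)))"
    proof (rule integral_le[OF integrable_const_ivl])
      show "(\<lambda>t. K l t (fst (node n l a k)) (snd (node n l a k))) integrable_on {mesh n k..mesh n (Suc k)}"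
        by (rule subint[OF mesh_range(1) mesh_range(2)[OF k(2)] K_integrable])
      fix t assume "t \<in> {mesh n k..mesh n (Suc k)}"
      then have "t \<in> {0..T}" using mesh_range(1)[of n k] mesh_range(2)[OF k(2)] by auto
      from K_neg[OF this, of "fst (node n l a k)" l "snd (node n l a k)"]
      show "min 1 (- a) \<le> K l t (fst (node n l a k)) (snd (node n l a k))"
        using node_neg[OF a k(1), of l] a by auto
    qed
    finally show "0 < integral {mesh n k..mesh n (Suc k)} (\<lambda>t. K l t (fst (node n l a k)) (snd (node n l a k)))" .
  qed auto
  have peak_neg: "peak n l a (Suc n) \<le> 0" if "a < 0" for n l a
    using peak_attained[of "Suc n" n l a] node_neg[OF that, of _ n l] that by (metis less_imp_le order_trans)
  have peak_ge: "a \<le> peak n l a (Suc n)" for n l a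
    using node_le_peak[of 0 "Suc n" n l a] by simp
  have clamp: "K (max (- 1) (min 1 l)) = K l" "\<theta> (max (- 1) (min 1 l)) = \<theta> l" for l
    by (auto simp: K_def \<theta>_def max_def min_def fun_eq_iff)
  have node_clamp: "node n (max (- 1) (min 1 l)) a k = node n l a k" for n l a k
    by (induction k) (simp_all add: clamp)
  have defect_clamp: "defect n l a = defect n (max (- 1) (min 1 l)) a" for n l a
    unfolding defect_def node_clamp clamp ..
  have peak_clamp: "peak n l a k = peak n (max (- 1) (min 1 l)) a k" for n l a k
    by (induction k) (simp_all add: node_clamp del: node.simps(2))
  have \<theta>_left: "\<theta> (- 1) = 0" by (simp add: \<theta>_def)
  \<comment> \<open>With \<theta> = 0 the polygon is exactly the line \<open>a * (1 + t)\<close>, so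
    its peak passes the value \<open>r\<close> precisely at \<open>a0\<close>.\<close>
  have node_left: "node n (- 1) a k = (a * (1 + mesh n k), a)" for n a k
    by (induction k) (auto simp: \<theta>_left mesh_0 mesh_Suc algebra_simps)
  have peak_lt: "peak n (- 1) a (Suc n) < r" if "a < a0" for n a
  proof -
    obtain j where j: "j \<le> Suc n" "peak n (- 1) a (Suc n) = a * (1 + mesh n j)"
      using peak_attained[of "Suc n" n "- 1" a] unfolding node_left by auto
    show ?thesis
    proof (cases "a < 0")
      case True
      then show ?thesis using peak_neg[OF True, of n "- 1"] r by simp
    next
      case False
      then have "a * (1 + mesh n j) \<le> a * (1 + T)" using mesh_range(2)[OF j(1)] by (intro mult_left_mono) auto
      also have "\<dots> < a0 * (1 + T)" using that T by (intro mult_strict_right_mono) auto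
      finally show ?thesis using a0 j by simp
    qed
  qed
  have peak_gt: "r < peak n (- 1) a (Suc n)" if "a0 < a" for n a
  proof -
    have "a0 * (1 + T) < a * (1 + T)" using that T by (intro mult_strict_right_mono) auto
    also have "\<dots> \<le> peak n (- 1) a (Suc n)"
      using node_le_peak[of "Suc n" "Suc n" n "- 1" a] unfolding node_left mesh_last by simp
    finally show ?thesis using a0 by simp
  qed
  define Q where "Q = (\<lambda>(l::real) (a::real) (G::real) (m::real). - 1 \<le> l \<and> l \<le> 1 \<and> 0 \<le> a \<and> a \<le> \<eta> \<and>
    (l = - 1 \<and> a = a0 \<and> 0 \<le> G \<or>
     G = 0 \<and> (l \<le> 0 \<and> m = r \<or> 0 \<le> l \<and> m = R \<or>
        l = 0 \<and> min r R \<le> m \<and> m \<le> max r R \<or> l = 1 \<and> m \<le> R)))"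
  have "\<exists>l a. Q l a (defect n l a) (peak n l a (Suc n))" for n
  proof -
    have "\<exists>l a. -1 \<le> l \<and> l \<le> 1 \<and>
      (l = -1 \<and> a = a0 \<and> 0 \<le> (\<lambda>p. defect n (fst p) (snd p)) (l, a) \<or>
       (\<lambda>p. defect n (fst p) (snd p)) (l, a) = 0 \<and> 0 \<le> a \<and>
       (l \<le> 0 \<and> (\<lambda>p. peak n (fst p) (snd p) (Suc n)) (l, a) = r \<or>
        0 \<le> l \<and> (\<lambda>p. peak n (fst p) (snd p) (Suc n)) (l, a) = R \<or>
        l = 0 \<and> min r R \<le> (\<lambda>p. peak n (fst p) (snd p) (Suc n)) (l, a) \<and>
          (\<lambda>p. peak n (fst p) (snd p) (Suc n)) (l, a) \<le> max r R \<or>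
        l = 1 \<and> (\<lambda>p. peak n (fst p) (snd p) (Suc n)) (l, a) \<le> R))"
    proof (rule planar_zero_alternative)
      show "continuous_on UNIV (\<lambda>p. defect n (fst p) (snd p))" by (rule defect_cont)
      show "continuous_on UNIV (\<lambda>p. peak n (fst p) (snd p) (Suc n))" by (rule peak_cont) simp
    qed (use r R defect_pos peak_neg peak_ge defect_clamp peak_clamp peak_lt peak_gt in
        \<open>simp_all del: peak.simps(2)\<close>)
    then obtain l a where la: "-1 \<le> l" "l \<le> 1"
      "l = -1 \<and> a = a0 \<and> 0 \<le> defect n l a \<or> defect n l a = 0 \<and> 0 \<le> a \<and>
       (l \<le> 0 \<and> peak n l a (Suc n) = r \<or> 0 \<le> l \<and> peak n l a (Suc n) = R \<or>
        l = 0 \<and> min r R \<le> peak n l a (Suc n) \<and> peak n l a (Suc n) \<le> max r R \<or>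
        l = 1 \<and> peak n l a (Suc n) \<le> R)"
      by (auto simp del: peak.simps(2))
    have "0 \<le> a" using la(3) a0 by auto
    moreover have "a \<le> \<eta>" using la(3) a0r \<eta> peak_ge[of a n l] unfolding \<eta>_def[symmetric] by linarith
    ultimately show ?thesis using la unfolding Q_def by blast
  qed
  then obtain l a where la: "\<And>n. Q (l n) (a n) (defect n (l n) (a n)) (peak n (l n) (a n) (Suc n))"
    by metis
  have la_range: "\<And>n. l n \<in> {-1..1}" "\<And>n. a n \<in> {0..\<eta>}" using la by (auto simp: Q_def)
  show thesis
  proof (rule Euler_limit[of l a \<eta>, OF la_range])
    fix \<rho> :: "nat \<Rightarrow> nat" and l' ts :: real and u w :: "real \<Rightarrow> real"
    assume \<rho>: "strict_mono (\<rho> :: nat \<Rightarrow> nat)" and l_lim: "(\<lambda>j. l (\<rho> j)) \<longlonglongrightarrow> l'"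
      and a_lim: "(\<lambda>j. a (\<rho> j)) \<longlonglongrightarrow> w 0"
      and contw: "continuous_on {0..T} w"
      and u: "\<And>t. t \<in> {0..T} \<Longrightarrow> u t = w 0 + integral {0..t} w"
      and Kint: "(\<lambda>t. K l' t (u t) (w t)) integrable_on {0..T}"
      and w: "\<And>t. t \<in> {0..T} \<Longrightarrow> w t = w 0 - \<theta> l' * integral {0..t} (\<lambda>t. K l' t (u t) (w t))"
      and d_lim: "(\<lambda>j. defect (\<rho> j) (l (\<rho> j)) (a (\<rho> j))) \<longlonglongrightarrow> integral {0..T} (\<lambda>t. K l' t (u t) (w t))"
      and p_lim: "(\<lambda>j. peak (\<rho> j) (l (\<rho> j)) (a (\<rho> j)) (Suc (\<rho> j))) \<longlonglongrightarrow> u ts"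
      and ts: "ts \<in> {0..T}" and u_max: "\<And>t. t \<in> {0..T} \<Longrightarrow> u t \<le> u ts"
    define I where "I = integral {0..T} (\<lambda>t. K l' t (u t) (w t))"
    have Qlim: "Q l' (w 0) I (u ts)"
    proof -
      have "closed {p. Q (fst p) (fst (snd p)) (fst (snd (snd p))) (snd (snd (snd p)))}"
        unfolding Q_def
        by (intro closed_Collect_conj closed_Collect_disj closed_Collect_le closed_Collect_eq continuous_intros)
      moreover have "\<And>j. (l (\<rho> j), a (\<rho> j), defect (\<rho> j) (l (\<rho> j)) (a (\<rho> j)), peak (\<rho> j) (l (\<rho> j)) (a (\<rho> j)) (Suc (\<rho> j)))
        \<in> {p. Q (fst p) (fst (snd p)) (fst (snd (snd p))) (snd (snd (snd p)))}"
        using la by (simp del: peak.simps(2))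
      moreover have "(\<lambda>j. (l (\<rho> j), a (\<rho> j), defect (\<rho> j) (l (\<rho> j)) (a (\<rho> j)), peak (\<rho> j) (l (\<rho> j)) (a (\<rho> j)) (Suc (\<rho> j))))
        \<longlonglongrightarrow> (l', w 0, I, u ts)"
        unfolding I_def by (intro tendsto_Pair l_lim a_lim d_lim p_lim)
      ultimately have "(l', w 0, I, u ts) \<in> {p. Q (fst p) (fst (snd p)) (fst (snd (snd p))) (snd (snd (snd p)))}"
        by (rule closed_sequentially)
      then show ?thesis by simp
    qed
    have l': "- 1 \<le> l'" "l' \<le> 1" and w0: "0 \<le> w 0" "w 0 \<le> \<eta>" using Qlim by (auto simp: Q_def)
    \<comment> \<open>At \<open>l' = -1\<close> the limit is the line \<open>a0 * (1 + t)\<close>,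
      either directly or because a non-decreasing line attains its maximum \<open>r\<close> at
      \<open>T\<close>. Its defect is then the integral in \<open>neg\<close>, contrary to
      \<open>0 \<le> I\<close>.\<close>
    have l'_ne: "l' \<noteq> - 1"
    proof
      assume l1: "l' = - 1"
      have "\<theta> l' = 0" by (simp add: l1 \<theta>_def)
      then have wc: "w t = w 0" if "t \<in> {0..T}" for t using w[OF that] by simp
      have uc: "u t = w 0 * (1 + t)" if "t \<in> {0..T}" for t
      proof -
        have "integral {0..t} w = integral {0..t} (\<lambda>_. w 0)" using that by (intro integral_cong wc) auto
        then show ?thesis using u[OF that] that by (simp add: algebra_simps)
      qed
      have "w 0 = a0 \<and> 0 \<le> I"
      proof (cases "w 0 = a0 \<and> 0 \<le> I")
        case False
        then have "I = 0" "u ts = r" using Qlim l1 by (auto simp: Q_def)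
        have "w 0 * (1 + ts) \<le> w 0 * (1 + T)" using ts w0 by (intro mult_left_mono) auto
        then have "w 0 * (1 + T) = r" using uc[OF ts] uc[of T] u_max[of T] T \<open>u ts = r\<close> by simp
        then have "w 0 = a0" using T by (simp add: a0_def field_simps)
        with \<open>I = 0\<close> show ?thesis by simp
      qed simp
      moreover have "K l' t (u t) (w t) = F t (a0 + a0 * t) a0" if t: "t \<in> {0..T}" "w 0 = a0" for t
      proof -
        have "0 \<le> a0 * (1 + t)" using a0 t by simp
        moreover have "a0 * (1 + t) \<le> a0 * (1 + T)" using a0 t by (intro mult_left_mono) auto
        ultimately have "0 \<le> a0 * (1 + t)" "a0 * (1 + t) \<le> \<eta>" "\<bar>a0\<bar> \<le> N" using a0 a0r \<eta> by linarith+
        from K_inner[OF l'(2) this, of t] show ?thesis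
          using uc[OF t(1)] wc[OF t(1)] t(2) l1 by (simp add: distrib_left)
      qed
      then have "I = integral {0..T} (\<lambda>t. F t (a0 + a0 * t) a0)" if "w 0 = a0"
        unfolding I_def using that by (intro integral_cong) auto
      ultimately show False using neg unfolding a0_def by auto
    qed
    then have alt: "I = 0" "l' \<le> 0 \<and> u ts = r \<or> 0 \<le> l' \<and> u ts = R \<or>
        l' = 0 \<and> min r R \<le> u ts \<and> u ts \<le> max r R \<or> l' = 1 \<and> u ts \<le> R"
      using Qlim by (auto simp: Q_def)
    have u_nonneg: "0 \<le> u t" if "t \<in> {0..T}" for t
    proof (rule shooting_solution_nonneg[OF T contw u w Kint _ \<theta>_range(1) w0(1) _ that])
      show "integral {0..T} (\<lambda>t. K l' t (u t) (w t)) = 0" using alt(1) by (simp add: I_def)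
      show "0 \<le> K l' t (u t) (w t)" if "t \<in> {0..T}" "u t < 0" for t
        using K_neg[OF that, of l' "w t"] that by auto
    qed
    have u_le: "u t \<le> \<eta>" if "t \<in> {0..T}" for t
      using u_max[OF that] alt(2) \<eta> unfolding \<eta>_def[symmetric] by linarith
    have K_eq: "K l' t (u t) (w t) = F t (u t) (w t) + \<alpha>0 * max 0 l' * v t"
      if "t \<in> {0..T}" "\<bar>w t\<bar> \<le> N" for t
      using u_nonneg[OF that(1)] u_le[OF that(1)] l' that(2) by (intro K_inner)
    have \<beta>v: "0 \<le> \<alpha>0 * max 0 l' * v t \<and> \<alpha>0 * max 0 l' * v t \<le> \<alpha>0 * v t" if "t \<in> {0..T}" for t
    proof -
      have "\<alpha>0 * max 0 l' * v t \<le> \<alpha>0 * 1 * v t"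
        using \<alpha>0 l' v(2)[OF that] by (intro mult_right_mono mult_left_mono) auto
      then show ?thesis using \<alpha>0 v(2)[OF that] by simp
    qed
    \<comment> \<open>Up to the level \<open>N\<close> the truncation is inactive, so the original
      growth condition applies to \<open>K\<close>.\<close>
    have w_le: "\<bar>w t\<bar> \<le> N" if "t \<in> {0..T}" for t
    proof (rule Nagumo_bound[OF contw u _ w _ \<theta>_range Kint _ N(1,3) \<phi> \<Psi> G C young _ that, where \<eta> = \<eta>])
      show "0 \<le> u t \<and> u t \<le> \<eta>" if "t \<in> {0..T}" for t using u_nonneg u_le that by auto
      show "\<bar>w 0\<bar> \<le> N0" using w0 \<eta> by auto
      show "integral {0..T} G + C * \<eta> < integral {N0..N} (\<lambda>x. x powr q / \<phi> x)"
        using large by (simp add: \<eta>_def)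
      show "\<bar>K l' t (u t) (w t)\<bar> \<le> \<Psi> t * \<phi> \<bar>w t\<bar>" if t: "t \<in> {0..T}" "N0 \<le> \<bar>w t\<bar>" "\<bar>w t\<bar> \<le> N" for t
      proof -
        have "\<bar>K l' t (u t) (w t)\<bar> \<le> \<bar>F t (u t) (w t)\<bar> + \<alpha>0 * v t" using \<beta>v[OF t(1)] K_eq[OF t(1,3)] by linarith
        also have "\<dots> \<le> \<Psi> t * \<phi> \<bar>w t\<bar>"
          using u_nonneg[OF t(1)] u_le[OF t(1)] t by (intro nagumo) (auto simp: \<eta>_def)
        finally show ?thesis .
      qed
    qed auto
    have int_eq: "integral {0..t} (\<lambda>t. K l' t (u t) (w t)) = integral {0..t} (\<lambda>t. F t (u t) (w t) + \<alpha>0 * max 0 l' * v t)"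
      if "t \<in> {0..T}" for t
      using that by (intro integral_cong K_eq w_le) auto
    show thesis
    proof (rule that[of l' w u ts])
      show "(\<lambda>t. F t (u t) (w t) + \<alpha>0 * max 0 l' * v t) integrable_on {0..T}"
        by (rule integrable_eq[OF Kint K_eq[OF _ w_le]])
      show "\<bar>F t (u t) (w t) + \<alpha>0 * max 0 l' * v t\<bar> \<le> g1 t + \<alpha>0 * g2 t" if t: "t \<in> {0..T}" for t
      proof -
        have "\<bar>F t (u t) (w t)\<bar> \<le> g1 t"
          using u_nonneg[OF t] u_le[OF t] w_le[OF t] t by (intro F_bound) (auto simp: \<eta>_def)
        moreover have "\<alpha>0 * v t \<le> \<alpha>0 * g2 t" using \<alpha>0 v(2)[OF t] by (intro mult_left_mono) auto
        ultimately show ?thesis using \<beta>v[OF t] by linarith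
      qed
      have "\<theta> l' = min 1 (1 + l')" using l' by (simp add: \<theta>_def)
      then show "w t = w 0 - min 1 (1 + l') * integral {0..t} (\<lambda>t. F t (u t) (w t) + \<alpha>0 * max 0 l' * v t)"
        if "t \<in> {0..T}" for t using w[OF that] int_eq[OF that] by simp
      show "integral {0..T} (\<lambda>t. F t (u t) (w t) + \<alpha>0 * max 0 l' * v t) = 0"
        using alt(1) int_eq[of T] T by (simp add: I_def)
    qed (use l' l'_ne contw w0 u ts u_nonneg u_max alt(2) in auto)
  qed
qed


text \<open>An interior zero is a minimum. At 0 the equality \<open>w 0 = u 0\<close> decides; at
  \<open>T\<close> the one-sided minimum gives \<open>w T \<le> 0\<close>, while
  \<open>w T = w 0 = u 0 \<ge> 0\<close>.\<close>

lemma slope_zero_at_zero_min: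
  fixes u w :: "real \<Rightarrow> real"
  assumes contw: "continuous_on {0..T} w"
    and u: "\<And>t. t \<in> {0..T} \<Longrightarrow> u t = w 0 + integral {0..t} w"
    and nonneg: "\<And>t. t \<in> {0..T} \<Longrightarrow> 0 \<le> u t" and wT: "w T = w 0"
    and t0: "t0 \<in> {0..T}" "u t0 = 0"
  shows "w t0 = 0"
proof -
  have der: "(u has_real_derivative w t0) (at t0 within {0..T})"
  proof -
    have "((\<lambda>t. w 0 + integral {0..t} w) has_real_derivative 0 + w t0) (at t0 within {0..T})"
      by (intro DERIV_add DERIV_const integral_has_real_derivative contw t0(1))
    then show ?thesis using u t0(1) by (auto elim!: has_field_derivative_transform_within[of _ _ _ _ 1])
  qed
  have pos: "w t0 \<le> 0" if "0 < t0"
  proof (rule ccontr)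
    assume "\<not> w t0 \<le> 0"
    then have "0 < w t0" by simp
    from has_real_derivative_pos_inc_left[OF der this] obtain d where
      d: "d > 0" "\<And>h. 0 < h \<Longrightarrow> t0 - h \<in> {0..T} \<Longrightarrow> h < d \<Longrightarrow> u (t0 - h) < u t0" by blast
    define h where "h = min t0 (d / 2)"
    have "0 < h" "t0 - h \<in> {0..T}" "h < d" using d(1) that t0 by (auto simp: h_def)
    from d(2)[OF this] nonneg[OF this(2)] t0(2) show False by simp
  qed
  have neg: "0 \<le> w t0" if "t0 < T"
  proof (rule ccontr)
    assume "\<not> 0 \<le> w t0"
    then have "w t0 < 0" by simp
    from has_real_derivative_neg_dec_right[OF der this] obtain d where
      d: "d > 0" "\<And>h. 0 < h \<Longrightarrow> t0 + h \<in> {0..T} \<Longrightarrow> h < d \<Longrightarrow> u (t0 + h) < u t0" by blast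
    define h where "h = min (T - t0) (d / 2)"
    have "0 < h" "t0 + h \<in> {0..T}" "h < d" using d(1) that t0 by (auto simp: h_def)
    from d(2)[OF this] nonneg[OF this(2)] t0(2) show False by simp
  qed
  have w0: "w 0 = u 0" "0 \<le> u 0" using u[of 0] nonneg[of 0] t0 by auto
  show ?thesis
  proof (cases "t0 = 0 \<or> t0 = T")
    case True
    then show ?thesis
    proof
      assume "t0 = 0"
      then show ?thesis using w0 t0 by simp
    next
      assume "t0 = T"
      then show ?thesis using w0 wT pos t0 by (cases "T = 0") auto
    qed
  next
    case False
    then show ?thesis using pos neg t0 by auto
  qed
qed

lemma in_Lp_nonneg_abs: "in_Lp p T g \<Longrightarrow> in_Lp_nonneg p T (\<lambda>t. \<bar>g t\<bar>)"
  by (auto simp: in_Lp_nonneg_def in_Lp_def split: if_splits)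

theorem theorem4p1:
  fixes T r R :: real and p :: ennreal and f :: "real \<Rightarrow> real \<Rightarrow> real \<Rightarrow> real"
  assumes "0 < T" and "1 \<le> p"
    and "Lp_Caratheodory p T f"
    and "cond_f1 T f" and "cond_f2 T f" and "cond_f3 p T f"
    and "0 < r" and "0 < R" and "r \<noteq> R"
    and "hyp_Hr T f r"
    and "hyp_HR p T f R"
  shows "\<exists>u. bvp_solution T f u \<and> (\<forall>t\<in>{0..T}. 0 < u t) \<and>
           min r R < (SUP t\<in>{0..T}. u t) \<and> (SUP t\<in>{0..T}. u t) < max r R"
proof -
  define \<eta> where "\<eta> = max r R"
  have \<eta>: "0 < \<eta>" using \<open>0 < r\<close> by (auto simp: \<eta>_def)
  define q where "q = nagumo_exponent p"
  define a0 where "a0 = r / (1 + T)"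

  obtain \<phi> \<psi> where \<phi>: "continuous_on {0..} \<phi>" "\<And>x. 0 \<le> x \<Longrightarrow> 0 \<le> \<phi> x"
    and div: "\<forall>\<^sub>F M in at_top. (\<integral>\<^sup>+\<xi>\<in>{M..}. ennreal (\<xi> powr q / \<phi> \<xi>) \<partial>lborel) = \<infinity>"
    and lim: "0 < Liminf at_top (\<lambda>\<xi>. ereal (\<phi> \<xi>))" and \<psi>: "in_Lp_nonneg p T \<psi>"
    and f3: "AE t in lebesgue_on {0..T}. \<forall>s \<xi>. 0 \<le> s \<and> s \<le> \<eta> \<longrightarrow> \<bar>f t s \<xi>\<bar> \<le> \<psi> t * \<phi> \<bar>\<xi>\<bar>"
    using \<open>cond_f3 p T f\<close>[unfolded cond_f3_def, rule_format, OF \<eta>] unfolding q_def by blast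
  obtain v \<alpha>0 where v: "in_Lp_nonneg p T v" and \<alpha>0: "0 < \<alpha>0"
    and HR1: "\<And>\<alpha> u. 0 \<le> \<alpha> \<Longrightarrow> \<alpha> \<le> \<alpha>0 \<Longrightarrow> bvp_solution T (\<lambda>t s \<xi>. f t s \<xi> + \<alpha> * v t) u \<Longrightarrow>
           (\<And>t. t \<in> {0..T} \<Longrightarrow> 0 \<le> u t) \<Longrightarrow> sup_norm T u \<noteq> R"
    and HR2: "\<And>u. bvp_solution T (\<lambda>t s \<xi>. f t s \<xi> + \<alpha>0 * v t) u \<Longrightarrow>
           (\<And>t. t \<in> {0..T} \<Longrightarrow> 0 \<le> u t \<and> u t \<le> R) \<Longrightarrow> False"
    using \<open>hyp_HR p T f R\<close> unfolding hyp_HR_def by blast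
  have Hr1: "(LINT t|lebesgue_on {0..T}. f t (a0 + a0 * t) a0) < 0"
    and Hr2: "\<And>\<theta> u. 0 < \<theta> \<Longrightarrow> \<theta> \<le> 1 \<Longrightarrow> bvp_solution T (\<lambda>t s \<xi>. \<theta> * f t s \<xi>) u \<Longrightarrow>
        (\<And>t. t \<in> {0..T} \<Longrightarrow> 0 < u t) \<Longrightarrow> sup_norm T u \<noteq> r"
    using \<open>hyp_Hr T f r\<close> unfolding hyp_Hr_def Let_def a0_def by blast+
  obtain kk \<rho> where kk: "in_Lp_nonneg 1 T kk" and \<rho>: "0 < \<rho>"
    and f2: "AE t in lebesgue_on {0..T}. \<forall>s \<xi>. 0 \<le> s \<and> s \<le> \<rho> \<and> \<bar>\<xi>\<bar> \<le> \<rho> \<longrightarrow>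
           \<bar>f t s \<xi>\<bar> \<le> kk t * (\<bar>s\<bar> + \<bar>\<xi>\<bar>)"
    using \<open>cond_f2 T f\<close> unfolding cond_f2_def by blast
  have f1: "AE t in lebesgue_on {0..T}. \<forall>\<xi>. f t 0 \<xi> = 0" using \<open>cond_f1 T f\<close> by (simp add: cond_f1_def)

  obtain G\<psi> C\<psi> where G\<psi>: "0 \<le> C\<psi>" "G\<psi> integrable_on {0..T}" "\<And>t. 0 \<le> G\<psi> t"
    "AE t in lebesgue_on {0..T}. 0 \<le> \<psi> t \<and> (\<forall>x\<ge>1. \<psi> t * x powr q \<le> G\<psi> t + C\<psi> * x)"
    using Lp_mult_powr_bound[OF \<open>1 \<le> p\<close> \<psi>, folded q_def] by blast
  obtain Gv Cv where Gv: "0 \<le> Cv" "Gv integrable_on {0..T}" "\<And>t. 0 \<le> Gv t"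
    "AE t in lebesgue_on {0..T}. 0 \<le> v t \<and> (\<forall>x\<ge>1. v t * x powr q \<le> Gv t + Cv * x)"
    using Lp_mult_powr_bound[OF \<open>1 \<le> p\<close> v, folded q_def] by blast
  \<comment> \<open>For \<open>p = 1\<close> the power is \<open>x powr 0\<close>; taken at
    \<open>x = 1\<close>, this replaces \<open>kk\<close> by the integrable majorant
    \<open>Gk + Ck\<close>, which is non-negative everywhere.\<close>
  obtain Gk Ck where Gk: "0 \<le> Ck" "Gk integrable_on {0..T}" "\<And>t. 0 \<le> Gk t"
    "AE t in lebesgue_on {0..T}. 0 \<le> kk t \<and> (\<forall>x\<ge>1. kk t * x powr nagumo_exponent 1 \<le> Gk t + Ck * x)"
    using Lp_mult_powr_bound[OF order_refl kk] by blast

  obtain c where c: "0 < c" "ereal c < Liminf at_top (\<lambda>\<xi>. ereal (\<phi> \<xi>))"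
    using ereal_dense2[OF lim] by auto
  have "\<forall>\<^sub>F x in at_top. ereal c < ereal (\<phi> x)" by (rule less_LiminfD[OF c(2)])
  then obtain N1 where N1: "\<And>x. N1 \<le> x \<Longrightarrow> c < \<phi> x" by (auto simp: eventually_at_top_linorder)
  obtain M0 where M0: "\<And>M. M0 \<le> M \<Longrightarrow> (\<integral>\<^sup>+\<xi>\<in>{M..}. ennreal (\<xi> powr q / \<phi> \<xi>) \<partial>lborel) = \<infinity>"
    using div by (auto simp: eventually_at_top_linorder)
  define N0 where "N0 = max 1 (max \<eta> (max N1 M0))"
  have N0: "1 \<le> N0" "\<eta> \<le> N0" "N1 \<le> N0" "M0 \<le> N0" by (auto simp: N0_def)
  \<comment> \<open>Since \<open>\<phi>\<close> exceeds \<open>c\<close> beyond \<open>N0\<close>,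
    the forcing term obeys \<open>\<alpha>0 * v t \<le> \<alpha>0 / c * v t * \<phi> x\<close> and
    is absorbed by enlarging \<open>\<psi>\<close>. \<open>G\<close> and \<open>C\<close> are the
    Young data of the enlarged function.\<close>
  define G where "G = (\<lambda>t. G\<psi> t + \<alpha>0 / c * Gv t)"
  define C where "C = C\<psi> + \<alpha>0 / c * Cv"
  have G: "G integrable_on {0..T}" "\<And>t. 0 \<le> G t" "0 \<le> C"
    unfolding G_def C_def using G\<psi> Gv c \<alpha>0 by (auto intro!: integrable_add integrable_on_mult_right)
  have \<phi>_pos: "0 < \<phi> x" if "N0 \<le> x" for x using N1[of x] that N0 c by linarith
  have "\<exists>N\<ge>N0. integral {0..T} G + C * \<eta> < integral {N0..N} (\<lambda>x. x powr q / \<phi> x)"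
  proof (rule integral_unbounded_of_nn_integral)
    show "continuous_on {N0..} (\<lambda>x. x powr q / \<phi> x)"
      using N0 \<phi>_pos by (intro continuous_intros continuous_on_subset[OF \<phi>(1)]) force+
    show "0 \<le> x powr q / \<phi> x" if "N0 \<le> x" for x using \<phi>_pos[OF that] by simp
    show "(\<integral>\<^sup>+\<xi>\<in>{N0..}. ennreal (\<xi> powr q / \<phi> \<xi>) \<partial>lborel) = \<infinity>" by (rule M0[OF N0(4)])
  qed
  then obtain N where N: "N0 \<le> N" "integral {0..T} G + C * \<eta> < integral {N0..N} (\<lambda>x. x powr q / \<phi> x)" by blast
  have "0 \<le> integral {0..T} G + C * \<eta>" using G \<eta> by (intro add_nonneg_nonneg integral_nonneg) auto
  then have "N0 \<noteq> N" using N(2) by auto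
  then have N0N: "N0 < N" using N(1) by simp

  have "0 < N" using N0 N0N by linarith
  then obtain gc where gc: "in_Lp p T gc" "AE t in lebesgue_on {0..T}. \<forall>s \<xi>. 0 \<le> s \<and> \<bar>s\<bar> \<le> N \<and> \<bar>\<xi>\<bar> \<le> N \<longrightarrow> \<bar>f t s \<xi>\<bar> \<le> gc t"
    using \<open>Lp_Caratheodory p T f\<close> unfolding Lp_Caratheodory_def by blast
  obtain Gc Cc where Gc: "0 \<le> Cc" "Gc integrable_on {0..T}" "\<And>t. 0 \<le> Gc t"
    "AE t in lebesgue_on {0..T}. 0 \<le> \<bar>gc t\<bar> \<and> (\<forall>x\<ge>1. \<bar>gc t\<bar> * x powr q \<le> Gc t + Cc * x)"
    using Lp_mult_powr_bound[OF \<open>1 \<le> p\<close> in_Lp_nonneg_abs[OF gc(1)], folded q_def] by blast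
  have f_cont: "AE t in lebesgue_on {0..T}. continuous_on ({0..} \<times> UNIV) (\<lambda>(s, \<xi>). f t s \<xi>)"
    and f_meas: "\<And>s \<xi>. 0 \<le> s \<Longrightarrow> (\<lambda>t. f t s \<xi>) \<in> borel_measurable (lebesgue_on {0..T})"
    using \<open>Lp_Caratheodory p T f\<close> unfolding Lp_Caratheodory_def by auto

  define A where "A = (\<lambda>t. continuous_on ({0..} \<times> UNIV) (\<lambda>(s, \<xi>). f t s \<xi>) \<and> (\<forall>\<xi>. f t 0 \<xi> = 0) \<and>
    (\<forall>s \<xi>. 0 \<le> s \<and> s \<le> \<rho> \<and> \<bar>\<xi>\<bar> \<le> \<rho> \<longrightarrow> \<bar>f t s \<xi>\<bar> \<le> (Gk t + Ck) * (\<bar>s\<bar> + \<bar>\<xi>\<bar>)) \<and>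
    (\<forall>s \<xi>. 0 \<le> s \<and> s \<le> \<eta> \<longrightarrow> \<bar>f t s \<xi>\<bar> \<le> \<psi> t * \<phi> \<bar>\<xi>\<bar>) \<and>
    (\<forall>s \<xi>. 0 \<le> s \<and> s \<le> \<eta> \<and> \<bar>\<xi>\<bar> \<le> N \<longrightarrow> \<bar>f t s \<xi>\<bar> \<le> Gc t + Cc) \<and>
    0 \<le> \<psi> t \<and> (\<forall>x\<ge>1. \<psi> t * x powr q \<le> G\<psi> t + C\<psi> * x) \<and>
    0 \<le> v t \<and> (\<forall>x\<ge>1. v t * x powr q \<le> Gv t + Cv * x))"
  have "AE t in lebesgue_on {0..T}. A t"
    using f_cont f1 f2 f3 gc(2) G\<psi>(4) Gv(4) Gk(4) Gc(4)
  proof eventually_elim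
    case (elim t)
    have "kk t \<le> Gk t + Ck" using elim(8) by (auto dest!: spec[of _ 1])
    have k': "\<bar>f t s \<xi>\<bar> \<le> (Gk t + Ck) * (\<bar>s\<bar> + \<bar>\<xi>\<bar>)" if "0 \<le> s" "s \<le> \<rho>" "\<bar>\<xi>\<bar> \<le> \<rho>" for s \<xi>
    proof -
      have "\<bar>f t s \<xi>\<bar> \<le> kk t * (\<bar>s\<bar> + \<bar>\<xi>\<bar>)" using elim(3) that by blast
      also have "\<dots> \<le> (Gk t + Ck) * (\<bar>s\<bar> + \<bar>\<xi>\<bar>)" using \<open>kk t \<le> Gk t + Ck\<close> by (intro mult_right_mono) auto
      finally show ?thesis .
    qed
    have "gc t \<le> Gc t + Cc" using elim(9) by (auto dest!: spec[of _ 1])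
    have c': "\<bar>f t s \<xi>\<bar> \<le> Gc t + Cc" if "0 \<le> s" "s \<le> \<eta>" "\<bar>\<xi>\<bar> \<le> N" for s \<xi>
    proof -
      have "\<bar>f t s \<xi>\<bar> \<le> gc t" using elim(5) that N0 N0N by auto
      then show ?thesis using \<open>gc t \<le> Gc t + Cc\<close> by simp
    qed
    show ?case unfolding A_def using elim k' c' by blast
  qed
  \<comment> \<open>Replacing \<open>f\<close> by \<open>0\<close> on the null set \<open>S\<close> makes every almost-everywhere condition hold pointwise.\<close>
  define S where "S = {t \<in> {0..T}. \<not> A t}"
  have negl: "negligible S"
    unfolding S_def by (rule AE_lebesgue_on_imp_negligible[OF \<open>AE t in lebesgue_on {0..T}. A t\<close>]) simp
  then have Smeas: "S \<inter> space (lebesgue_on {0..T}) \<in> sets (lebesgue_on {0..T})"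
    using negligible_imp_sets[OF negl] by (auto simp: sets_restrict_space S_def)
  have A: "A t" if "t \<in> {0..T}" "t \<notin> S" for t using that by (simp add: S_def)

  define F where "F = (\<lambda>t s x. if t \<in> S then 0 else f t s x)"
  define V where "V = (\<lambda>t. if t \<in> S then 0 else v t)"
  define \<Psi> where "\<Psi> = (\<lambda>t. if t \<in> S then 0 else \<psi> t + \<alpha>0 / c * v t)"
  define g1 where "g1 = (\<lambda>t. Gc t + Cc)"
  define g2 where "g2 = (\<lambda>t. Gv t + Cv)"
  have v_meas: "v \<in> borel_measurable (lebesgue_on {0..T})" and \<psi>_meas: "\<psi> \<in> borel_measurable (lebesgue_on {0..T})"
    using v \<psi> by (auto simp: in_Lp_nonneg_def in_Lp_def)
  have V: "0 \<le> V t \<and> V t \<le> g2 t" if "t \<in> {0..T}" for t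
    using A[OF that] Gv(1) Gv(3)[of t] by (auto simp: V_def g2_def A_def dest!: spec[of _ 1])
  have g: "g1 integrable_on {0..T}" "g2 integrable_on {0..T}"
    unfolding g1_def g2_def using Gc Gv by (auto intro!: integrable_add integrable_const_ivl)
  have young: "\<Psi> t * x powr q \<le> G t + C * x" if "t \<in> {0..T}" "1 \<le> x" for t x
  proof (cases "t \<in> S")
    case True
    then show ?thesis using G that by (simp add: \<Psi>_def)
  next
    case False
    have 1: "\<psi> t * x powr q \<le> G\<psi> t + C\<psi> * x" "v t * x powr q \<le> Gv t + Cv * x"
      using A[OF that(1) False] that(2) by (auto simp: A_def)
    have "\<alpha>0 / c * (v t * x powr q) \<le> \<alpha>0 / c * (Gv t + Cv * x)"
      using 1(2) \<alpha>0 c by (intro mult_left_mono) auto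
    then show ?thesis using 1(1) False by (simp add: \<Psi>_def G_def C_def algebra_simps)
  qed
  have \<Psi>_nonneg: "0 \<le> \<Psi> t" if "t \<in> {0..T}" for t
    using A[OF that] \<alpha>0 c by (auto simp: \<Psi>_def A_def)
  have \<Psi>_int: "\<Psi> integrable_on {0..T}"
  proof (rule measurable_bounded_by_integrable_imp_integrable)
    show "\<Psi> \<in> borel_measurable (lebesgue_on {0..T})"
      unfolding \<Psi>_def by (intro measurable_If_set Smeas borel_measurable_add borel_measurable_times
          borel_measurable_const v_meas \<psi>_meas)
    show "(\<lambda>t. G t + C * 1) integrable_on {0..T}" using G by (intro integrable_add integrable_const_ivl)
    show "norm (\<Psi> t) \<le> G t + C * 1" if "t \<in> {0..T}" for t
      using young[OF that, of 1] \<Psi>_nonneg[OF that] by simp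
  qed simp
  have nag: "\<bar>F t s x\<bar> + \<alpha>0 * V t \<le> \<Psi> t * \<phi> \<bar>x\<bar>"
    if "t \<in> {0..T}" "0 \<le> s" "s \<le> max r R" "N0 \<le> \<bar>x\<bar>" "\<bar>x\<bar> \<le> N" for t s x
  proof (cases "t \<in> S")
    case True
    then show ?thesis by (simp add: F_def V_def \<Psi>_def)
  next
    case False
    have 1: "\<bar>f t s x\<bar> \<le> \<psi> t * \<phi> \<bar>x\<bar>" "0 \<le> v t"
      using A[OF that(1) False] that by (auto simp: A_def \<eta>_def)
    have "\<alpha>0 * v t = \<alpha>0 / c * v t * c" using c by simp
    also have "\<dots> \<le> \<alpha>0 / c * v t * \<phi> \<bar>x\<bar>"
      using N1[of "\<bar>x\<bar>"] that N0 1 \<alpha>0 c by (intro mult_left_mono) auto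
    finally show ?thesis using 1 False by (simp add: F_def V_def \<Psi>_def algebra_simps)
  qed
  have neg: "integral {0..T} (\<lambda>t. F t (a0 + a0 * t) a0) < 0"
  proof -
    \<comment> \<open>A non-integrable function has Bochner integral 0 by convention, so the strict
      sign forces integrability.\<close>
    have "integrable (lebesgue_on {0..T}) (\<lambda>t. f t (a0 + a0 * t) a0)"
      using Hr1 not_integrable_integral_eq by fastforce
    then have "integral {0..T} (\<lambda>t. f t (a0 + a0 * t) a0) < 0"
      using Hr1 by (subst (asm) lebesgue_integral_eq_integral) auto
    moreover have "integral {0..T} (\<lambda>t. f t (a0 + a0 * t) a0) = integral {0..T} (\<lambda>t. F t (a0 + a0 * t) a0)"
      by (rule integral_spike[OF negl]) (simp add: F_def)
    ultimately show ?thesis by simp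
  qed

  show ?thesis
  proof (rule shooting_alternative[of T r R \<alpha>0 F N g1 V g2 N0 \<Psi> \<phi> G C q])
    show "0 < T" "0 < r" "0 < R" "0 \<le> \<alpha>0" "1 \<le> N0" "max r R \<le> N0" "N0 < N" "0 \<le> C"
      using \<open>0 < T\<close> \<open>0 < r\<close> \<open>0 < R\<close> \<alpha>0 N0 N0N G by (auto simp: \<eta>_def)
    show "g1 integrable_on {0..T}" "g2 integrable_on {0..T}" "\<Psi> integrable_on {0..T}" "G integrable_on {0..T}"
      by (fact g \<Psi>_int G(1))+
    show "(\<lambda>t. F t s x) \<in> borel_measurable (lebesgue_on {0..T})" if "0 \<le> s" for s x
      unfolding F_def by (intro measurable_If_set Smeas borel_measurable_const f_meas that)
    show "continuous_on ({0..} \<times> UNIV) (\<lambda>(s, x). F t s x)" if "t \<in> {0..T}" for t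
    proof (cases "t \<in> S")
      case True
      then show ?thesis by (simp add: F_def case_prod_unfold)
    next
      case False
      then show ?thesis using A[OF that False] by (simp add: F_def A_def)
    qed
    show "\<bar>F t s x\<bar> \<le> g1 t" if "t \<in> {0..T}" "0 \<le> s" "s \<le> max r R" "\<bar>x\<bar> \<le> N" for t s x
      using A[OF that(1)] that Gc(1) Gc(3)[of t] by (auto simp: F_def A_def g1_def \<eta>_def)
    show "F t 0 x = 0" if "t \<in> {0..T}" for t x
      using A[OF that] by (auto simp: F_def A_def)
    show "V \<in> borel_measurable (lebesgue_on {0..T})"
      unfolding V_def by (intro measurable_If_set Smeas borel_measurable_const v_meas)
    show "0 \<le> V t \<and> V t \<le> g2 t" if "t \<in> {0..T}" for t by (rule V[OF that])
    show "\<bar>F t s x\<bar> + \<alpha>0 * V t \<le> \<Psi> t * \<phi> \<bar>x\<bar>"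
      if "t \<in> {0..T}" "0 \<le> s" "s \<le> max r R" "N0 \<le> \<bar>x\<bar>" "\<bar>x\<bar> \<le> N" for t s x by (rule nag[OF that])
    show "continuous_on {N0..N} \<phi>" by (rule continuous_on_subset[OF \<phi>(1)]) (use N0 in auto)
    show "0 < \<phi> x" if "x \<in> {N0..N}" for x using \<phi>_pos that by auto
    show "0 \<le> \<Psi> t" if "t \<in> {0..T}" for t by (rule \<Psi>_nonneg[OF that])
    show "0 \<le> G t" if "t \<in> {0..T}" for t by (rule G(2))
    show "\<Psi> t * x powr q \<le> G t + C * x" if "t \<in> {0..T}" "1 \<le> x" for t x by (rule young[OF that])
    show "integral {0..T} G + C * max r R < integral {N0..N} (\<lambda>x. x powr q / \<phi> x)"
      using N(2) by (simp add: \<eta>_def)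
    show "integral {0..T} (\<lambda>t. F t (r / (1 + T) + r / (1 + T) * t) (r / (1 + T))) < 0"
      using neg by (simp add: a0_def)
  next
    fix l ts :: real and u w :: "real \<Rightarrow> real"
    define k where "k = (\<lambda>t. F t (u t) (w t) + \<alpha>0 * max 0 l * V t)"
    assume l: "-1 < l" "l \<le> 1" and contw: "continuous_on {0..T} w" and w0: "0 \<le> w 0"
      and u: "\<And>t. t \<in> {0..T} \<Longrightarrow> u t = w 0 + integral {0..t} w"
      and k_int: "(\<lambda>t. F t (u t) (w t) + \<alpha>0 * max 0 l * V t) integrable_on {0..T}"
      and k_bound: "\<And>t. t \<in> {0..T} \<Longrightarrow> \<bar>F t (u t) (w t) + \<alpha>0 * max 0 l * V t\<bar> \<le> g1 t + \<alpha>0 * g2 t"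
      and w: "\<And>t. t \<in> {0..T} \<Longrightarrow> w t = w 0 - min 1 (1 + l) * integral {0..t} (\<lambda>t. F t (u t) (w t) + \<alpha>0 * max 0 l * V t)"
      and total: "integral {0..T} (\<lambda>t. F t (u t) (w t) + \<alpha>0 * max 0 l * V t) = 0"
      and ts: "ts \<in> {0..T}" and u_range: "\<And>t. t \<in> {0..T} \<Longrightarrow> 0 \<le> u t \<and> u t \<le> u ts"
      and alt: "l \<le> 0 \<and> u ts = r \<or> 0 \<le> l \<and> u ts = R \<or>
        l = 0 \<and> min r R \<le> u ts \<and> u ts \<le> max r R \<or> l = 1 \<and> u ts \<le> R"
    note k_int = k_int[folded k_def] and w = w[folded k_def] and total = total[folded k_def]
    have k_bound: "\<bar>k t\<bar> \<le> g1 t + \<alpha>0 * g2 t" if "t \<in> {0..T}" for t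
      unfolding k_def by (rule k_bound[OF that])
    define \<theta> where "\<theta> = min 1 (1 + l)"
    have \<theta>: "0 < \<theta>" "\<theta> \<le> 1" using l by (auto simp: \<theta>_def)
    have w': "w t = w 0 - integral {0..t} (\<lambda>t. \<theta> * k t)" if "t \<in> {0..T}" for t
      using w[OF that] by (simp add: \<theta>_def)
    have \<theta>k: "\<bar>\<theta> * k t\<bar> \<le> \<bar>k t\<bar>" for t using \<theta> by (simp add: abs_mult mult_left_le_one_le)
    \<comment> \<open>Stated for an arbitrary \<open>H\<close> to serve both homotopies:
      \<open>\<theta>\<close> times \<open>f\<close> for \<open>l \<le> 0\<close>, and
      \<open>f\<close> plus forcing for \<open>l \<ge> 0\<close>, where
      \<open>\<theta> = 1\<close>.\<close>
    have bvp: "bvp_solution T H u" if H: "\<And>t. t \<in> {0..T} \<Longrightarrow> t \<notin> S \<Longrightarrow> H t (u t) (w t) = \<theta> * k t" for H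
    proof (rule bvp_solution_integral[OF \<open>0 < T\<close> _ _ _ w' u])
      show "(\<lambda>t. g1 t + \<alpha>0 * g2 t) integrable_on {0..T}"
        by (intro integrable_add integrable_on_mult_right g)
      show "(\<lambda>t. \<theta> * k t) integrable_on {0..T}" by (intro integrable_on_mult_right k_int)
      show "\<bar>\<theta> * k t\<bar> \<le> g1 t + \<alpha>0 * g2 t" if "t \<in> {0..T}" for t
        using \<theta>k[of t] k_bound[OF that] by linarith
      show "integral {0..T} (\<lambda>t. \<theta> * k t) = 0" using total by simp
      show "AE t in lebesgue_on {0..T}. H t (u t) (w t) = \<theta> * k t"
        by (rule AE_lebesgue_on_negligible[OF negl H]) auto
    qed
    have sup_u: "(SUP t\<in>{0..T}. u t) = u ts"
      using ts u_range by (intro cSup_eq_maximum) auto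
    have "sup_norm T u = (SUP t\<in>{0..T}. u t)"
      unfolding sup_norm_def using u_range by (intro SUP_cong) auto
    then have sup_norm_u: "sup_norm T u = u ts" using sup_u by simp
    \<comment> \<open>A zero of the non-negative \<open>u\<close> is also a zero of
      \<open>w\<close>, and then (f_2) forces \<open>u\<close> to vanish identically. The
      restriction \<open>l \<le> 0\<close> removes the forcing term, for which no linear growth
      bound is available.\<close>
    have positive: "0 < u t" if "l \<le> 0" "0 < u ts" "t \<in> {0..T}" for t
    proof (rule ccontr)
      assume "\<not> 0 < u t"
      then have "u t = 0" using u_range[OF that(3)] by simp
      have "w T = w 0" using w[of T] total \<open>0 < T\<close> by simp
      with \<open>u t = 0\<close> have "w t = 0"
        using u_range that(3) by (intro slope_zero_at_zero_min[OF contw u]) auto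
      have "u ts = 0"
      proof (rule linear_growth_unique_zero[OF contw u w' _ _ _ \<rho> _ that(3) \<open>u t = 0\<close> \<open>w t = 0\<close> ts])
        show "(\<lambda>t. \<theta> * k t) integrable_on {0..T}" by (intro integrable_on_mult_right k_int)
        show "(\<lambda>t. Gk t + Ck) integrable_on {0..T}" using Gk by (intro integrable_add integrable_const_ivl)
        show "0 \<le> Gk t + Ck" for t using Gk by simp
        fix s assume s: "s \<in> {0..T}" "\<bar>u s\<bar> \<le> \<rho>" "\<bar>w s\<bar> \<le> \<rho>"
        have "\<bar>k s\<bar> \<le> (Gk s + Ck) * (\<bar>u s\<bar> + \<bar>w s\<bar>)"
          using A[OF s(1)] s(2,3) u_range[OF s(1)] that(1) Gk(1) Gk(3)[of s]
          by (auto simp: k_def F_def A_def)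
        then show "\<bar>\<theta> * k s\<bar> \<le> (Gk s + Ck) * (\<bar>u s\<bar> + \<bar>w s\<bar>)" using \<theta>k[of s] by linarith
      qed
      then show False using that(2) by simp
    qed
    have not_r: "u ts \<noteq> r" if "l \<le> 0"
    proof
      assume "u ts = r"
      then have "0 < u ts" using \<open>0 < r\<close> by simp
      have "bvp_solution T (\<lambda>t s \<xi>. \<theta> * f t s \<xi>) u"
        by (rule bvp) (use that in \<open>auto simp: k_def F_def\<close>)
      from Hr2[OF \<theta> this positive[OF that \<open>0 < u ts\<close>]] show False using sup_norm_u \<open>u ts = r\<close> by simp
    qed
    have bvp_\<alpha>: "bvp_solution T (\<lambda>t s \<xi>. f t s \<xi> + \<alpha>0 * l * v t) u" if "0 \<le> l"
      by (rule bvp) (use that in \<open>auto simp: k_def F_def V_def \<theta>_def\<close>)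
    have not_R: "u ts \<noteq> R" if "0 \<le> l"
    proof -
      have "\<alpha>0 * l \<le> \<alpha>0" "0 \<le> \<alpha>0 * l" using \<alpha>0 l that by (auto intro: mult_left_le)
      then have "sup_norm T u \<noteq> R" using u_range by (intro HR1[OF _ _ bvp_\<alpha>[OF that]]) auto
      then show ?thesis using sup_norm_u by simp
    qed
    have "\<not> (l = 1 \<and> u ts \<le> R)"
    proof
      assume *: "l = 1 \<and> u ts \<le> R"
      then have "bvp_solution T (\<lambda>t s \<xi>. f t s \<xi> + \<alpha>0 * v t) u" using bvp_\<alpha> by simp
      moreover have "0 \<le> u t \<and> u t \<le> R" if "t \<in> {0..T}" for t using u_range[OF that] * by auto
      ultimately show False by (rule HR2)
    qed
    \<comment> \<open>The value \<open>l = 0\<close> belongs to both homotopies, so both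
      \<open>not_r\<close> and \<open>not_R\<close> apply to it; this makes the final inequalities
      strict.\<close>
    then have l0: "l = 0" "min r R \<le> u ts" "u ts \<le> max r R" using alt not_r not_R by auto
    have "min r R < u ts" "u ts < max r R" using l0 not_r not_R by (auto simp: min_def max_def split: if_splits)
    moreover have "0 < u t" if "t \<in> {0..T}" for t
      using positive[OF _ _ that] l0 \<open>0 < r\<close> \<open>0 < R\<close> by (auto simp: min_def split: if_splits)
    moreover have "bvp_solution T f u" using bvp_\<alpha> l0(1) by simp
    ultimately show ?thesis using sup_u by auto
  qed
qed

end
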